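(* Consider the two-Higgs-doublet model (2HDM) Lagrangian $\mathcal{L}$ in $d=4$ spacetime dimensions, with gauge couplings $g\neq 0$, $g'\neq 0$, common hypercharge $Y\neq 0$ of the two doublets, and an arbitrary choice of the parameters of its general renormalizable potential $V$ (real $m_{11}^2,m_{22}^2,\lambda_1,\lambda_2,\lambda_3,\lambda_4$ and complex $m_{12}^2,\lambda_5,\lambda_6,\lambda_7$). Let $\mathfrak{g}_{\mathrm{EL}}$ be the Lie algebra of all scalar Lie point symmetries of the Euler-Lagrange equations $E(\mathcal{L})=0$, let $\mathfrak{g}_{\mathrm{var}}$ be the subalgebra of variational ones and $\mathfrak{g}_{\mathrm{svar}}$ the subalgebra of strictly variational ones. Then: (a) $\mathfrak{g}_{\mathrm{svar}}=\mathfrak{g}_{\mathrm{var}}=\mathfrak{g}_{\mathrm{EL}}$; that is, the 2HDM has no scalar Lie point divergence symmetries and no scalar non-variational Lie point symmetries. (b) Up to a change of Higgs basis, $\mathfrak{g}_{\mathrm{EL}}$ is one of the following three Lie algebras, each of which occurs for some choice of the parameters of $V$: $$\operatorname{span}(H_1,H_2,H_3,X_Y)\cong\mathfrak{su}(2)\oplus\mathfrak{u}(1)_Y,\qquad \operatorname{span}(H_3,X_Y)\cong\mathfrak{u}(1)\oplus\mathfrak{u}(1)_Y,\qquad \operatorname{span}(X_Y)=\mathfrak{u}(1)_Y .$$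
   Context: **The model.** Spacetime is 4-dimensional Minkowski space with coordinates $x^0,\dots,x^3$; indices are raised with the Minkowski metric and repeated indices are summed. The Lagrangian is $$\mathcal{L}=-\tfrac14 W^a_{\mu\nu}W^{a\mu\nu}-\tfrac14 B_{\mu\nu}B^{\mu\nu}+\sum_{i=1}^2(D_\mu\Phi_i)^\dagger(D^\mu\Phi_i)-V(\Phi_1,\Phi_2),$$ with $$D_\mu=\partial_\mu+ig\tfrac{\sigma^a}{2}W^a_\mu+ig'YB_\mu,\quad W^a_{\mu\nu}=\partial_\mu W^a_\nu-\partial_\nu W^a_\mu+g\,\epsilon^{abc}W^b_\mu W^c_\nu,\quad B_{\mu\nu}=\partial_\mu B_\nu-\partial_\nu B_\mu,$$ where $\sigma^a$ ($a=1,2,3$) are the Pauli matrices and $$\Phi_1=\tfrac1{\sqrt2}\begin{pmatrix}\phi_1+i\phi_2\\ \phi_3+i\phi_4\end{pmatrix},\qquad \Phi_2=\tfrac1{\sqrt2}\begin{pmatrix}\phi_5+i\phi_6\\ \phi_7+i\phi_8\end{pmatrix}$$ with real scalar fields $\phi_1,\dots,\phi_8$; the gauge fields $W^a_\mu,B_\mu$ are real. The potential is $$\begin{aligned}V={}&m_{11}^2\Phi_1^\dagger\Phi_1+m_{22}^2\Phi_2^\dagger\Phi_2-[m_{12}^2\Phi_1^\dagger\Phi_2+\text{h.c.}]+\tfrac{\lambda_1}{2}(\Phi_1^\dagger\Phi_1)^2+\tfrac{\lambda_2}{2}(\Phi_2^\dagger\Phi_2)^2\\&+\lambda_3(\Phi_1^\dagger\Phi_1)(\Phi_2^\dagger\Phi_2)+\lambda_4(\Phi_1^\dagger\Phi_2)(\Phi_2^\dagger\Phi_1)\\&+\Big[\tfrac{\lambda_5}{2}(\Phi_1^\dagger\Phi_2)^2+\lambda_6(\Phi_1^\dagger\Phi_1)(\Phi_1^\dagger\Phi_2)+\lambda_7(\Phi_2^\dagger\Phi_2)(\Phi_1^\dagger\Phi_2)+\text{h.c.}\Big],\end{aligned}$$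 where h.c. denotes the Hermitian conjugate. The 24 dependent variables are $y=(\phi_1,\dots,\phi_8,B_0,\dots,B_3,W^1_0,\dots,W^3_3)$. **Euler operator.** $E=(E_1,\dots,E_{24})$ with $E_i(\mathcal{L})=\frac{\partial\mathcal{L}}{\partial y^i}-d_\mu\frac{\partial\mathcal{L}}{\partial y^i_{,\mu}}$, where $d_\mu$ is the total derivative with respect to $x^\mu$ and $y^i_{,\mu}=\partial y^i/\partial x^\mu$. **Scalar Lie point symmetries.** A scalar generator is a vector field $X=\sum_{i=1}^8\eta^i\,\partial_{\phi_i}$ transforming only the scalar fields: no component along spacetime variables or gauge fields, and smooth coefficients $\eta^i=\eta^i(y)$ with no explicit dependence on $x$. Its prolongation to the jet space is $\operatorname{pr}X=\sum_{i,J}(D_J\eta^i)\,\partial/\partial \phi_{i,J}$, where $J$ runs over all multi-indices, $D_J$ is the iterated total derivative, and $\phi_{i,J}$ is the corresponding derivative of $\phi_i$. $X$ is a (Lie point) symmetry of $E(\mathcal{L})=0$ if $\operatorname{pr}X(E_i(\mathcal{L}))=0$ whenever $E(\mathcal{L})=0$, for all $i=1,\dots,24$. $X$ is variational if $\operatorname{pr}X(\mathcal{L})=d_\mu\beta^\mu$ identically, for some local functions $\beta^\mu$ of $x$, $y$ and finitely many derivatives of $y$. It is strictly variational if $\operatorname{pr}X(\mathcal{L})=0$, and a divergence symmetry if it is variational but not strictly variational. A non-variational symmetry is a symmetry of $E(\mathcal{L})=0$ that is not variational. **Change of Higgs basis.** A change of Higgs basis replaces $(\Phi_1,\Phi_2)^T$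 by $U(\Phi_1,\Phi_2)^T$ with $U\in\mathsf{U}(2)$, with the parameters of $V$ redefined so that the value of the Lagrangian is unchanged. "Up to a change of Higgs basis" means that there is such a $U$ for which the symmetry algebra, expressed in the new field components, equals the listed algebra. **Generators.** $$X_Y=-\phi_2\partial_{\phi_1}+\phi_1\partial_{\phi_2}-\phi_4\partial_{\phi_3}+\phi_3\partial_{\phi_4}-\phi_6\partial_{\phi_5}+\phi_5\partial_{\phi_6}-\phi_8\partial_{\phi_7}+\phi_7\partial_{\phi_8},$$ $$H_1=\phi_6\partial_{\phi_1}-\phi_5\partial_{\phi_2}+\phi_8\partial_{\phi_3}-\phi_7\partial_{\phi_4}+\phi_2\partial_{\phi_5}-\phi_1\partial_{\phi_6}+\phi_4\partial_{\phi_7}-\phi_3\partial_{\phi_8},$$ $$H_2=\phi_5\partial_{\phi_1}+\phi_6\partial_{\phi_2}+\phi_7\partial_{\phi_3}+\phi_8\partial_{\phi_4}-\phi_1\partial_{\phi_5}-\phi_2\partial_{\phi_6}-\phi_3\partial_{\phi_7}-\phi_4\partial_{\phi_8},$$ $$H_3=\phi_2\partial_{\phi_1}-\phi_1\partial_{\phi_2}+\phi_4\partial_{\phi_3}-\phi_3\partial_{\phi_4}-\phi_6\partial_{\phi_5}+\phi_5\partial_{\phi_6}-\phi_8\partial_{\phi_7}+\phi_7\partial_{\phi_8}.$$ Spans are over $\mathbb{R}$. *)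

theory Defs
  imports "HOL-Analysis.Analysis" "HOL-Library.Function_Algebras"
begin

instantiation "fun" :: (type, scaleR) scaleR
begin
definition scaleR_fun :: "real \<Rightarrow> ('a \<Rightarrow> 'b) \<Rightarrow> 'a \<Rightarrow> 'b"
  where "scaleR_fun r f = (\<lambda>x. r *\<^sub>R f x)"
instance ..
end

instance "fun" :: (type, real_vector) real_vector
  by standard (simp_all add: scaleR_fun_def plus_fun_def fun_eq_iff algebra_simps)

text \<open>Points are functions from coordinate labels to reals; continuity refers to the product
  topology. This covers both the 24-dimensional space of the fields and the infinite jet space.\<close>

definition pd :: "'c \<Rightarrow> (('c \<Rightarrow> real) \<Rightarrow> real) \<Rightarrow> ('c \<Rightarrow> real) \<Rightarrow> real"
  where "pd c F z = deriv (\<lambda>t. F (z(c := t))) (z c)"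

definition smooth :: "(('c \<Rightarrow> real) \<Rightarrow> real) \<Rightarrow> bool"
  where "smooth F \<longleftrightarrow> (\<forall>cs. continuous_on UNIV (foldr pd cs F) \<and>
    (\<forall>c z. (\<lambda>t. foldr pd cs F (z(c := t))) field_differentiable (at (z c))))"

text \<open>In the numeral types, \<open>4\<close> has the elements 0, 1, 2, 3; \<open>3\<close> has the elements 1, 2, 3
  (with 3 = 0); \<open>8\<close> has the elements 1, ..., 8 (with 8 = 0).\<close>

datatype dep_var = Phi 8 | BF 4 | WF 3 4

type_synonym multi_index = "4 \<Rightarrow> nat"

datatype coord = Indep 4 | Dep dep_var multi_index

type_synonym jet = "coord \<Rightarrow> real"

definition unit_index :: "4 \<Rightarrow> multi_index"
  where "unit_index \<mu> = (\<lambda>\<nu>. if \<nu> = \<mu> then 1 else 0)"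

definition local_function :: "(jet \<Rightarrow> real) \<Rightarrow> bool"
  where "local_function F \<longleftrightarrow> smooth F \<and>
    (\<exists>S. finite S \<and> (\<forall>z z'. (\<forall>c\<in>S. z c = z' c) \<longrightarrow> F z = F z'))"

text \<open>For a local function the index sets of the sums in \<open>total_deriv\<close> and \<open>prolong\<close> are finite.\<close>

definition total_deriv :: "4 \<Rightarrow> (jet \<Rightarrow> real) \<Rightarrow> jet \<Rightarrow> real"
  where "total_deriv \<mu> F z = pd (Indep \<mu>) F z +
    (\<Sum>(f, J) | pd (Dep f J) F z \<noteq> 0. z (Dep f (J + unit_index \<mu>)) * pd (Dep f J) F z)"

definition total_deriv_multi :: "multi_index \<Rightarrow> (jet \<Rightarrow> real) \<Rightarrow> jet \<Rightarrow> real"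
  where "total_deriv_multi J =
    (total_deriv 0 ^^ J 0) \<circ> (total_deriv 1 ^^ J 1) \<circ> (total_deriv 2 ^^ J 2) \<circ> (total_deriv 3 ^^ J 3)"

definition euler :: "(jet \<Rightarrow> real) \<Rightarrow> dep_var \<Rightarrow> jet \<Rightarrow> real"
  where "euler L f z =
    pd (Dep f 0) L z - (\<Sum>\<mu>\<in>UNIV. total_deriv \<mu> (pd (Dep f (unit_index \<mu>)) L) z)"

text \<open>The generator with coefficients \<open>\<eta>\<^sup>1, \<dots>, \<eta>\<^sup>8\<close> is represented by the map
  \<open>y \<mapsto> (\<eta>\<^sup>1(y), \<dots>, \<eta>\<^sup>8(y))\<close>.\<close>

type_synonym generator = "(dep_var \<Rightarrow> real) \<Rightarrow> real^8"

definition scalar_generator :: "generator \<Rightarrow> bool"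
  where "scalar_generator X \<longleftrightarrow> (\<forall>i. smooth (\<lambda>y. X y $ i))"

definition coefficient :: "generator \<Rightarrow> 8 \<Rightarrow> jet \<Rightarrow> real"
  where "coefficient X i z = X (\<lambda>f. z (Dep f 0)) $ i"

definition prolong :: "generator \<Rightarrow> (jet \<Rightarrow> real) \<Rightarrow> jet \<Rightarrow> real"
  where "prolong X F z = (\<Sum>(i, J) | pd (Dep (Phi i) J) F z \<noteq> 0.
    total_deriv_multi J (coefficient X i) z * pd (Dep (Phi i) J) F z)"

text \<open>The condition ``whenever \<open>E(L) = 0\<close>'' is imposed at every point of jet space where all 24
  Euler expressions vanish.\<close>

definition el_symmetry :: "(jet \<Rightarrow> real) \<Rightarrow> generator \<Rightarrow> bool"
  where "el_symmetry L X \<longleftrightarrow>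
    (\<forall>z. (\<forall>f. euler L f z = 0) \<longrightarrow> (\<forall>f. prolong X (euler L f) z = 0))"

definition variational :: "(jet \<Rightarrow> real) \<Rightarrow> generator \<Rightarrow> bool"
  where "variational L X \<longleftrightarrow> (\<exists>\<beta> :: 4 \<Rightarrow> jet \<Rightarrow> real. (\<forall>\<mu>. local_function (\<beta> \<mu>)) \<and>
    (\<forall>z. prolong X L z = (\<Sum>\<mu>\<in>UNIV. total_deriv \<mu> (\<beta> \<mu>) z)))"

definition strictly_variational :: "(jet \<Rightarrow> real) \<Rightarrow> generator \<Rightarrow> bool"
  where "strictly_variational L X \<longleftrightarrow> (\<forall>z. prolong X L z = 0)"

definition g_EL :: "(jet \<Rightarrow> real) \<Rightarrow> generator set"
  where "g_EL L = {X. scalar_generator X \<and> el_symmetry L X}"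

text \<open>Variational generators are not required to be symmetries of the Euler-Lagrange equations by
  definition, so the inclusions of \<open>g_var\<close> and \<open>g_svar\<close> in \<open>g_EL\<close> have content.\<close>

definition g_var :: "(jet \<Rightarrow> real) \<Rightarrow> generator set"
  where "g_var L = {X. scalar_generator X \<and> variational L X}"

definition g_svar :: "(jet \<Rightarrow> real) \<Rightarrow> generator set"
  where "g_svar L = {X. scalar_generator X \<and> strictly_variational L X}"

text \<open>The entry \<open>m11sq\<close> stands for \<open>m\<^sub>1\<^sub>1\<^sup>2\<close>, which may be negative; similarly for the others.\<close>

record potential_params =
  m11sq :: real
  m22sq :: real
  m12sq :: complex
  lam1 :: real
  lam2 :: real
  lam3 :: real
  lam4 :: real
  lam5 :: complex
  lam6 :: complex
  lam7 :: complex

text \<open>Diagonal entries of the metric. The signature (+,-,-,-) is the one for which the scalar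
  kinetic term of the Lagrangian is positive in the time derivatives.\<close>

definition minkowski :: "4 \<Rightarrow> real"
  where "minkowski \<mu> = (if \<mu> = 0 then 1 else - 1)"

definition levi_civita :: "3 \<Rightarrow> 3 \<Rightarrow> 3 \<Rightarrow> real"
  where "levi_civita a b c =
    (if (a, b, c) \<in> {(1, 2, 3), (2, 3, 1), (3, 1, 2)} then 1
     else if (a, b, c) \<in> {(1, 3, 2), (2, 1, 3), (3, 2, 1)} then - 1
     else 0)"

definition pauli :: "3 \<Rightarrow> complex^2^2"
  where "pauli a =
    (if a = 1 then vector [vector [0, 1], vector [1, 0]]
     else if a = 2 then vector [vector [0, - \<i>], vector [\<i>, 0]]
     else vector [vector [1, 0], vector [0, - 1]])"

definition cinner2 :: "complex^2 \<Rightarrow> complex^2 \<Rightarrow> complex"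
  where "cinner2 u v = (\<Sum>k\<in>UNIV. cnj (u $ k) * v $ k)"

definition doublet :: "real^8 \<Rightarrow> 2 \<Rightarrow> complex^2"
  where "doublet s i = (1 / sqrt 2) *\<^sub>R
    (if i = 1 then vector [Complex (s $ 1) (s $ 2), Complex (s $ 3) (s $ 4)]
     else vector [Complex (s $ 5) (s $ 6), Complex (s $ 7) (s $ 8)])"

definition scalars :: "jet \<Rightarrow> multi_index \<Rightarrow> real^8"
  where "scalars z J = (\<chi> k. z (Dep (Phi k) J))"

definition add_hc :: "complex \<Rightarrow> complex"
  where "add_hc c = c + cnj c"

definition potential :: "potential_params \<Rightarrow> (2 \<Rightarrow> complex^2) \<Rightarrow> complex"
  where "potential P \<Phi> =
    (let p11 = cinner2 (\<Phi> 1) (\<Phi> 1); p22 = cinner2 (\<Phi> 2) (\<Phi> 2);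
         p12 = cinner2 (\<Phi> 1) (\<Phi> 2); p21 = cinner2 (\<Phi> 2) (\<Phi> 1)
     in of_real (m11sq P) * p11 + of_real (m22sq P) * p22 - add_hc (m12sq P * p12)
        + of_real (lam1 P) / 2 * p11\<^sup>2 + of_real (lam2 P) / 2 * p22\<^sup>2
        + of_real (lam3 P) * p11 * p22 + of_real (lam4 P) * p12 * p21
        + add_hc (lam5 P / 2 * p12\<^sup>2 + lam6 P * p11 * p12 + lam7 P * p22 * p12))"

definition B_strength :: "jet \<Rightarrow> 4 \<Rightarrow> 4 \<Rightarrow> real"
  where "B_strength z \<mu> \<nu> = z (Dep (BF \<nu>) (unit_index \<mu>)) - z (Dep (BF \<mu>) (unit_index \<nu>))"

definition W_strength :: "real \<Rightarrow> jet \<Rightarrow> 3 \<Rightarrow> 4 \<Rightarrow> 4 \<Rightarrow> real"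
  where "W_strength g z a \<mu> \<nu> =
    z (Dep (WF a \<nu>) (unit_index \<mu>)) - z (Dep (WF a \<mu>) (unit_index \<nu>))
    + g * (\<Sum>b\<in>UNIV. \<Sum>c\<in>UNIV. levi_civita a b c * z (Dep (WF b \<mu>) 0) * z (Dep (WF c \<nu>) 0))"

definition cov_deriv :: "real \<Rightarrow> real \<Rightarrow> real \<Rightarrow> jet \<Rightarrow> 4 \<Rightarrow> 2 \<Rightarrow> complex^2"
  where "cov_deriv g g' Y z \<mu> i =
    doublet (scalars z (unit_index \<mu>)) i
    + (\<i> * of_real g) *s
        (\<Sum>a\<in>UNIV. of_real (z (Dep (WF a \<mu>) 0) / 2) *s (pauli a *v doublet (scalars z 0) i))
    + (\<i> * of_real (g' * Y * z (Dep (BF \<mu>) 0))) *s doublet (scalars z 0) i"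

text \<open>The scalar terms are complex expressions with vanishing imaginary part.\<close>

definition lagrangian :: "real \<Rightarrow> real \<Rightarrow> real \<Rightarrow> potential_params \<Rightarrow> jet \<Rightarrow> real"
  where "lagrangian g g' Y P z =
    - (1/4) * (\<Sum>a\<in>UNIV. \<Sum>\<mu>\<in>UNIV. \<Sum>\<nu>\<in>UNIV.
        minkowski \<mu> * minkowski \<nu> * (W_strength g z a \<mu> \<nu>)\<^sup>2)
    - (1/4) * (\<Sum>\<mu>\<in>UNIV. \<Sum>\<nu>\<in>UNIV. minkowski \<mu> * minkowski \<nu> * (B_strength z \<mu> \<nu>)\<^sup>2)
    + Re (\<Sum>i\<in>UNIV. \<Sum>\<mu>\<in>UNIV. of_real (minkowski \<mu>) *
        cinner2 (cov_deriv g g' Y z \<mu> i) (cov_deriv g g' Y z \<mu> i))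
    - Re (potential P (doublet (scalars z 0)))"

definition dagger :: "complex^2^2 \<Rightarrow> complex^2^2"
  where "dagger A = (\<chi> i j. cnj (A $ j $ i))"

definition unitary2 :: "complex^2^2 \<Rightarrow> bool"
  where "unitary2 U \<longleftrightarrow> dagger U ** U = mat 1 \<and> U ** dagger U = mat 1"

text \<open>Real components of a pair of doublets, inverse to \<open>doublet\<close>.\<close>

definition real_components :: "(2 \<Rightarrow> complex^2) \<Rightarrow> real^8"
  where "real_components \<Phi> = sqrt 2 *\<^sub>R
    vector [Re (\<Phi> 1 $ 1), Im (\<Phi> 1 $ 1), Re (\<Phi> 1 $ 2), Im (\<Phi> 1 $ 2),
            Re (\<Phi> 2 $ 1), Im (\<Phi> 2 $ 1), Re (\<Phi> 2 $ 2), Im (\<Phi> 2 $ 2)]"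

definition higgs_rotate :: "complex^2^2 \<Rightarrow> real^8 \<Rightarrow> real^8"
  where "higgs_rotate U s = real_components (\<lambda>i. \<Sum>j\<in>UNIV. U $ i $ j *s doublet s j)"

definition rotate_fields :: "complex^2^2 \<Rightarrow> (dep_var \<Rightarrow> real) \<Rightarrow> dep_var \<Rightarrow> real"
  where "rotate_fields U y f =
    (case f of Phi k \<Rightarrow> higgs_rotate U (\<chi> i. y (Phi i)) $ k | _ \<Rightarrow> y f)"

definition rotate_jet :: "complex^2^2 \<Rightarrow> jet \<Rightarrow> jet"
  where "rotate_jet U z c =
    (case c of Dep (Phi k) J \<Rightarrow> higgs_rotate U (scalars z J) $ k | _ \<Rightarrow> z c)"

definition higgs_basis_change ::
    "real \<Rightarrow> real \<Rightarrow> real \<Rightarrow> complex^2^2 \<Rightarrow> potential_params \<Rightarrow> potential_params \<Rightarrow> bool"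
  where "higgs_basis_change g g' Y U P P' \<longleftrightarrow> unitary2 U \<and>
    (\<forall>z. lagrangian g g' Y P' (rotate_jet U z) = lagrangian g g' Y P z)"

text \<open>Push-forward of the generators along \<open>y \<mapsto> y' = rotate_fields U y\<close>.\<close>

definition in_new_basis :: "complex^2^2 \<Rightarrow> generator set \<Rightarrow> generator set"
  where "in_new_basis U G =
    {X'. \<exists>X\<in>G. \<forall>y. X' (rotate_fields U y) = higgs_rotate U (X y)}"

definition X_Y :: generator
  where "X_Y y = vector [- y (Phi 2), y (Phi 1), - y (Phi 4), y (Phi 3),
                         - y (Phi 6), y (Phi 5), - y (Phi 8), y (Phi 7)]"

definition H1 :: generator
  where "H1 y = vector [y (Phi 6), - y (Phi 5), y (Phi 8), - y (Phi 7),
                        y (Phi 2), - y (Phi 1), y (Phi 4), - y (Phi 3)]"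

definition H2 :: generator
  where "H2 y = vector [y (Phi 5), y (Phi 6), y (Phi 7), y (Phi 8),
                        - y (Phi 1), - y (Phi 2), - y (Phi 3), - y (Phi 4)]"

definition H3 :: generator
  where "H3 y = vector [y (Phi 2), - y (Phi 1), y (Phi 4), - y (Phi 3),
                        - y (Phi 6), y (Phi 5), - y (Phi 8), y (Phi 7)]"

definition lie_bracket :: "generator \<Rightarrow> generator \<Rightarrow> generator"
  where "lie_bracket X Z = (\<lambda>y. \<chi> i. \<Sum>j\<in>UNIV.
    X y $ j * pd (Phi j) (\<lambda>y. Z y $ i) y - Z y $ j * pd (Phi j) (\<lambda>y. X y $ i) y)"

definition lie_subalgebra :: "('a::real_vector \<Rightarrow> 'a \<Rightarrow> 'a) \<Rightarrow> 'a set \<Rightarrow> bool"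
  where "lie_subalgebra br G \<longleftrightarrow> subspace G \<and> (\<forall>x\<in>G. \<forall>y\<in>G. br x y \<in> G)"

text \<open>A linear map defined on the subspace \<open>G\<close> only can always be extended to the ambient space,
  so \<open>h\<close> may be taken globally linear.\<close>

definition lie_iso ::
    "('a::real_vector \<Rightarrow> 'b::real_vector) \<Rightarrow>
     ('a \<Rightarrow> 'a \<Rightarrow> 'a) \<Rightarrow> 'a set \<Rightarrow> ('b \<Rightarrow> 'b \<Rightarrow> 'b) \<Rightarrow> 'b set \<Rightarrow> bool"
  where "lie_iso h br G br' G' \<longleftrightarrow> lie_subalgebra br G \<and> lie_subalgebra br' G' \<and>
    linear h \<and> bij_betw h G G' \<and> (\<forall>x\<in>G. \<forall>y\<in>G. h (br x y) = br' (h x) (h y))"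

definition mat_commutator :: "complex^2^2 \<Rightarrow> complex^2^2 \<Rightarrow> complex^2^2"
  where "mat_commutator A C = A ** C - C ** A"

definition su2 :: "(complex^2^2) set"
  where "su2 = {A. dagger A = - A \<and> trace A = 0}"

text \<open>\<open>u(1)\<close> as the anti-Hermitian 1-by-1 matrices, with vanishing bracket.\<close>

definition u1 :: "complex set"
  where "u1 = {c. cnj c = - c}"

definition abelian_bracket :: "'a \<Rightarrow> 'a \<Rightarrow> 'a::zero"
  where "abelian_bracket x y = 0"

definition sum_bracket ::
    "('a \<Rightarrow> 'a \<Rightarrow> 'a) \<Rightarrow> ('b \<Rightarrow> 'b \<Rightarrow> 'b) \<Rightarrow> 'a \<times> 'b \<Rightarrow> 'a \<times> 'b \<Rightarrow> 'a \<times> 'b"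
  where "sum_bracket br br' p q = (br (fst p) (fst q), br' (snd p) (snd q))"

end

theory Submission
  imports Defs
begin

text \<open>Over an arbitrary 1-jet the field equations can be solved for second derivatives. Prolonged to a
  scalar symmetry with coefficients \<open>\<eta>\<close>, the gauge field equations therefore hold identically in the
  1-jet. They force \<open>\<eta> = S\<phi>\<close> with \<open>S\<close> constant, antisymmetric and commuting with the gauge group, that is,
  an anti-Hermitian matrix acting on the flavour index; the scalar equations then say that \<open>S\<close>
  preserves the potential.

  A total divergence has the same integral over a box for any two configurations whose jets agree on
  the boundary. For polynomial bumps on shrinking boxes, the terms of \<open>pr X(L)\<close> quadratic in the first
  derivatives give the Killing equation for \<open>\<eta>\<close>, the linear ones give commutation with the gauge group,
  and the remaining ones, of degree 2 and 4 in the scalars, the invariance of the potential. So both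
  kinds of symmetry are the flavour symmetries of the potential.

  The potential is a quadratic polynomial in the four gauge-invariant bilinears of the doublets. If a
  traceless flavour direction preserves it, a change of basis turns that direction into \<open>H\<^sub>3\<close>,
  which kills \<open>m\<^sub>1\<^sub>2\<^sup>2\<close>, \<open>\<lambda>\<^sub>5\<close>, \<open>\<lambda>\<^sub>6\<close>, \<open>\<lambda>\<^sub>7\<close>; any further direction then makes the potential invariant
  under the whole flavour group.\<close>

section \<open>Functions of finitely many coordinates\<close>

text \<open>The coefficients may depend on all 24 fields, so the scalar equations become tractable
  only once the dependence on the gauge fields is gone. The gauge equations come first because a
  scalar generator leaves their second-order terms alone and turns them into conditions on 1-jets.
  Both couplings shape the answer: the skew maps commuting with weak isospin alone form sp(2), and
  hypercharge cuts these down to u(2). Variational generators are not assumed to be symmetries of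
  the field equations, so the two inclusions are proved independently. For them the order of
  \<open>\<beta>\<close> is unknown, which rules out comparing coefficients at a fixed order;
  integrals over a box only need profiles vanishing to high order at the ends, and on a box
  polynomials can do that. In both routes the mass terms and the quartic terms of the potential
  arrive with different positive weights, and scaling the scalars separates them.\<close>

lemma tendsto_coordinatewise:
  fixes f :: "'a \<Rightarrow> 'b \<Rightarrow> 'c::topological_space"
  assumes "\<And>i. ((\<lambda>x. f x i) \<longlongrightarrow> l i) F"
  shows "(f \<longlongrightarrow> l) F"
  using assms limitin_componentwise[of "\<lambda>_. euclidean" UNIV f l F]
  by (simp add: euclidean_product_topology)

lemma smooth_DERIV:
  assumes "smooth F"
  shows "((\<lambda>t. F (z(c := t))) has_real_derivative pd c F (z(c := s))) (at s)"
proof -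
  have "(\<lambda>t. F ((z(c := s))(c := t))) field_differentiable (at ((z(c := s)) c))"
    using assms unfolding smooth_def by (metis foldr.simps(1) id_apply)
  then have "(\<lambda>t. F (z(c := t))) field_differentiable (at s)" by simp
  then show ?thesis
    unfolding pd_def by (simp add: field_differentiable_derivI)
qed

lemma smooth_continuous: "smooth F \<Longrightarrow> continuous_on UNIV F"
  unfolding smooth_def by (metis foldr.simps(1) id_apply)

lemma smooth_pd: "smooth F \<Longrightarrow> smooth (pd c F)"
proof -
  assume F: "smooth F"
  have "foldr pd cs (pd c F) = foldr pd (cs @ [c]) F" for cs by simp
  then show ?thesis using F unfolding smooth_def by metis
qed

lemma smooth_pd_continuous: "smooth F \<Longrightarrow> continuous_on UNIV (pd c F)"
  by (rule smooth_continuous[OF smooth_pd])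

definition depends_on :: "(('c \<Rightarrow> 'b) \<Rightarrow> 'a) \<Rightarrow> 'c set \<Rightarrow> bool"
  where "depends_on F S \<longleftrightarrow> (\<forall>z z'. (\<forall>c\<in>S. z c = z' c) \<longrightarrow> F z = F z')"

lemma local_function_iff: "local_function F \<longleftrightarrow> smooth F \<and> (\<exists>S. finite S \<and> depends_on F S)"
  by (simp add: local_function_def depends_on_def)

lemma depends_on_pd_eq_0: "depends_on F S \<Longrightarrow> c \<notin> S \<Longrightarrow> pd c F z = 0"
proof -
  assume F: "depends_on F S" and c: "c \<notin> S"
  have "F (z(c := t)) = F z" for t
    using F c unfolding depends_on_def by (metis fun_upd_apply)
  then show ?thesis by (simp add: pd_def)
qed

text \<open>\<open>smooth\<close> supplies coordinatewise derivatives and continuity in the product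
  topology, so differentiability along a path is built up one moving coordinate at a time: the mean
  value theorem handles the new coordinate, and continuity of \<open>pd c F\<close> absorbs the
  intermediate point.\<close>

lemma chain_rule_finite_change:
  fixes F :: "('c \<Rightarrow> real) \<Rightarrow> real"
  assumes F: "smooth F" and "finite S"
  shows "(\<And>t c. c \<notin> S \<Longrightarrow> p t c = p t0 c) \<Longrightarrow>
    (\<And>c. c \<in> S \<Longrightarrow> ((\<lambda>t. p t c) has_real_derivative p' c) (at t0)) \<Longrightarrow>
    ((\<lambda>t. F (p t)) has_real_derivative (\<Sum>c\<in>S. p' c * pd c F (p t0))) (at t0)"
  using \<open>finite S\<close>
proof (induction S arbitrary: p rule: finite_induct)
  case empty
  then have "p t = p t0" for t by blast
  then have "(\<lambda>t. F (p t)) = (\<lambda>t. F (p t0))" by metis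
  then show ?case by simp
next
  case (insert c S)
  define z0 where "z0 = p t0"
  define p1 where "p1 = (\<lambda>t. (p t)(c := z0 c))"
  have 1: "p1 t0 = z0" by (simp add: p1_def z0_def)
  have d1: "((\<lambda>t. F (p1 t)) has_real_derivative (\<Sum>c\<in>S. p' c * pd c F (p1 t0))) (at t0)"
  proof (rule insert.IH)
    fix t d assume "d \<notin> S"
    then show "p1 t d = p1 t0 d"
      using insert.prems(1)[of d t] by (simp add: p1_def z0_def)
  next
    fix d assume "d \<in> S"
    then show "((\<lambda>t. p1 t d) has_real_derivative p' d) (at t0)"
      using insert.prems(2)[of d] insert.hyps by (cases "d = c") (auto simp: p1_def)
  qed
  \<comment> \<open>The bound on the intermediate point also covers a vanishing increment, so one
    function \<open>u\<close> can be chosen for all \<open>t\<close>.\<close>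
  have "\<exists>u. \<bar>u - z0 c\<bar> \<le> \<bar>p t c - z0 c\<bar> \<and>
      F (p t) - F (p1 t) = (p t c - z0 c) * pd c F ((p t)(c := u))" for t
  proof -
    have D: "((\<lambda>s. F ((p t)(c := s))) has_real_derivative pd c F ((p t)(c := s))) (at s)" for s
      by (rule smooth_DERIV[OF F])
    consider "p t c = z0 c" | "p t c < z0 c" | "z0 c < p t c" by linarith
    then show ?thesis
    proof cases
      case 1
      have "p1 t = p t" by (simp add: p1_def 1[symmetric])
      then show ?thesis by (auto simp: 1 intro: exI[of _ "z0 c"])
    next
      case 2
      then obtain u where "p t c < u" "u < z0 c"
        "F ((p t)(c := z0 c)) - F ((p t)(c := p t c)) = (z0 c - p t c) * pd c F ((p t)(c := u))"
        using MVT2[OF 2 D] by auto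
      then show ?thesis
        by (intro exI[of _ u]) (auto simp: p1_def algebra_simps)
    next
      case 3
      then obtain u where "z0 c < u" "u < p t c"
        "F ((p t)(c := p t c)) - F ((p t)(c := z0 c)) = (p t c - z0 c) * pd c F ((p t)(c := u))"
        using MVT2[OF 3 D] by auto
      then show ?thesis
        by (intro exI[of _ u]) (auto simp: p1_def algebra_simps)
    qed
  qed
  then obtain u where u: "\<And>t. \<bar>u t - z0 c\<bar> \<le> \<bar>p t c - z0 c\<bar>"
    "\<And>t. F (p t) - F (p1 t) = (p t c - z0 c) * pd c F ((p t)(c := u t))" by metis
  have lim_p: "((\<lambda>t. p t d) \<longlongrightarrow> z0 d) (at t0)" for d
  proof (cases "d \<in> insert c S")
    case True
    then show ?thesis
      using DERIV_isCont[OF insert.prems(2)[OF True]] by (simp add: isCont_def z0_def)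
  next
    case False
    then have "(\<lambda>t. p t d) = (\<lambda>t. z0 d)" using insert.prems(1) unfolding z0_def by blast
    then show ?thesis by simp
  qed
  have "((\<lambda>t. u t - z0 c) \<longlongrightarrow> 0) (at t0)"
  proof (rule Lim_null_comparison)
    show "\<forall>\<^sub>F t in at t0. norm (u t - z0 c) \<le> \<bar>p t c - z0 c\<bar>"
      using u(1) by simp
    show "((\<lambda>t. \<bar>p t c - z0 c\<bar>) \<longlongrightarrow> 0) (at t0)"
      using lim_p[of c] by (metis LIM_zero tendsto_rabs_zero)
  qed
  then have lim_u: "(u \<longlongrightarrow> z0 c) (at t0)" by (simp add: LIM_zero_iff)
  have "((\<lambda>t. (p t)(c := u t)) \<longlongrightarrow> z0) (at t0)"
  proof (rule tendsto_coordinatewise)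
    fix d
    show "((\<lambda>t. ((p t)(c := u t)) d) \<longlongrightarrow> z0 d) (at t0)"
      using lim_p[of d] lim_u by (cases "d = c") auto
  qed
  then have lim_pd: "((\<lambda>t. pd c F ((p t)(c := u t))) \<longlongrightarrow> pd c F z0) (at t0)"
    by (rule continuous_on_tendsto_compose[OF smooth_pd_continuous[OF F]]) auto
  have "((\<lambda>t. (p t c - z0 c) / (t - t0)) \<longlongrightarrow> p' c) (at t0)"
    using insert.prems(2)[of c] by (simp add: has_field_derivative_iff z0_def)
  then have "((\<lambda>t. (p t c - z0 c) / (t - t0) * pd c F ((p t)(c := u t))) \<longlongrightarrow> p' c * pd c F z0) (at t0)"
    using lim_pd by (rule tendsto_mult)
  then have d2: "((\<lambda>t. F (p t) - F (p1 t)) has_real_derivative p' c * pd c F z0) (at t0)"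
    unfolding has_field_derivative_iff using u(2) by (simp add: z0_def)
  show ?case
    using DERIV_add[OF d1 d2] insert.hyps by (simp add: 1 z0_def[symmetric] add.commute)
qed

text \<open>Coordinates outside \<open>S\<close> may move arbitrarily, even discontinuously:
  freezing them does not change \<open>F\<close>.\<close>

lemma chain_rule:
  fixes F :: "('c \<Rightarrow> real) \<Rightarrow> real"
  assumes "smooth F" "finite S" "depends_on F S"
    and d: "\<And>c. c \<in> S \<Longrightarrow> ((\<lambda>t. p t c) has_real_derivative p' c) (at t0)"
  shows "((\<lambda>t. F (p t)) has_real_derivative (\<Sum>c\<in>S. p' c * pd c F (p t0))) (at t0)"
proof -
  define p2 where "p2 = (\<lambda>t c. if c \<in> S then p t c else p t0 c)"
  have "p2 t0 = p t0" by (auto simp: p2_def)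
  moreover have "F (p2 t) = F (p t)" for t
    using assms(3) unfolding depends_on_def p2_def by simp
  moreover have "((\<lambda>t. F (p2 t)) has_real_derivative (\<Sum>c\<in>S. p' c * pd c F (p2 t0))) (at t0)"
    by (rule chain_rule_finite_change[OF assms(1,2)]) (auto simp: p2_def d)
  ultimately show ?thesis by simp
qed

text \<open>This class is closed under \<open>pd\<close>, so membership gives \<open>smooth\<close>
  without tracking iterated derivatives. The Lagrangian and its Euler expressions belong to
  it.\<close>

inductive polyfun :: "(('c \<Rightarrow> real) \<Rightarrow> real) \<Rightarrow> bool" where
  polyfun_const: "polyfun (\<lambda>z. k)"
| polyfun_coord: "polyfun (\<lambda>z. z c)"
| polyfun_add: "polyfun F \<Longrightarrow> polyfun G \<Longrightarrow> polyfun (\<lambda>z. F z + G z)"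
| polyfun_mult: "polyfun F \<Longrightarrow> polyfun G \<Longrightarrow> polyfun (\<lambda>z. F z * G z)"

named_theorems polyfun_intros
declare polyfun.intros [polyfun_intros]

lemma polyfun_minus [polyfun_intros]: "polyfun F \<Longrightarrow> polyfun (\<lambda>z. - F z)"
  using polyfun_mult[OF polyfun_const[of "-1"]] by fastforce

lemma polyfun_diff [polyfun_intros]: "polyfun F \<Longrightarrow> polyfun G \<Longrightarrow> polyfun (\<lambda>z. F z - G z)"
  using polyfun_add[OF _ polyfun_minus] by fastforce

lemma polyfun_power [polyfun_intros]: "polyfun F \<Longrightarrow> polyfun (\<lambda>z. F z ^ n)"
  by (induction n) (auto intro: polyfun_intros)

lemma polyfun_divide [polyfun_intros]: "polyfun F \<Longrightarrow> polyfun (\<lambda>z. F z / k)"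
  using polyfun_mult[OF _ polyfun_const[of "inverse k"]] by (simp add: divide_inverse)

lemma polyfun_sum [polyfun_intros]:
  "(\<And>i. i \<in> I \<Longrightarrow> polyfun (F i)) \<Longrightarrow> polyfun (\<lambda>z. \<Sum>i\<in>I. F i z)"
  by (induction I rule: infinite_finite_induct) (auto intro: polyfun_intros)

lemma polyfun_differentiable:
  "polyfun F \<Longrightarrow> (\<lambda>t. F (z(c := t))) field_differentiable (at s)"
proof (induction rule: polyfun.induct)
  case (polyfun_coord d)
  then show ?case
    by (cases "d = c") auto
qed (auto intro: field_differentiable_add field_differentiable_mult)

lemma polyfun_DERIV:
  "polyfun F \<Longrightarrow> ((\<lambda>t. F (z(c := t))) has_real_derivative pd c F z) (at (z c))"
  unfolding pd_def by (simp add: field_differentiable_derivI polyfun_differentiable)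

lemma pd_eqI: "((\<lambda>t. F (z(c := t))) has_real_derivative D) (at (z c)) \<Longrightarrow> pd c F z = D"
  unfolding pd_def by (rule DERIV_imp_deriv)

lemma polyfun_pd: "polyfun F \<Longrightarrow> polyfun (pd c F)"
proof (induction rule: polyfun.induct)
  case (polyfun_const k)
  have "pd c (\<lambda>z. k) = (\<lambda>z. 0)" by (rule ext, rule pd_eqI) simp
  then show ?case by (simp add: polyfun.polyfun_const)
next
  case (polyfun_coord d)
  have "pd c (\<lambda>z. z d) = (\<lambda>z. if d = c then 1 else 0)" by (rule ext, rule pd_eqI) auto
  then show ?case by (simp add: polyfun.polyfun_const)
next
  case (polyfun_add F G)
  have "pd c (\<lambda>z. F z + G z) = (\<lambda>z. pd c F z + pd c G z)"
    using polyfun_add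
    by (intro ext pd_eqI DERIV_add polyfun_DERIV)
  then show ?case using polyfun_add by (auto intro: polyfun_intros)
next
  case (polyfun_mult F G)
  have "pd c (\<lambda>z. F z * G z) = (\<lambda>z. pd c F z * G z + pd c G z * F z)"
  proof (rule ext, rule pd_eqI)
    fix z
    show "((\<lambda>t. F (z(c := t)) * G (z(c := t))) has_real_derivative pd c F z * G z + pd c G z * F z) (at (z c))"
      using DERIV_mult[OF polyfun_DERIV[OF polyfun_mult(1)] polyfun_DERIV[OF polyfun_mult(2)], of z c z]
      by simp
  qed
  then show ?case using polyfun_mult by (auto intro: polyfun_intros)
qed

lemma polyfun_continuous: "polyfun F \<Longrightarrow> continuous_on UNIV F"
  by (induction rule: polyfun.induct) (auto intro!: continuous_intros)

lemma polyfun_foldr_pd: "polyfun F \<Longrightarrow> polyfun (foldr pd cs F)"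
  by (induction cs) (auto intro: polyfun_pd)

lemma polyfun_smooth: "polyfun F \<Longrightarrow> smooth F"
  unfolding smooth_def
  by (blast intro: polyfun_foldr_pd polyfun_continuous polyfun_differentiable)

lemma depends_on_combine:
  fixes F :: "('c \<Rightarrow> 'b) \<Rightarrow> 'a" and G :: "('c \<Rightarrow> 'b) \<Rightarrow> 'd"
  assumes "depends_on F S" "depends_on G T"
  shows "depends_on (\<lambda>z. h (F z) (G z)) (S \<union> T)"
  unfolding depends_on_def
proof (intro allI impI)
  fix z z' :: "'c \<Rightarrow> 'b" assume z: "\<forall>c\<in>S \<union> T. z c = z' c"
  then have "F z = F z'" "G z = G z'"
    using assms unfolding depends_on_def by blast+
  then show "h (F z) (G z) = h (F z') (G z')" by simp
qed

lemma polyfun_depends_on: "polyfun F \<Longrightarrow> \<exists>S. finite S \<and> depends_on F S"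
proof (induction rule: polyfun.induct)
  case (polyfun_const k)
  then show ?case by (intro exI[of _ "{}"]) (simp add: depends_on_def)
next
  case (polyfun_coord c)
  then show ?case by (intro exI[of _ "{c}"]) (simp add: depends_on_def)
next
  case (polyfun_add F G)
  then show ?case
    using depends_on_combine[of F _ G _ "(+)"] finite_UnI by blast
next
  case (polyfun_mult F G)
  then show ?case
    using depends_on_combine[of F _ G _ "(*)"] finite_UnI by blast
qed

lemma polyfun_local: "polyfun F \<Longrightarrow> local_function F"
  by (simp add: local_function_iff polyfun_smooth polyfun_depends_on)

section \<open>Jet space\<close>

text \<open>The direction of the total derivative: \<open>total_deriv \<mu>\<close> at
  \<open>z\<close> is the derivative along \<open>shift \<mu> z\<close>. The entry 1 accounts for
  explicit dependence on the coordinate itself.\<close>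

definition shift :: "4 \<Rightarrow> jet \<Rightarrow> jet"
  where "shift \<mu> z c = (case c of Indep \<nu> \<Rightarrow> if \<nu> = \<mu> then 1 else 0 | Dep f J \<Rightarrow> z (Dep f (J + unit_index \<mu>)))"

lemma shift_Dep [simp]: "shift \<mu> z (Dep f J) = z (Dep f (J + unit_index \<mu>))"
  by (simp add: shift_def)

definition prol_dir :: "generator \<Rightarrow> jet \<Rightarrow> jet"
  where "prol_dir X z c = (case c of Dep (Phi i) J \<Rightarrow> total_deriv_multi J (coefficient X i) z | _ \<Rightarrow> 0)"

text \<open>The defining sum runs over a support that varies with \<open>z\<close>; a fixed finite
  index set makes the total derivative a polynomial or continuous function where its argument allows
  it.\<close>

lemma total_deriv_eq_sum:
  assumes "finite S" "depends_on F S"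
  shows "total_deriv \<mu> F z = (\<Sum>c\<in>S. shift \<mu> z c * pd c F z)"
proof -
  define A where "A = {(f, J). pd (Dep f J) F z \<noteq> 0}"
  define g where "g = (\<lambda>c. shift \<mu> z c * pd c F z)"
  have supp: "pd c F z = 0" if "c \<notin> S" for c
    using depends_on_pd_eq_0[OF assms(2) that] .
  let ?h = "\<lambda>(f, J). Dep f J"
  have inj: "inj_on ?h A" by (auto simp: inj_on_def)
  have 1: "(\<Sum>(f, J)\<in>A. z (Dep f (J + unit_index \<mu>)) * pd (Dep f J) F z) = sum g (?h ` A)"
    unfolding sum.reindex[OF inj] by (rule sum.cong) (auto simp: g_def shift_def)
  have fin: "finite (?h ` A)"
    by (rule finite_subset[OF _ assms(1)]) (use supp in \<open>auto simp: A_def\<close>)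
  have "pd (Indep \<mu>) F z = sum g (range Indep)"
  proof -
    have "sum g (range Indep) = (\<Sum>\<nu>\<in>UNIV. if \<nu> = \<mu> then pd (Indep \<nu>) F z else 0)"
      by (subst sum.reindex) (simp_all add: inj_on_def g_def shift_def if_distrib[of "\<lambda>u. u * _"] cong: if_cong)
    then show ?thesis by (simp add: sum.delta)
  qed
  then have "total_deriv \<mu> F z = sum g (range Indep) + sum g (?h ` A)"
    unfolding total_deriv_def 1[symmetric] A_def[symmetric] by simp
  also have "\<dots> = sum g (range Indep \<union> ?h ` A)"
    by (rule sum.union_disjoint[symmetric]) (use fin in auto)
  also have "\<dots> = sum g (S \<union> (range Indep \<union> ?h ` A))"
  proof (rule sum.mono_neutral_left)
    show "\<forall>i\<in>S \<union> (range Indep \<union> ?h ` A) - (range Indep \<union> ?h ` A). g i = 0"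
    proof
      fix c assume c: "c \<in> S \<union> (range Indep \<union> ?h ` A) - (range Indep \<union> ?h ` A)"
      then obtain f J where "c = Dep f J" by (cases c) auto
      then show "g c = 0" using c by (auto simp: g_def A_def image_iff)
    qed
  qed (use fin assms(1) in auto)
  also have "\<dots> = sum g S"
    by (rule sum.mono_neutral_right) (use fin assms(1) supp in \<open>auto simp: g_def\<close>)
  finally show ?thesis by (simp add: g_def)
qed

lemma prolong_eq_sum:
  assumes "finite S" "depends_on F S"
  shows "prolong X F z = (\<Sum>c\<in>S. prol_dir X z c * pd c F z)"
proof -
  define A where "A = {(i, J). pd (Dep (Phi i) J) F z \<noteq> 0}"
  define g where "g = (\<lambda>c. prol_dir X z c * pd c F z)"
  have supp: "pd c F z = 0" if "c \<notin> S" for c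
    using depends_on_pd_eq_0[OF assms(2) that] .
  let ?h = "\<lambda>(i, J). Dep (Phi i) J"
  have inj: "inj_on ?h A" by (auto simp: inj_on_def)
  have "prolong X F z = sum g (?h ` A)"
    unfolding prolong_def sum.reindex[OF inj] A_def[symmetric]
    by (rule sum.cong) (auto simp: g_def prol_dir_def)
  also have "\<dots> = sum g S"
  proof (rule sum.mono_neutral_left)
    show "?h ` A \<subseteq> S" using supp by (auto simp: A_def)
    show "\<forall>c\<in>S - ?h ` A. g c = 0"
      by (auto simp: g_def A_def prol_dir_def image_iff split: coord.splits dep_var.splits)
  qed (rule assms)
  finally show ?thesis by (simp add: g_def)
qed

text \<open>Both operators become one-variable derivatives along straight lines, so they can be
  evaluated from closed formulas in \<open>t\<close> instead of expanding partial derivatives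
  coordinate by coordinate.\<close>

lemma has_derivative_along:
  assumes "local_function F"
  shows total_deriv_along: "((\<lambda>t. F (\<lambda>c. z c + t * shift \<mu> z c)) has_real_derivative total_deriv \<mu> F z) (at 0)"
    and prolong_along: "((\<lambda>t. F (\<lambda>c. z c + t * prol_dir X z c)) has_real_derivative prolong X F z) (at 0)"
proof -
  obtain S where S: "finite S" "depends_on F S" "smooth F"
    using assms by (auto simp: local_function_iff)
  have "((\<lambda>t. F (\<lambda>c. z c + t * h c)) has_real_derivative (\<Sum>c\<in>S. h c * pd c F z)) (at 0)" for h
  proof -
    have "((\<lambda>t. z c + t * h c) has_real_derivative h c) (at 0)" for c
      by (auto intro!: derivative_eq_intros)
    from chain_rule[OF S(3,1,2) this] show ?thesis by simp
  qed
  then show "((\<lambda>t. F (\<lambda>c. z c + t * shift \<mu> z c)) has_real_derivative total_deriv \<mu> F z) (at 0)"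
    "((\<lambda>t. F (\<lambda>c. z c + t * prol_dir X z c)) has_real_derivative prolong X F z) (at 0)"
    by (simp_all add: total_deriv_eq_sum[OF S(1,2)] prolong_eq_sum[OF S(1,2)])
qed

lemma total_deriv_eqI:
  assumes "local_function F" "((\<lambda>t. F (\<lambda>c. z c + t * shift \<mu> z c)) has_real_derivative D) (at 0)"
  shows "total_deriv \<mu> F z = D"
  using total_deriv_along[OF assms(1)] assms(2) by (rule DERIV_unique)

lemma prolong_eqI:
  assumes "local_function F" "((\<lambda>t. F (\<lambda>c. z c + t * prol_dir X z c)) has_real_derivative D) (at 0)"
  shows "prolong X F z = D"
  using prolong_along[OF assms(1)] assms(2) by (rule DERIV_unique)

definition coord_dir :: "'c \<Rightarrow> 'c \<Rightarrow> real"
  where "coord_dir c = (\<lambda>c'. if c' = c then 1 else 0)"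

lemma pd_along_eqI:
  assumes "((\<lambda>t. F (\<lambda>c'. z c' + t * coord_dir c c')) has_real_derivative D) (at 0)"
  shows "pd c F z = D"
proof (rule pd_eqI)
  have eq: "(\<lambda>c'. z c' + (t - z c) * coord_dir c c') = z(c := t)" for t
    by (auto simp: coord_dir_def)
  have "((\<lambda>t. F (\<lambda>c'. z c' + (t - z c) * coord_dir c c')) has_real_derivative D * 1) (at (z c))"
    by (rule DERIV_chain'[where g = "\<lambda>t. F (\<lambda>c'. z c' + t * coord_dir c c')" and f = "\<lambda>t. t - z c"])
       (use assms in \<open>auto intro!: derivative_eq_intros\<close>)
  then show "((\<lambda>t. F (z(c := t))) has_real_derivative D) (at (z c))"
    unfolding eq by simp
qed

lemma polyfun_total_deriv:
  assumes "polyfun F"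
  shows "polyfun (total_deriv \<mu> F)"
proof -
  obtain S where S: "finite S" "depends_on F S"
    using polyfun_depends_on[OF assms] by blast
  have "polyfun (\<lambda>z. shift \<mu> z c)" for c
    by (cases c) (auto simp: shift_def intro: polyfun_intros)
  then have "polyfun (\<lambda>z. \<Sum>c\<in>S. shift \<mu> z c * pd c F z)"
    by (intro polyfun_intros polyfun_pd assms)
  moreover have "total_deriv \<mu> F = (\<lambda>z. \<Sum>c\<in>S. shift \<mu> z c * pd c F z)"
    using total_deriv_eq_sum[OF S] by blast
  ultimately show ?thesis by simp
qed

lemma polyfun_euler: "polyfun L \<Longrightarrow> polyfun (euler L f)"
  unfolding euler_def by (intro polyfun_intros polyfun_pd polyfun_total_deriv)

lemma unit_index_inject [simp]: "unit_index \<mu> = unit_index \<nu> \<longleftrightarrow> \<mu> = \<nu>"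
  by (auto simp: unit_index_def fun_eq_iff split: if_splits)

lemma unit_index_neq_0 [simp]: "unit_index \<mu> \<noteq> 0" "0 \<noteq> unit_index \<mu>"
  by (auto simp: unit_index_def fun_eq_iff)

lemma total_deriv_multi_0 [simp]: "total_deriv_multi 0 F = F"
  by (simp add: total_deriv_multi_def)

lemma total_deriv_multi_unit [simp]: "total_deriv_multi (unit_index \<mu>) F = total_deriv \<mu> F"
  using exhaust_4[of \<mu>] by (auto simp: total_deriv_multi_def unit_index_def)

lemma total_deriv_const [simp]: "total_deriv \<mu> (\<lambda>z. k) z = 0"
  by (rule total_deriv_eqI) (auto intro: polyfun_local polyfun_const)

section \<open>The Lagrangian in real components\<close>

lemma exhaust_8: "(x::8) = 1 \<or> x = 2 \<or> x = 3 \<or> x = 4 \<or> x = 5 \<or> x = 6 \<or> x = 7 \<or> x = 8"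
proof (induct x)
  case (of_int z)
  then have "0 \<le> z" and "z < 8" by simp_all
  then have "z = 0 \<or> z = 1 \<or> z = 2 \<or> z = 3 \<or> z = 4 \<or> z = 5 \<or> z = 6 \<or> z = 7" by arith
  then show ?case by auto
qed

lemma forall_8: "(\<forall>i::8. P i) \<longleftrightarrow> P 1 \<and> P 2 \<and> P 3 \<and> P 4 \<and> P 5 \<and> P 6 \<and> P 7 \<and> P 8"
  by (metis exhaust_8)

lemma UNIV_8: "UNIV = {1, 2, 3, 4, 5, 6, 7, 8::8}"
  using exhaust_8 by auto

lemma sum_8: "sum f (UNIV::8 set) = f 1 + f 2 + f 3 + f 4 + f 5 + f 6 + f 7 + f 8"
  unfolding UNIV_8 by (simp add: ac_simps)

lemma vector_8 [simp]:
  "(vector [a, b, c, d, e, f, g, h] :: ('a::zero)^8) $ 1 = a"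
  "(vector [a, b, c, d, e, f, g, h] :: ('a::zero)^8) $ 2 = b"
  "(vector [a, b, c, d, e, f, g, h] :: ('a::zero)^8) $ 3 = c"
  "(vector [a, b, c, d, e, f, g, h] :: ('a::zero)^8) $ 4 = d"
  "(vector [a, b, c, d, e, f, g, h] :: ('a::zero)^8) $ 5 = e"
  "(vector [a, b, c, d, e, f, g, h] :: ('a::zero)^8) $ 6 = f"
  "(vector [a, b, c, d, e, f, g, h] :: ('a::zero)^8) $ 7 = g"
  "(vector [a, b, c, d, e, f, g, h] :: ('a::zero)^8) $ 8 = h"
  "(vector [a, b, c, d, e, f, g, h] :: ('a::zero)^8) $ 0 = h"
  unfolding vector_def by simp_all

lemma vector_4 [simp]:
  "(vector [a, b, c, d] :: ('a::zero)^4) $ 1 = a"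
  "(vector [a, b, c, d] :: ('a::zero)^4) $ 2 = b"
  "(vector [a, b, c, d] :: ('a::zero)^4) $ 3 = c"
  "(vector [a, b, c, d] :: ('a::zero)^4) $ 4 = d"
  "(vector [a, b, c, d] :: ('a::zero)^4) $ 0 = d"
  unfolding vector_def by simp_all

lemma sum_option: "(\<Sum>m\<in>(UNIV :: 'a::finite option set). h m) = h None + (\<Sum>a\<in>UNIV. h (Some a))"
  by (simp add: UNIV_option_conv sum.reindex)

text \<open>Multiplication of both doublets by i, in real components; up to a factor this is the
  hypercharge generator.\<close>

definition Jm :: "real^8 \<Rightarrow> real^8"
  where "Jm v = vector [- v $ 2, v $ 1, - v $ 4, v $ 3, - v $ 6, v $ 5, - v $ 8, v $ 7]"

text \<open>The real form of i times half the Pauli matrix \<open>\<sigma>\<^sub>a\<close>, acting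
  on both doublets.\<close>

definition tau :: "3 \<Rightarrow> real^8 \<Rightarrow> real^8"
  where "tau a v = (1/2) *\<^sub>R
    (if a = 1 then vector [- v $ 4, v $ 3, - v $ 2, v $ 1, - v $ 8, v $ 7, - v $ 6, v $ 5]
     else if a = 2 then vector [v $ 3, v $ 4, - v $ 1, - v $ 2, v $ 7, v $ 8, - v $ 5, - v $ 6]
     else vector [- v $ 2, v $ 1, v $ 4, - v $ 3, - v $ 6, v $ 5, v $ 8, - v $ 7])"

lemma linear_Jm: "linear Jm"
  by (rule linearI) (simp_all add: Jm_def vec_eq_iff forall_8)

lemma linear_tau: "linear (tau a)"
  by (rule linearI) (simp_all add: tau_def vec_eq_iff forall_8 algebra_simps)

lemma inner_8: "(v::real^8) \<bullet> w = v$1* w$1 + v$2* w$2 + v$3* w$3 + v$4* w$4 + v$5* w$5 + v$6* w$6 + v$7* w$7 + v$8* w$8"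
  by (simp add: inner_vec_def sum_8)

lemma inner_4: "(v::real^4) \<bullet> w = v$1* w$1 + v$2* w$2 + v$3* w$3 + v$4* w$4"
  by (simp add: inner_vec_def sum_4)

lemma Jm_skew: "Jm v \<bullet> w = - (v \<bullet> Jm w)"
  by (simp add: Jm_def inner_8)

lemma tau_skew: "tau a v \<bullet> w = - (v \<bullet> tau a w)"
  by (simp add: tau_def inner_8 algebra_simps)

lemma Jm_Jm [simp]: "Jm (Jm v) = - v"
  by (simp add: Jm_def vec_eq_iff forall_8)

text \<open>\<open>None\<close> stands for hypercharge and \<open>Some a\<close> for weak isospin,
  so that one computation covers both gauge groups.\<close>

definition gfield :: "4 \<Rightarrow> 3 option \<Rightarrow> dep_var"
  where "gfield \<mu> m = (case m of None \<Rightarrow> BF \<mu> | Some a \<Rightarrow> WF a \<mu>)"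

lemma gfield_simps [simp]:
  "gfield \<mu> None = BF \<mu>" "gfield \<mu> (Some a) = WF a \<mu>"
  "gfield \<mu> m = gfield \<nu> n \<longleftrightarrow> \<mu> = \<nu> \<and> m = n"
  "gfield \<mu> m \<noteq> Phi k" "Phi k \<noteq> gfield \<mu> m"
  by (auto simp: gfield_def split: option.splits)

lemma dep_var_cases: obtains (scalar) i where "f = Phi i" | (gauge) \<nu> m where "f = gfield \<nu> m"
  by (cases f) (metis gfield_simps(1), metis gfield_simps(1), metis gfield_simps(2))

text \<open>\<open>bil\<close> is the polarization of
  \<open>(\<Phi>\<^sub>1\<^sup>\<dagger>\<Phi>\<^sub>1, \<Phi>\<^sub>2\<^sup>\<dagger>\<Phi>\<^sub>2, Re \<Phi>\<^sub>1\<^sup>\<dagger>\<Phi>\<^sub>2, Im \<Phi>\<^sub>1\<^sup>\<dagger>\<Phi>\<^sub>2)\<close>, in which the potential is a quadratic polynomial.\<close>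

definition bil :: "real^8 \<Rightarrow> real^8 \<Rightarrow> real^4"
  where "bil u v = vector
    [(u$1* v$1 + u$2* v$2 + u$3* v$3 + u$4* v$4) / 2,
     (u$5* v$5 + u$6* v$6 + u$7* v$7 + u$8* v$8) / 2,
     (u$1* v$5 + v$1*u$5 + u$2* v$6 + v$2*u$6 + u$3* v$7 + v$3*u$7 + u$4* v$8 + v$4*u$8) / 4,
     (u$1* v$6 + v$1*u$6 - u$2* v$5 - v$2*u$5 + u$3* v$8 + v$3*u$8 - u$4* v$7 - v$4*u$7) / 4]"

definition mass_vec :: "potential_params \<Rightarrow> real^4"
  where "mass_vec P = vector [m11sq P, m22sq P, - 2 * Re (m12sq P), 2 * Im (m12sq P)]"

text \<open>Hessian of the quartic part in the four bilinears. The factors 2 come from Hermitian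
  conjugates and from the 1/2 in \<open>vpot\<close>, the minus signs from Re(cz) = Re c Re z - Im c
  Im z.\<close>

definition quartic_mat :: "potential_params \<Rightarrow> real^4^4"
  where "quartic_mat P = vector
    [vector [lam1 P, lam3 P, 2 * Re (lam6 P), - 2 * Im (lam6 P)],
     vector [lam3 P, lam2 P, 2 * Re (lam7 P), - 2 * Im (lam7 P)],
     vector [2 * Re (lam6 P), 2 * Re (lam7 P), 2 * (lam4 P + Re (lam5 P)), - 2 * Im (lam5 P)],
     vector [- 2 * Im (lam6 P), - 2 * Im (lam7 P), - 2 * Im (lam5 P), 2 * (lam4 P - Re (lam5 P))]]"

definition vpot :: "potential_params \<Rightarrow> real^8 \<Rightarrow> real"
  where "vpot P v = mass_vec P \<bullet> bil v v + (bil v v \<bullet> (quartic_mat P *v bil v v)) / 2"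

lemma forall_4': "(\<forall>i::4. P i) \<longleftrightarrow> P 1 \<and> P 2 \<and> P 3 \<and> P 4"
  by (metis exhaust_4)

lemma bil_add_left: "bil (u + u') v = bil u v + bil u' v"
  and bil_scaleR_left: "bil (c *\<^sub>R u) v = c *\<^sub>R bil u v"
  and bil_sym: "bil u v = bil v u"
  by (simp_all add: bil_def vec_eq_iff forall_4' field_simps)

lemma bil_add_right: "bil v (u + u') = bil v u + bil v u'"
  and bil_scaleR_right: "bil v (c *\<^sub>R u) = c *\<^sub>R bil v u"
  using bil_add_left bil_scaleR_left bil_sym by metis+

lemma quartic_mat_sym: "(quartic_mat P *v u) \<bullet> v = u \<bullet> (quartic_mat P *v v)"
  by (simp add: quartic_mat_def matrix_vector_mult_def inner_4 sum_4 algebra_simps)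

lemma doublet_simps:
  "doublet v 1 $ 1 = Complex (v $ 1 / sqrt 2) (v $ 2 / sqrt 2)"
  "doublet v 1 $ 2 = Complex (v $ 3 / sqrt 2) (v $ 4 / sqrt 2)"
  "doublet v 2 $ 1 = Complex (v $ 5 / sqrt 2) (v $ 6 / sqrt 2)"
  "doublet v 2 $ 2 = Complex (v $ 7 / sqrt 2) (v $ 8 / sqrt 2)"
  by (simp_all add: doublet_def complex_eq_iff)

lemma cinner2_doublets:
  "cinner2 (doublet v 1) (doublet v 1) = of_real (bil v v $ 1)"
  "cinner2 (doublet v 2) (doublet v 2) = of_real (bil v v $ 2)"
  "cinner2 (doublet v 1) (doublet v 2) = Complex (bil v v $ 3) (bil v v $ 4)"
  "cinner2 (doublet v 2) (doublet v 1) = Complex (bil v v $ 3) (- bil v v $ 4)"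
  by (simp_all add: cinner2_def sum_2 doublet_simps bil_def complex_eq_iff algebra_simps add_divide_distrib diff_divide_distrib)

lemma potential_eq_vpot: "Re (potential P (doublet v)) = vpot P v"
  unfolding potential_def Let_def cinner2_doublets vpot_def
  by (simp add: mass_vec_def quartic_mat_def inner_4 matrix_vector_mult_def sum_4 add_hc_def
      power2_eq_square algebra_simps add_divide_distrib diff_divide_distrib)

lemma cinner2_sum: "Re (\<Sum>i\<in>UNIV. cinner2 (doublet v i) (doublet v i)) = (v \<bullet> v) / 2"
  by (simp add: sum_2 cinner2_doublets bil_def inner_8 add_divide_distrib)

locale couplings =
  fixes g g' Y :: real
  assumes g: "g \<noteq> 0" and g': "g' \<noteq> 0" and Y: "Y \<noteq> 0"
begin

text \<open>Generators with the couplings absorbed: the covariant derivative is the partial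
  derivative plus the sum over \<open>m\<close> of the gauge field times
  \<open>Tg m\<close>.\<close>

definition Tg :: "3 option \<Rightarrow> real^8 \<Rightarrow> real^8"
  where "Tg m v = (case m of None \<Rightarrow> (g' * Y) *\<^sub>R Jm v | Some a \<Rightarrow> g *\<^sub>R tau a v)"

lemma linear_Tg: "linear (Tg m)"
  by (cases m) (simp_all add: Tg_def[abs_def] linear_Jm linear_tau linear_compose_scale_right)

lemmas Tg_linear = linear_add[OF linear_Tg] linear_cmul[OF linear_Tg] linear_0[OF linear_Tg]

lemma Tg_skew: "Tg m v \<bullet> w = - (v \<bullet> Tg m w)"
  by (cases m) (simp_all add: Tg_def Jm_skew tau_skew)

definition Kcov :: "4 \<Rightarrow> jet \<Rightarrow> real^8"
  where "Kcov \<mu> z = scalars z (unit_index \<mu>) +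
    (\<Sum>m\<in>UNIV. z (Dep (gfield \<mu> m) 0) *\<^sub>R Tg m (scalars z 0))"

definition nonab :: "3 option \<Rightarrow> 4 \<Rightarrow> 4 \<Rightarrow> jet \<Rightarrow> real"
  where "nonab m \<mu> \<nu> z = (case m of None \<Rightarrow> 0 | Some a \<Rightarrow>
    g * (\<Sum>b\<in>UNIV. \<Sum>c\<in>UNIV. levi_civita a b c * z (Dep (WF b \<mu>) 0) * z (Dep (WF c \<nu>) 0)))"

definition strength :: "3 option \<Rightarrow> 4 \<Rightarrow> 4 \<Rightarrow> jet \<Rightarrow> real"
  where "strength m \<mu> \<nu> z = z (Dep (gfield \<nu> m) (unit_index \<mu>))
    - z (Dep (gfield \<mu> m) (unit_index \<nu>)) + nonab m \<mu> \<nu> z"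

definition Lgauge :: "jet \<Rightarrow> real"
  where "Lgauge z = - (1/4) * (\<Sum>m\<in>UNIV. \<Sum>\<mu>\<in>UNIV. \<Sum>\<nu>\<in>UNIV.
    minkowski \<mu> * minkowski \<nu> * (strength m \<mu> \<nu> z)\<^sup>2)"

lemma cov_deriv_eq: "cov_deriv g g' Y z \<mu> i = doublet (Kcov \<mu> z) i"
proof -
  have "cov_deriv g g' Y z \<mu> i $ k = doublet (Kcov \<mu> z) i $ k" for k
    using exhaust_2[of i] exhaust_2[of k]
    by (auto simp: cov_deriv_def Kcov_def sum_option Tg_def sum_3 doublet_simps pauli_def
        matrix_vector_mult_def sum_2 complex_eq_iff Jm_def tau_def add_divide_distrib diff_divide_distrib
        algebra_simps)
  then show ?thesis by (simp add: vec_eq_iff)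
qed

lemma lagrangian_eq:
  "lagrangian g g' Y P z = Lgauge z + (\<Sum>\<mu>\<in>UNIV. minkowski \<mu> * (Kcov \<mu> z \<bullet> Kcov \<mu> z) / 2)
    - vpot P (scalars z 0)"
proof -
  have "Re (\<Sum>i\<in>UNIV. \<Sum>\<mu>\<in>UNIV. of_real (minkowski \<mu>) *
        cinner2 (cov_deriv g g' Y z \<mu> i) (cov_deriv g g' Y z \<mu> i))
    = (\<Sum>\<mu>\<in>UNIV. minkowski \<mu> * Re (\<Sum>i\<in>UNIV. cinner2 (doublet (Kcov \<mu> z) i) (doublet (Kcov \<mu> z) i)))"
    unfolding cov_deriv_eq by (subst sum.swap) (simp add: sum_distrib_left)
  then show ?thesis
    unfolding lagrangian_def potential_eq_vpot cinner2_sum Lgauge_def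
    by (simp add: sum_option strength_def nonab_def B_strength_def W_strength_def algebra_simps)
qed

end

section \<open>Directional derivatives and the Euler expressions\<close>

lemma scalars_nth [simp]: "scalars z J $ i = z (Dep (Phi i) J)"
  by (simp add: scalars_def)

lemma scalars_line: "scalars (\<lambda>c. z c + t * h c) J = scalars z J + t *\<^sub>R scalars h J"
  by (simp add: vec_eq_iff)

lemma linear_eq_sum_axes:
  fixes f :: "real^'n \<Rightarrow> 'b::real_vector"
  assumes "linear f"
  shows "f v = (\<Sum>j\<in>UNIV. v $ j *\<^sub>R f (axis j 1))"
proof -
  have "v = (\<Sum>j\<in>UNIV. v $ j *\<^sub>R axis j 1)"
    by (simp add: vec_eq_iff axis_def if_distrib sum.delta cong: if_cong)
  then have "f v = f (\<Sum>j\<in>UNIV. v $ j *\<^sub>R axis j 1)" by simp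
  then show ?thesis
    by (simp add: linear_sum[OF assms] linear_cmul[OF assms])
qed

lemma linear_nth_eq_sum:
  fixes f :: "real^'n \<Rightarrow> real^'m"
  assumes "linear f"
  shows "f v $ i = (\<Sum>j\<in>UNIV. v $ j * f (axis j 1) $ i)"
  by (subst linear_eq_sum_axes[OF assms]) simp

lemma polyfun_linear_scalars [polyfun_intros]:
  assumes "linear f"
  shows "polyfun (\<lambda>z. (f (scalars z J) :: real^8) $ i)"
  by (subst linear_nth_eq_sum[OF assms], subst scalars_nth, intro polyfun_intros)

lemma polyfun_vpot: "polyfun (\<lambda>z. vpot P (scalars z J))"
proof -
  have "polyfun (\<lambda>z. bil (scalars z J) (scalars z J) $ k)" for k
    using exhaust_4[of k] by (auto simp: bil_def intro!: polyfun_intros)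
  then show ?thesis
    unfolding vpot_def inner_4 matrix_vector_mult_def sum_4
    by (auto intro!: polyfun_intros)
qed

definition dvpot :: "potential_params \<Rightarrow> real^8 \<Rightarrow> real^8 \<Rightarrow> real"
  where "dvpot P v w = 2 * (mass_vec P \<bullet> bil v w) + 2 * (bil v w \<bullet> (quartic_mat P *v bil v v))"

definition ddvpot :: "potential_params \<Rightarrow> real^8 \<Rightarrow> real^8 \<Rightarrow> real^8 \<Rightarrow> real"
  where "ddvpot P v u w = 2 * (mass_vec P \<bullet> bil u w) + 2 * (bil u w \<bullet> (quartic_mat P *v bil v v))
    + 4 * (bil v w \<bullet> (quartic_mat P *v bil v u))"

lemmas bil_linear = bil_add_left bil_add_right bil_scaleR_left bil_scaleR_right

lemma vpot_line: "((\<lambda>t. vpot P (v + t *\<^sub>R w)) has_real_derivative dvpot P v w) (at 0)"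
proof -
  define m where "m = mass_vec P"
  define a b c where "a = bil v v" and "b = bil v w" and "c = bil w w"
  have "bil w v = b" by (simp add: b_def bil_sym)
  then have e: "bil (v + t *\<^sub>R w) (v + t *\<^sub>R w) = a + (2 * t) *\<^sub>R b + t\<^sup>2 *\<^sub>R c" for t
    by (simp add: bil_linear a_def b_def c_def power2_eq_square algebra_simps vec_eq_iff)
  have s: "b \<bullet> (quartic_mat P *v a) = a \<bullet> (quartic_mat P *v b)"
    by (metis quartic_mat_sym inner_commute)
  show ?thesis
    unfolding vpot_def dvpot_def e m_def[symmetric] a_def[symmetric] b_def[symmetric]
    by (auto intro!: derivative_eq_intros simp: matrix_vector_right_distrib matrix_vector_mult_scaleR
        inner_simps algebra_simps s)
qed

lemma dvpot_line: "((\<lambda>t. dvpot P (v + t *\<^sub>R u) w) has_real_derivative ddvpot P v u w) (at 0)"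
proof -
  define a b c where "a = bil v v" and "b = bil v u" and "c = bil u u"
  have "bil u v = b" by (simp add: b_def bil_sym)
  then have e: "bil (v + t *\<^sub>R u) (v + t *\<^sub>R u) = a + (2 * t) *\<^sub>R b + t\<^sup>2 *\<^sub>R c" for t
    by (simp add: bil_linear a_def b_def c_def power2_eq_square algebra_simps vec_eq_iff)
  show ?thesis
    unfolding dvpot_def ddvpot_def e a_def[symmetric] b_def[symmetric]
    by (auto intro!: derivative_eq_intros simp: matrix_vector_right_distrib matrix_vector_mult_scaleR
        inner_simps bil_linear algebra_simps)
qed

context couplings begin

definition Acov :: "4 \<Rightarrow> jet \<Rightarrow> real^8 \<Rightarrow> real^8"
  where "Acov \<mu> z v = (\<Sum>m\<in>UNIV. z (Dep (gfield \<mu> m) 0) *\<^sub>R Tg m v)"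

lemma linear_Acov: "linear (Acov \<mu> z)"
  unfolding Acov_def[abs_def]
  by (rule linearI) (simp_all add: Tg_linear algebra_simps sum.distrib scaleR_sum_right)

lemmas Acov_linear = linear_add[OF linear_Acov] linear_cmul[OF linear_Acov] linear_0[OF linear_Acov]

lemma Acov_skew: "Acov \<mu> z v \<bullet> w = - (v \<bullet> Acov \<mu> z w)"
  by (simp add: Acov_def inner_sum_left inner_sum_right Tg_skew sum_negf)

lemma Kcov_Acov: "Kcov \<mu> z = scalars z (unit_index \<mu>) + Acov \<mu> z (scalars z 0)"
  by (simp add: Kcov_def Acov_def)

lemma Acov_line: "Acov \<mu> (\<lambda>c. z c + t * h c) v = Acov \<mu> z v + t *\<^sub>R Acov \<mu> h v"
  by (simp add: Acov_def algebra_simps sum.distrib scaleR_sum_right)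

definition dKcov :: "4 \<Rightarrow> jet \<Rightarrow> jet \<Rightarrow> real^8"
  where "dKcov \<mu> z h = scalars h (unit_index \<mu>) + Acov \<mu> h (scalars z 0) + Acov \<mu> z (scalars h 0)"

lemma Kcov_line_eq: "Kcov \<mu> (\<lambda>c. z c + t * h c) =
    Kcov \<mu> z + t *\<^sub>R dKcov \<mu> z h + t\<^sup>2 *\<^sub>R Acov \<mu> h (scalars h 0)"
  unfolding Kcov_Acov scalars_line Acov_line dKcov_def
  by (simp add: Acov_linear algebra_simps power2_eq_square)

lemma Kcov_inner_line:
  "((\<lambda>t. Kcov \<mu> (\<lambda>c. z c + t * h c) \<bullet> v) has_real_derivative dKcov \<mu> z h \<bullet> v) (at 0)"
  "((\<lambda>t. Kcov \<mu> (\<lambda>c. z c + t * h c) $ i) has_real_derivative dKcov \<mu> z h $ i) (at 0)"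
  "((\<lambda>t. Kcov \<mu> (\<lambda>c. z c + t * h c) \<bullet> Kcov \<mu> (\<lambda>c. z c + t * h c)) has_real_derivative
     2 * (Kcov \<mu> z \<bullet> dKcov \<mu> z h)) (at 0)"
  unfolding Kcov_line_eq
  by (auto intro!: derivative_eq_intros simp: inner_simps inner_commute)

lemma polyfun_Acov [polyfun_intros]: "polyfun (\<lambda>z. Acov \<mu> z (scalars z J) $ i)"
  unfolding Acov_def by (simp, intro polyfun_intros linear_Tg)

lemma polyfun_Kcov [polyfun_intros]: "polyfun (\<lambda>z. Kcov \<mu> z $ i)"
  unfolding Kcov_Acov by (simp, intro polyfun_intros)

lemma polyfun_nonab [polyfun_intros]: "polyfun (nonab m \<mu> \<nu>)"
  unfolding nonab_def[abs_def] by (cases m) (auto intro!: polyfun_intros)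

lemma polyfun_strength [polyfun_intros]: "polyfun (strength m \<mu> \<nu>)"
proof -
  have "polyfun (\<lambda>z. nonab m \<mu> \<nu> z)" by (simp add: polyfun_nonab)
  then show ?thesis unfolding strength_def[abs_def] by (intro polyfun_intros)
qed

lemma polyfun_Lgauge: "polyfun Lgauge"
proof -
  have "polyfun (\<lambda>z. strength m \<mu> \<nu> z)" for m \<mu> \<nu> by (simp add: polyfun_strength)
  then show ?thesis unfolding Lgauge_def[abs_def] by (intro polyfun_intros)
qed

abbreviation "Lag P \<equiv> lagrangian g g' Y P"

lemma polyfun_lagrangian: "polyfun (Lag P)"
proof -
  have "polyfun (\<lambda>z. Lgauge z)" by (simp add: polyfun_Lgauge)
  then have "polyfun (\<lambda>z. Lgauge z + (\<Sum>\<mu>\<in>UNIV. minkowski \<mu> * (Kcov \<mu> z \<bullet> Kcov \<mu> z) / 2)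
    - vpot P (scalars z 0))"
    unfolding inner_8 by (intro polyfun_intros polyfun_vpot)
  then show ?thesis by (simp add: lagrangian_eq[abs_def])
qed

lemma lagrangian_line:
  assumes "((\<lambda>t. Lgauge (\<lambda>c. z c + t * h c)) has_real_derivative D) (at 0)"
  shows "((\<lambda>t. Lag P (\<lambda>c. z c + t * h c)) has_real_derivative
    D + (\<Sum>\<mu>\<in>UNIV. minkowski \<mu> * (Kcov \<mu> z \<bullet> dKcov \<mu> z h)) - dvpot P (scalars z 0) (scalars h 0)) (at 0)"
proof -
  have "((\<lambda>t. minkowski \<mu> * (Kcov \<mu> (\<lambda>c. z c + t * h c) \<bullet> Kcov \<mu> (\<lambda>c. z c + t * h c)) / 2) has_real_derivative
      minkowski \<mu> * (Kcov \<mu> z \<bullet> dKcov \<mu> z h)) (at 0)" for \<mu>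
    using DERIV_cdivide[OF DERIV_cmult[OF Kcov_inner_line(3)], of "minkowski \<mu>" \<mu> z h 2] by simp
  then show ?thesis
    unfolding lagrangian_eq scalars_line
    by (intro DERIV_diff DERIV_add DERIV_sum assms vpot_line)
qed

definition scalar_dir :: "jet \<Rightarrow> bool"
  where "scalar_dir h \<longleftrightarrow> (\<forall>\<mu> m J. h (Dep (gfield \<mu> m) J) = 0)"

text \<open>Agreement of the gauge fields to first order, which is all that \<open>Lgauge\<close>
  sees.\<close>

definition gauge_agree :: "jet \<Rightarrow> jet \<Rightarrow> bool"
  where "gauge_agree z z' \<longleftrightarrow> (\<forall>\<mu> m. z (Dep (gfield \<mu> m) 0) = z' (Dep (gfield \<mu> m) 0) \<and>
    (\<forall>\<nu>. z (Dep (gfield \<mu> m) (unit_index \<nu>)) = z' (Dep (gfield \<mu> m) (unit_index \<nu>))))"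

lemma gauge_agree_scalar_dir: "scalar_dir h \<Longrightarrow> gauge_agree (\<lambda>c. z c + t * h c) z"
  by (simp add: scalar_dir_def gauge_agree_def)

lemma gauge_agree_WF:
  assumes "gauge_agree z z'"
  shows "z (Dep (WF a \<mu>) 0) = z' (Dep (WF a \<mu>) 0)"
    "z (Dep (WF a \<mu>) (unit_index \<nu>)) = z' (Dep (WF a \<mu>) (unit_index \<nu>))"
  using assms unfolding gauge_agree_def by (metis gfield_simps(2))+

lemma gauge_agree_upd: "gauge_agree z z' \<Longrightarrow> gauge_agree (z(c := t)) (z'(c := t))"
  by (simp add: gauge_agree_def)

lemma strength_cong:
  assumes "gauge_agree z z'"
  shows "strength m \<mu> \<nu> z = strength m \<mu> \<nu> z'"
proof -
  have "nonab m \<mu> \<nu> z = nonab m \<mu> \<nu> z'"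
    by (cases m) (simp_all add: nonab_def gauge_agree_WF[OF assms])
  then show ?thesis using assms by (simp add: strength_def gauge_agree_def)
qed

lemma Lgauge_cong: "gauge_agree z z' \<Longrightarrow> Lgauge z = Lgauge z'"
  unfolding Lgauge_def by (simp add: strength_cong[of z z'])

lemma lagrangian_scalar_line:
  assumes "scalar_dir h"
  shows "((\<lambda>t. Lag P (\<lambda>c. z c + t * h c)) has_real_derivative
    (\<Sum>\<mu>\<in>UNIV. minkowski \<mu> * (Kcov \<mu> z \<bullet> (scalars h (unit_index \<mu>) + Acov \<mu> z (scalars h 0))))
    - dvpot P (scalars z 0) (scalars h 0)) (at 0)"
proof -
  have "Lgauge (\<lambda>c. z c + t * h c) = Lgauge z" for t
    by (rule Lgauge_cong[OF gauge_agree_scalar_dir[OF assms]])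
  then have "((\<lambda>t. Lgauge (\<lambda>c. z c + t * h c)) has_real_derivative 0) (at 0)" by simp
  from lagrangian_line[OF this] show ?thesis
    using assms by (simp add: dKcov_def Acov_def scalar_dir_def)
qed

section \<open>Euler expressions of the scalars\<close>

lemma scalars_coord_dir:
  "scalars (coord_dir (Dep (Phi i) J)) J' = (if J' = J then axis i 1 else 0)"
  "scalars (coord_dir (Dep (gfield \<mu> m) J)) J' = 0"
  by (auto simp: vec_eq_iff coord_dir_def axis_def)

lemma scalar_dir_coord_dir: "scalar_dir (coord_dir (Dep (Phi i) J))"
  by (simp add: scalar_dir_def coord_dir_def)

lemma pd_scalar_0:
  "pd (Dep (Phi i) 0) (Lag P) z =
    - (\<Sum>\<mu>\<in>UNIV. minkowski \<mu> * Acov \<mu> z (Kcov \<mu> z) $ i) - dvpot P (scalars z 0) (axis i 1)"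
proof -
  have "Kcov \<mu> z \<bullet> Acov \<mu> z (axis i 1) = - Acov \<mu> z (Kcov \<mu> z) $ i" for \<mu>
    using Acov_skew[of \<mu> z "Kcov \<mu> z" "axis i 1"] by (simp add: inner_axis)
  then show ?thesis
    using lagrangian_scalar_line[OF scalar_dir_coord_dir, of P z i 0]
    by (intro pd_along_eqI) (simp add: scalars_coord_dir sum_negf)
qed

lemma pd_scalar_unit:
  "pd (Dep (Phi i) (unit_index \<mu>)) (Lag P) z = minkowski \<mu> * Kcov \<mu> z $ i"
proof -
  have "(\<Sum>\<nu>\<in>UNIV. minkowski \<nu> * (Kcov \<nu> z \<bullet> (scalars (coord_dir (Dep (Phi i) (unit_index \<mu>))) (unit_index \<nu>) +
     Acov \<nu> z (scalars (coord_dir (Dep (Phi i) (unit_index \<mu>))) 0))))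
    = (\<Sum>\<nu>\<in>UNIV. if \<nu> = \<mu> then minkowski \<nu> * Kcov \<nu> z $ i else 0)"
    by (rule sum.cong) (auto simp: scalars_coord_dir Acov_linear inner_axis)
  also have "\<dots> = minkowski \<mu> * Kcov \<mu> z $ i" by (simp add: sum.delta)
  moreover have "dvpot P v 0 = 0" for v
    using bil_scaleR_right[of v 0 0] by (simp add: dvpot_def)
  ultimately show ?thesis
    using lagrangian_scalar_line[OF scalar_dir_coord_dir, of P z i "unit_index \<mu>"]
    by (intro pd_along_eqI) (simp add: scalars_coord_dir)
qed

text \<open>The covariant d'Alembertian of the scalars.\<close>

definition box_scalar :: "jet \<Rightarrow> real^8"
  where "box_scalar z = (\<Sum>\<mu>\<in>UNIV. minkowski \<mu> *\<^sub>R (Acov \<mu> z (Kcov \<mu> z) + dKcov \<mu> z (shift \<mu> z)))"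

lemma euler_scalar:
  "euler (Lag P) (Phi i) z = - box_scalar z $ i - dvpot P (scalars z 0) (axis i 1)"
proof -
  have "total_deriv \<mu> (pd (Dep (Phi i) (unit_index \<mu>)) (Lag P)) z = minkowski \<mu> * dKcov \<mu> z (shift \<mu> z) $ i" for \<mu>
  proof (rule total_deriv_eqI)
    show "local_function (pd (Dep (Phi i) (unit_index \<mu>)) (Lag P))"
      by (intro polyfun_local polyfun_pd polyfun_lagrangian)
    show "((\<lambda>t. pd (Dep (Phi i) (unit_index \<mu>)) (Lag P) (\<lambda>c. z c + t * shift \<mu> z c)) has_real_derivative
        minkowski \<mu> * dKcov \<mu> z (shift \<mu> z) $ i) (at 0)"
      unfolding pd_scalar_unit by (intro DERIV_cmult Kcov_inner_line)
  qed
  then show ?thesis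
    unfolding euler_def pd_scalar_0
    by (simp add: box_scalar_def sum.distrib algebra_simps)
qed

lemma scalars_shift [simp]: "scalars (shift \<mu> z) J = scalars z (J + unit_index \<mu>)"
  by (simp add: vec_eq_iff shift_def)

section \<open>Euler expressions of the gauge fields\<close>

lemma strength_line_unit:
  "strength n \<alpha> \<beta> (\<lambda>c. z c + t * coord_dir (Dep (gfield \<nu> m) (unit_index \<mu>)) c) =
   strength n \<alpha> \<beta> z + t * ((if n = m \<and> \<alpha> = \<mu> \<and> \<beta> = \<nu> then 1 else 0) - (if n = m \<and> \<alpha> = \<nu> \<and> \<beta> = \<mu> then 1 else 0))"
proof -
  let ?h = "coord_dir (Dep (gfield \<nu> m) (unit_index \<mu>))"
  have 0: "?h (Dep f 0) = 0" for f by (simp add: coord_dir_def)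
  have "nonab n \<alpha> \<beta> (\<lambda>c. z c + t * ?h c) = nonab n \<alpha> \<beta> z"
    by (cases n) (simp_all add: nonab_def 0)
  moreover have "?h (Dep (gfield \<beta> n) (unit_index \<alpha>)) = (if n = m \<and> \<alpha> = \<mu> \<and> \<beta> = \<nu> then 1 else 0)"
    for \<alpha> \<beta> by (auto simp: coord_dir_def)
  ultimately show ?thesis
    unfolding strength_def by (simp add: right_diff_distrib conj_commute conj_left_commute)
qed

text \<open>A first derivative of a gauge field enters the strength once for each order of the two
  indices, with opposite signs; hence the difference.\<close>

lemma pd_gauge_unit:
  "pd (Dep (gfield \<nu> m) (unit_index \<mu>)) (Lag P) z =
    - (1/2) * minkowski \<mu> * minkowski \<nu> * (strength m \<mu> \<nu> z - strength m \<nu> \<mu> z)"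
proof -
  let ?\<delta> = "\<lambda>n \<alpha> \<beta>. (if n = m \<and> \<alpha> = \<mu> \<and> \<beta> = \<nu> then 1 else 0) - (if n = m \<and> \<alpha> = \<nu> \<and> \<beta> = \<mu> then 1 else 0) :: real"
  let ?h = "coord_dir (Dep (gfield \<nu> m) (unit_index \<mu>))"
  have D: "((\<lambda>t. Lgauge (\<lambda>c. z c + t * ?h c)) has_real_derivative
      - (1/4) * (\<Sum>n\<in>UNIV. \<Sum>\<alpha>\<in>UNIV. \<Sum>\<beta>\<in>UNIV. minkowski \<alpha> * minkowski \<beta> * (2 * strength n \<alpha> \<beta> z * ?\<delta> n \<alpha> \<beta>))) (at 0)"
    unfolding Lgauge_def strength_line_unit
    by (rule derivative_eq_intros refl)+ (simp add: ac_simps)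
  have "(\<Sum>n\<in>UNIV. \<Sum>\<alpha>\<in>UNIV. \<Sum>\<beta>\<in>UNIV. minkowski \<alpha> * minkowski \<beta> * (2 * strength n \<alpha> \<beta> z * ?\<delta> n \<alpha> \<beta>))
    = (\<Sum>n\<in>UNIV. \<Sum>\<alpha>\<in>UNIV. \<Sum>\<beta>\<in>UNIV. if \<beta> = \<nu> then if \<alpha> = \<mu> then if n = m then
        minkowski \<alpha> * minkowski \<beta> * (2 * strength n \<alpha> \<beta> z) else 0 else 0 else 0)
    - (\<Sum>n\<in>UNIV. \<Sum>\<alpha>\<in>UNIV. \<Sum>\<beta>\<in>UNIV. if \<beta> = \<mu> then if \<alpha> = \<nu> then if n = m then
        minkowski \<alpha> * minkowski \<beta> * (2 * strength n \<alpha> \<beta> z) else 0 else 0 else 0)"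
    unfolding sum_subtractf[symmetric] by (intro sum.cong refl) auto
  then have S: "(\<Sum>n\<in>UNIV. \<Sum>\<alpha>\<in>UNIV. \<Sum>\<beta>\<in>UNIV. minkowski \<alpha> * minkowski \<beta> * (2 * strength n \<alpha> \<beta> z * ?\<delta> n \<alpha> \<beta>))
    = 2 * minkowski \<mu> * minkowski \<nu> * (strength m \<mu> \<nu> z - strength m \<nu> \<mu> z)"
    by (simp add: sum.delta right_diff_distrib)
  have "((\<lambda>t. Lgauge (\<lambda>c. z c + t * ?h c)) has_real_derivative
     - (1/2) * minkowski \<mu> * minkowski \<nu> * (strength m \<mu> \<nu> z - strength m \<nu> \<mu> z)) (at 0)"
    using D unfolding S by (simp add: mult.assoc)
  from lagrangian_line[OF this, of P] have "((\<lambda>t. Lag P (\<lambda>c. z c + t * ?h c)) has_real_derivative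
     - (1/2) * minkowski \<mu> * minkowski \<nu> * (strength m \<mu> \<nu> z - strength m \<nu> \<mu> z)
     + (\<Sum>\<kappa>\<in>UNIV. minkowski \<kappa> * (Kcov \<kappa> z \<bullet> dKcov \<kappa> z ?h)) - dvpot P (scalars z 0) (scalars ?h 0)) (at 0)" .
  moreover have "Acov \<kappa> ?h v = 0" for \<kappa> v
    by (simp add: Acov_def coord_dir_def)
  ultimately have "((\<lambda>t. Lag P (\<lambda>c. z c + t * ?h c)) has_real_derivative
     - (1/2) * minkowski \<mu> * minkowski \<nu> * (strength m \<mu> \<nu> z - strength m \<nu> \<mu> z)) (at 0)"
    using bil_scaleR_right[of "scalars z 0" 0 0]
    by (simp add: dKcov_def scalars_coord_dir Acov_linear dvpot_def)
  then show ?thesis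
    by (intro pd_along_eqI) simp
qed

lemma pd_gauge_0:
  "pd (Dep (gfield \<nu> m) 0) (Lag P) z =
    pd (Dep (gfield \<nu> m) 0) Lgauge z + minkowski \<nu> * (Kcov \<nu> z \<bullet> Tg m (scalars z 0))"
proof -
  let ?c = "Dep (gfield \<nu> m) 0"
  have eq: "z(?c := z ?c + t) = (\<lambda>c. z c + t * coord_dir ?c c)" for t
    by (auto simp: coord_dir_def)
  have "((\<lambda>t. Lgauge (z(?c := z ?c + t))) has_real_derivative pd ?c Lgauge z) (at 0)"
    using DERIV_chain'[of "\<lambda>t. z ?c + t" 1 0 UNIV "\<lambda>t. Lgauge (z(?c := t))"]
      polyfun_DERIV[OF polyfun_Lgauge, of z ?c] DERIV_shift[of "\<lambda>t. Lgauge (z(?c := t))" _ 0 "z ?c"]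
    by (simp add: add.commute)
  note lagrangian_line[OF this[unfolded eq], of P]
  moreover have "(\<Sum>\<mu>\<in>UNIV. minkowski \<mu> * (Kcov \<mu> z \<bullet> dKcov \<mu> z (coord_dir ?c)))
    = (\<Sum>\<mu>\<in>UNIV. if \<mu> = \<nu> then minkowski \<mu> * (Kcov \<mu> z \<bullet> Tg m (scalars z 0)) else 0)"
  proof (rule sum.cong)
    fix \<mu>
    have "Acov \<mu> (coord_dir ?c) v = (\<Sum>n\<in>UNIV. if n = m then if \<mu> = \<nu> then Tg n v else 0 else 0)" for v
      unfolding Acov_def by (rule sum.cong) (auto simp: coord_dir_def)
    then show "minkowski \<mu> * (Kcov \<mu> z \<bullet> dKcov \<mu> z (coord_dir ?c)) =
        (if \<mu> = \<nu> then minkowski \<mu> * (Kcov \<mu> z \<bullet> Tg m (scalars z 0)) else 0)"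
      by (simp add: dKcov_def scalars_coord_dir Acov_linear)
  qed simp
  ultimately have "((\<lambda>t. Lag P (\<lambda>c. z c + t * coord_dir ?c c)) has_real_derivative
    pd ?c Lgauge z + minkowski \<nu> * (Kcov \<nu> z \<bullet> Tg m (scalars z 0))) (at 0)"
    using bil_scaleR_right[of "scalars z 0" 0 0]
    by (simp add: scalars_coord_dir dvpot_def)
  then show ?thesis
    by (intro pd_along_eqI) simp
qed

definition dnonab :: "3 option \<Rightarrow> 4 \<Rightarrow> 4 \<Rightarrow> jet \<Rightarrow> jet \<Rightarrow> real"
  where "dnonab m \<mu> \<nu> z h = (case m of None \<Rightarrow> 0 | Some a \<Rightarrow>
    g * (\<Sum>b\<in>UNIV. \<Sum>c\<in>UNIV. levi_civita a b c *
      (h (Dep (WF b \<mu>) 0) * z (Dep (WF c \<nu>) 0) + z (Dep (WF b \<mu>) 0) * h (Dep (WF c \<nu>) 0))))"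

lemma nonab_line: "((\<lambda>t. nonab m \<mu> \<nu> (\<lambda>c. z c + t * h c)) has_real_derivative dnonab m \<mu> \<nu> z h) (at 0)"
proof (cases m)
  case (Some a)
  show ?thesis
    unfolding Some nonab_def dnonab_def option.case
    by (rule derivative_eq_intros refl)+ (simp add: algebra_simps)
qed (simp add: nonab_def dnonab_def)

lemma strength_line:
  "((\<lambda>t. strength m \<mu> \<nu> (\<lambda>c. z c + t * h c)) has_real_derivative
    h (Dep (gfield \<nu> m) (unit_index \<mu>)) - h (Dep (gfield \<mu> m) (unit_index \<nu>)) + dnonab m \<mu> \<nu> z h) (at 0)"
proof -
  have "((\<lambda>t. z c + t * h c) has_real_derivative h c) (at 0)" for c
    by (auto intro!: derivative_eq_intros)
  then show ?thesis
    unfolding strength_def by (intro DERIV_add DERIV_diff nonab_line)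
qed

text \<open>The contribution of the gauge fields to their Euler expression that contains no second
  derivatives. It stays unevaluated because a scalar generator does not change it.\<close>

definition gauge_lower :: "4 \<Rightarrow> 3 option \<Rightarrow> jet \<Rightarrow> real"
  where "gauge_lower \<nu> m z = pd (Dep (gfield \<nu> m) 0) Lgauge z +
    (\<Sum>\<mu>\<in>UNIV. (1/2) * minkowski \<mu> * minkowski \<nu> * (dnonab m \<mu> \<nu> z (shift \<mu> z) - dnonab m \<nu> \<mu> z (shift \<mu> z)))"

lemma gauge_lower_cong:
  assumes "gauge_agree z z'"
  shows "gauge_lower \<nu> m z = gauge_lower \<nu> m z'"
proof -
  have "Lgauge (z(Dep (gfield \<nu> m) 0 := t)) = Lgauge (z'(Dep (gfield \<nu> m) 0 := t))" for t
    by (rule Lgauge_cong[OF gauge_agree_upd[OF assms]])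
  moreover have "z (Dep (gfield \<nu> m) 0) = z' (Dep (gfield \<nu> m) 0)"
    using assms by (simp add: gauge_agree_def)
  ultimately have "pd (Dep (gfield \<nu> m) 0) Lgauge z = pd (Dep (gfield \<nu> m) 0) Lgauge z'"
    by (simp add: pd_def)
  moreover have "dnonab m \<mu> \<nu>' z (shift \<kappa> z) = dnonab m \<mu> \<nu>' z' (shift \<kappa> z')" for \<mu> \<nu>' \<kappa>
    by (cases m) (simp_all add: dnonab_def gauge_agree_WF[OF assms])
  ultimately show ?thesis by (simp add: gauge_lower_def)
qed

lemma euler_gauge:
  "euler (Lag P) (gfield \<nu> m) z = gauge_lower \<nu> m z + minkowski \<nu> * (Kcov \<nu> z \<bullet> Tg m (scalars z 0))
    + (\<Sum>\<mu>\<in>UNIV. minkowski \<mu> * minkowski \<nu> * (z (Dep (gfield \<nu> m) (unit_index \<mu> + unit_index \<mu>))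
        - z (Dep (gfield \<mu> m) (unit_index \<nu> + unit_index \<mu>))))"
proof -
  have td: "total_deriv \<mu> (pd (Dep (gfield \<nu> m) (unit_index \<mu>)) (Lag P)) z =
    - (1/2) * minkowski \<mu> * minkowski \<nu> * (2 * (z (Dep (gfield \<nu> m) (unit_index \<mu> + unit_index \<mu>))
        - z (Dep (gfield \<mu> m) (unit_index \<nu> + unit_index \<mu>)))
        + dnonab m \<mu> \<nu> z (shift \<mu> z) - dnonab m \<nu> \<mu> z (shift \<mu> z))" for \<mu>
  proof (rule total_deriv_eqI)
    show "local_function (pd (Dep (gfield \<nu> m) (unit_index \<mu>)) (Lag P))"
      by (intro polyfun_local polyfun_pd polyfun_lagrangian)
  next
    show "((\<lambda>t. pd (Dep (gfield \<nu> m) (unit_index \<mu>)) (Lag P) (\<lambda>c. z c + t * shift \<mu> z c)) has_real_derivative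
      - (1/2) * minkowski \<mu> * minkowski \<nu> * (2 * (z (Dep (gfield \<nu> m) (unit_index \<mu> + unit_index \<mu>))
        - z (Dep (gfield \<mu> m) (unit_index \<nu> + unit_index \<mu>)))
        + dnonab m \<mu> \<nu> z (shift \<mu> z) - dnonab m \<nu> \<mu> z (shift \<mu> z))) (at 0)"
      unfolding pd_gauge_unit
      using DERIV_cmult[OF DERIV_diff[OF strength_line strength_line],
          of "- (1/2) * minkowski \<mu> * minkowski \<nu>" m \<mu> \<nu> z "shift \<mu> z" m \<nu> \<mu> z "shift \<mu> z"]
      by (rule DERIV_cong) (simp add: algebra_simps)
  qed
  have "(\<Sum>\<mu>\<in>UNIV. total_deriv \<mu> (pd (Dep (gfield \<nu> m) (unit_index \<mu>)) (Lag P)) z) =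
    - (\<Sum>\<mu>\<in>UNIV. (1/2) * minkowski \<mu> * minkowski \<nu> * (dnonab m \<mu> \<nu> z (shift \<mu> z) - dnonab m \<nu> \<mu> z (shift \<mu> z)))
    - (\<Sum>\<mu>\<in>UNIV. minkowski \<mu> * minkowski \<nu> * (z (Dep (gfield \<nu> m) (unit_index \<mu> + unit_index \<mu>))
        - z (Dep (gfield \<mu> m) (unit_index \<nu> + unit_index \<mu>))))"
    unfolding sum_negf[symmetric] sum_subtractf[symmetric]
    by (intro sum.cong refl) (simp add: td algebra_simps)
  then show ?thesis
    unfolding euler_def pd_gauge_0 gauge_lower_def by simp
qed

section \<open>The prolonged Lagrangian and the prolonged gauge equations\<close>

lemma scalar_dir_prol_dir: "scalar_dir (prol_dir X z)"
  by (simp add: scalar_dir_def prol_dir_def gfield_def split: option.splits)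

lemma prolong_lagrangian:
  "prolong X (Lag P) z =
    (\<Sum>\<mu>\<in>UNIV. minkowski \<mu> * (Kcov \<mu> z \<bullet> (scalars (prol_dir X z) (unit_index \<mu>) + Acov \<mu> z (scalars (prol_dir X z) 0))))
    - dvpot P (scalars z 0) (scalars (prol_dir X z) 0)"
  by (intro prolong_eqI polyfun_local polyfun_lagrangian lagrangian_scalar_line scalar_dir_prol_dir)

text \<open>The scalars enter the gauge equation only through the current
  \<open>Kcov \<nu> z \<bullet> Tg m (scalars z 0)\<close>. What remains is its variation, which
  contains at most first derivatives.\<close>

lemma prolong_euler_gauge:
  "prolong X (euler (Lag P) (gfield \<nu> m)) z =
    minkowski \<nu> * ((scalars (prol_dir X z) (unit_index \<nu>) + Acov \<nu> z (scalars (prol_dir X z) 0)) \<bullet> Tg m (scalars z 0)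
      + Kcov \<nu> z \<bullet> Tg m (scalars (prol_dir X z) 0))"
proof (rule prolong_eqI)
  define h where "h = prol_dir X z"
  have h: "scalar_dir h" by (simp add: h_def scalar_dir_prol_dir)
  have eq: "euler (Lag P) (gfield \<nu> m) (\<lambda>c. z c + t * h c) =
     euler (Lag P) (gfield \<nu> m) z + minkowski \<nu> * (Kcov \<nu> (\<lambda>c. z c + t * h c) \<bullet> Tg m (scalars z 0)
       + t * (Kcov \<nu> (\<lambda>c. z c + t * h c) \<bullet> Tg m (scalars h 0)) - Kcov \<nu> z \<bullet> Tg m (scalars z 0))" for t
  proof -
    define z' where "z' = (\<lambda>c. z c + t * h c)"
    have "z' (Dep (gfield \<mu> n) J) = z (Dep (gfield \<mu> n) J)" for \<mu> n J
      using h by (simp add: z'_def scalar_dir_def)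
    moreover have "scalars z' 0 = scalars z 0 + t *\<^sub>R scalars h 0"
      by (simp add: z'_def scalars_line)
    moreover have "gauge_lower \<nu> m z' = gauge_lower \<nu> m z"
      unfolding z'_def by (rule gauge_lower_cong[OF gauge_agree_scalar_dir[OF h]])
    ultimately show ?thesis
      unfolding z'_def[symmetric] euler_gauge
      by (simp add: Tg_linear inner_add_right right_diff_distrib distrib_left)
  qed
  have "dKcov \<nu> z h = scalars h (unit_index \<nu>) + Acov \<nu> z (scalars h 0)"
    using h by (simp add: dKcov_def Acov_def scalar_dir_def)
  note d = Kcov_inner_line(1)[of \<nu> z h, unfolded this]
  show "((\<lambda>t. euler (Lag P) (gfield \<nu> m) (\<lambda>c. z c + t * prol_dir X z c)) has_real_derivative
     minkowski \<nu> * ((scalars (prol_dir X z) (unit_index \<nu>) + Acov \<nu> z (scalars (prol_dir X z) 0)) \<bullet> Tg m (scalars z 0)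
      + Kcov \<nu> z \<bullet> Tg m (scalars (prol_dir X z) 0))) (at 0)"
    unfolding h_def[symmetric] eq
    using DERIV_add[OF DERIV_const DERIV_cmult[OF DERIV_diff[OF DERIV_add[OF d DERIV_mult[OF DERIV_ident d]] DERIV_const]],
      of "euler (Lag P) (gfield \<nu> m) z" "minkowski \<nu>" "Tg m (scalars z 0)" "Tg m (scalars h 0)" "Kcov \<nu> z \<bullet> Tg m (scalars z 0)"]
    by (rule DERIV_cong) simp
qed (intro polyfun_local polyfun_euler polyfun_lagrangian)

end

section \<open>Scalar generators\<close>

lemma finite_dep_var: "finite (UNIV :: dep_var set)"
proof -
  have eq: "UNIV = range Phi \<union> range BF \<union> range (\<lambda>(a, \<mu>). WF a \<mu>)"
  proof (rule set_eqI)
    fix f show "f \<in> UNIV \<longleftrightarrow> f \<in> range Phi \<union> range BF \<union> range (\<lambda>(a, \<mu>). WF a \<mu>)"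
      by (cases f) auto
  qed
  show ?thesis by (subst eq) simp
qed

definition fields :: "jet \<Rightarrow> dep_var \<Rightarrow> real"
  where "fields z = (\<lambda>f. z (Dep f 0))"

definition ph :: "(dep_var \<Rightarrow> real) \<Rightarrow> real^8"
  where "ph y = (\<chi> i. y (Phi i))"

definition emb :: "real^8 \<Rightarrow> dep_var \<Rightarrow> real"
  where "emb v f = (case f of Phi i \<Rightarrow> v $ i | _ \<Rightarrow> 0)"

lemma ph_nth [simp]: "ph y $ i = y (Phi i)"
  by (simp add: ph_def)

lemma ph_emb [simp]: "ph (emb v) = v"
  by (simp add: vec_eq_iff emb_def)

lemma ph_fields [simp]: "ph (fields z) = scalars z 0"
  by (simp add: vec_eq_iff fields_def)

lemma ph_line: "ph (\<lambda>f. y f + t * w f) = ph y + t *\<^sub>R ph w"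
  by (simp add: vec_eq_iff)

lemma emb_line: "emb (u + t *\<^sub>R v) = (\<lambda>f. emb u f + t * emb v f)"
  by (auto simp: emb_def split: dep_var.splits)

text \<open>The differential of the coefficients. The sum includes the gauge fields because the
  coefficients may depend on them.\<close>

definition dgen :: "generator \<Rightarrow> (dep_var \<Rightarrow> real) \<Rightarrow> (dep_var \<Rightarrow> real) \<Rightarrow> real^8"
  where "dgen X y w = (\<chi> i. \<Sum>f\<in>UNIV. w f * pd f (\<lambda>y. X y $ i) y)"

lemma dgen_chain:
  assumes "scalar_generator X"
    and "\<And>f. ((\<lambda>t. p t f) has_real_derivative p' f) (at t0)"
  shows "((\<lambda>t. X (p t) $ i) has_real_derivative dgen X (p t0) p' $ i) (at t0)"
proof -
  have "smooth (\<lambda>y. X y $ i)" using assms(1) by (simp add: scalar_generator_def)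
  moreover have "depends_on (\<lambda>y. X y $ i) UNIV"
  proof -
    have "y = y'" if "\<forall>c\<in>UNIV. y c = y' c" for y y' :: "dep_var \<Rightarrow> real"
      using that by auto
    then show ?thesis unfolding depends_on_def by metis
  qed
  ultimately show ?thesis
    using chain_rule[OF _ finite_dep_var _ assms(2), of "\<lambda>y. X y $ i"] by (simp add: dgen_def)
qed

lemma dgen_line:
  assumes "scalar_generator X"
  shows "((\<lambda>t. X (\<lambda>f. y f + t * w f) $ i) has_real_derivative dgen X (\<lambda>f. y f + t * w f) w $ i) (at t)"
  by (rule dgen_chain[OF assms]) (auto intro!: derivative_eq_intros)

lemma total_deriv_coefficient:
  "total_deriv \<mu> (coefficient X i) z = dgen X (fields z) (\<lambda>f. z (Dep f (unit_index \<mu>))) $ i"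
proof -
  let ?S = "(\<lambda>f. Dep f 0) ` UNIV"
  have dep: "depends_on (coefficient X i) ?S"
  proof -
    have "fields z = fields z'" if "\<forall>c\<in>?S. z c = z' c" for z z'
      using that by (auto simp: fields_def)
    then show ?thesis unfolding depends_on_def coefficient_def fields_def[symmetric] by metis
  qed
  have "pd (Dep f 0) (coefficient X i) z = pd f (\<lambda>y. X y $ i) (fields z)" for f
  proof -
    have "fields (z(Dep f 0 := t)) = (fields z)(f := t)" for t
      by (auto simp: fields_def)
    then show ?thesis
      by (simp add: pd_def coefficient_def flip: fields_def) (simp add: fields_def)
  qed
  moreover have "inj (\<lambda>f. Dep f 0)" by (simp add: inj_def)
  ultimately show ?thesis
    unfolding total_deriv_eq_sum[OF finite_imageI[OF finite_dep_var] dep]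
    by (simp add: sum.reindex dgen_def shift_def)
qed

lemma scalars_prol_dir:
  "scalars (prol_dir X z) 0 = X (fields z)"
  "scalars (prol_dir X z) (unit_index \<mu>) = dgen X (fields z) (\<lambda>f. z (Dep f (unit_index \<mu>)))"
  by (simp_all add: vec_eq_iff prol_dir_def total_deriv_coefficient coefficient_def fields_def)

subsection \<open>Linear generators\<close>

lemma polyfun_linear_ph: "linear S \<Longrightarrow> polyfun (\<lambda>y. (S (ph y) :: real^8) $ i)"
  by (subst linear_nth_eq_sum, assumption, subst ph_nth, intro polyfun_intros)

lemma scalar_generator_linear: "linear S \<Longrightarrow> scalar_generator (\<lambda>y. S (ph y))"
  unfolding scalar_generator_def by (blast intro: polyfun_smooth polyfun_linear_ph)

lemma dgen_linear:
  assumes "linear S"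
  shows "dgen (\<lambda>y. S (ph y)) y w = S (ph w)"
proof -
  have "dgen (\<lambda>y. S (ph y)) y w $ i = S (ph w) $ i" for i
  proof (rule DERIV_unique)
    show "((\<lambda>t. S (ph (\<lambda>f. y f + t * w f)) $ i) has_real_derivative dgen (\<lambda>y. S (ph y)) y w $ i) (at 0)"
      using dgen_line[OF scalar_generator_linear[OF assms], of y w i 0] by simp
    show "((\<lambda>t. S (ph (\<lambda>f. y f + t * w f)) $ i) has_real_derivative S (ph w) $ i) (at 0)"
      unfolding ph_line by (auto simp: linear_add[OF assms] linear_cmul[OF assms] intro!: derivative_eq_intros)
  qed
  then show ?thesis by (simp add: vec_eq_iff)
qed

lemma total_deriv_linear:
  assumes "linear S"
  shows "total_deriv \<mu> (\<lambda>z. (S (scalars z J) :: real^8) $ i) = (\<lambda>z. S (scalars z (J + unit_index \<mu>)) $ i)"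
proof (rule ext, rule total_deriv_eqI)
  fix z
  show "((\<lambda>t. S (scalars (\<lambda>c. z c + t * shift \<mu> z c) J) $ i) has_real_derivative
      S (scalars z (J + unit_index \<mu>)) $ i) (at 0)"
    unfolding scalars_line
    by (auto simp: linear_add[OF assms] linear_cmul[OF assms] vec_eq_iff intro!: derivative_eq_intros
        arg_cong[where f = "\<lambda>v. S v $ i"])
qed (intro polyfun_local polyfun_intros assms)

lemma total_deriv_funpow_linear:
  assumes "linear S"
  shows "(total_deriv \<mu> ^^ n) (\<lambda>z. (S (scalars z J) :: real^8) $ i) =
    (\<lambda>z. S (scalars z (\<lambda>\<nu>. J \<nu> + n * unit_index \<mu> \<nu>)) $ i)"
proof (induction n)
  case (Suc n)
  have "(\<lambda>\<nu>. J \<nu> + n * unit_index \<mu> \<nu>) + unit_index \<mu> = (\<lambda>\<nu>. J \<nu> + Suc n * unit_index \<mu> \<nu>)"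
    by (auto simp: fun_eq_iff)
  then show ?case by (simp add: Suc total_deriv_linear[OF assms] del: mult_Suc)
qed simp

text \<open>A linear generator commutes with total derivatives, so its prolongation acts by
  \<open>S\<close> at every order; the scalar equations require this at order two.\<close>

lemma scalars_prol_dir_linear:
  assumes "linear S"
  shows "scalars (prol_dir (\<lambda>y. S (ph y)) z) J = S (scalars z J)"
proof -
  have c: "coefficient (\<lambda>y. S (ph y)) i = (\<lambda>z. S (scalars z 0) $ i)" for i
    by (simp add: coefficient_def fun_eq_iff fields_def[symmetric])
  have J: "(\<lambda>\<nu>. ((((0::multi_index) \<nu> + J 3 * unit_index 3 \<nu>) + J 2 * unit_index 2 \<nu>) + J 1 * unit_index 1 \<nu>)
     + J 0 * unit_index 0 \<nu>) = J"
  proof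
    fix \<nu> :: 4
    show "0 \<nu> + J 3 * unit_index 3 \<nu> + J 2 * unit_index 2 \<nu> + J 1 * unit_index 1 \<nu> + J 0 * unit_index 0 \<nu> = J \<nu>"
      using exhaust_4[of \<nu>] by (auto simp: unit_index_def)
  qed
  have "total_deriv_multi J (coefficient (\<lambda>y. S (ph y)) i) z = S (scalars z J) $ i" for i
    unfolding c total_deriv_multi_def o_def total_deriv_funpow_linear[OF assms] J ..
  then show ?thesis by (simp add: vec_eq_iff prol_dir_def)
qed

section \<open>Flavour rotations and the commutant of the gauge group\<close>

text \<open>Stated for every complex matrix: \<open>higgs_rotate\<close> serves both for unitary
  changes of basis and for anti-Hermitian generators.\<close>

lemma higgs_eq:
  "higgs_rotate M v = vector
    [Re (M$1$1) * v$1 - Im (M$1$1) * v$2 + (Re (M$1$2) * v$5 - Im (M$1$2) * v$6),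
     Re (M$1$1) * v$2 + Im (M$1$1) * v$1 + (Re (M$1$2) * v$6 + Im (M$1$2) * v$5),
     Re (M$1$1) * v$3 - Im (M$1$1) * v$4 + (Re (M$1$2) * v$7 - Im (M$1$2) * v$8),
     Re (M$1$1) * v$4 + Im (M$1$1) * v$3 + (Re (M$1$2) * v$8 + Im (M$1$2) * v$7),
     Re (M$2$1) * v$1 - Im (M$2$1) * v$2 + (Re (M$2$2) * v$5 - Im (M$2$2) * v$6),
     Re (M$2$1) * v$2 + Im (M$2$1) * v$1 + (Re (M$2$2) * v$6 + Im (M$2$2) * v$5),
     Re (M$2$1) * v$3 - Im (M$2$1) * v$4 + (Re (M$2$2) * v$7 - Im (M$2$2) * v$8),
     Re (M$2$1) * v$4 + Im (M$2$1) * v$3 + (Re (M$2$2) * v$8 + Im (M$2$2) * v$7)]"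
  by (simp add: higgs_rotate_def real_components_def vec_eq_iff forall_8 sum_2 doublet_simps
      distrib_left right_diff_distrib)

lemma linear_higgs: "linear (higgs_rotate M)"
  by (rule linearI) (simp_all add: higgs_eq vec_eq_iff forall_8 algebra_simps)

lemma higgs_rotate_Jm: "higgs_rotate M (Jm v) = Jm (higgs_rotate M v)"
  by (simp add: higgs_eq vec_eq_iff forall_8 Jm_def algebra_simps)

lemma higgs_rotate_tau: "higgs_rotate M (tau a v) = tau a (higgs_rotate M v)"
  by (simp add: higgs_eq vec_eq_iff forall_8 tau_def field_simps)

lemma antihermitian_entries:
  assumes "dagger M = - M"
  shows "Re (M$1$1) = 0" "Re (M$2$2) = 0" "Re (M$2$1) = - Re (M$1$2)" "Im (M$2$1) = Im (M$1$2)"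
proof -
  have "cnj (M$j$i) = - M$i$j" for i j
    using arg_cong[OF assms, of "\<lambda>A. A$i$j"] by (simp add: dagger_def)
  from this[of 1 1] this[of 2 2] this[of 1 2]
  show "Re (M$1$1) = 0" "Re (M$2$2) = 0" "Re (M$2$1) = - Re (M$1$2)" "Im (M$2$1) = Im (M$1$2)"
    by (simp_all add: complex_eq_iff)
qed

lemma higgs_rotate_skew: "dagger M = - M \<Longrightarrow> higgs_rotate M v \<bullet> w = - (v \<bullet> higgs_rotate M w)"
  by (simp add: higgs_eq inner_8 antihermitian_entries algebra_simps)

lemma linear_eqI_axes:
  fixes f h :: "real^8 \<Rightarrow> real^8"
  assumes "linear f" "linear h" "\<And>j. f (axis j 1) = h (axis j 1)"
  shows "f = h"
proof
  fix v
  have "f v $ i = h v $ i" for i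
    using assms linear_nth_eq_sum[of f v i] linear_nth_eq_sum[of h v i] by simp
  then show "f v = h v" by (simp add: vec_eq_iff)
qed

text \<open>The gauge generators carry \<open>e 1\<close> and \<open>e 5\<close> to all basis
  vectors, so \<open>S\<close> is determined by \<open>x\<close> and \<open>z\<close>. The third
  isospin generator confines these to the upper components, and skewness leaves the four real
  parameters of an anti-Hermitian matrix.\<close>

lemma gauge_commutant:
  assumes S: "linear S" and skew: "\<And>v w. S v \<bullet> w = - (v \<bullet> S w)"
    and J: "\<And>v. S (Jm v) = Jm (S v)" and tau: "\<And>a v. S (tau a v) = tau a (S v)"
  shows "\<exists>M. dagger M = - M \<and> S = higgs_rotate M"
proof -
  define e :: "8 \<Rightarrow> real^8" where "e = (\<lambda>i. axis i 1)"
  have ax: "axis i 1 $ j = (if i = j then 1 else 0 :: real)" for i j :: 8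
    by (auto simp: axis_def)
  define x z where "x = S (e 1)" and "z = S (e 5)"
  have e2: "e 2 = Jm (e 1)" and e6: "e 6 = Jm (e 5)"
    and e3: "e 3 = (- 2) *\<^sub>R tau 2 (e 1)" and e7: "e 7 = (- 2) *\<^sub>R tau 2 (e 5)"
    by (simp_all add: e_def vec_eq_iff forall_8 Jm_def tau_def ax)
  have e4: "e 4 = Jm (e 3)" and e8: "e 8 = Jm (e 7)"
    by (simp_all add: e_def vec_eq_iff forall_8 Jm_def ax)
  have Se: "S (e 1) = x" "S (e 5) = z" "S (e 2) = Jm x" "S (e 6) = Jm z"
    by (simp_all only: x_def z_def e2 e6 J)
  have Se3: "S (e 3) = (- 2) *\<^sub>R tau 2 x" "S (e 7) = (- 2) *\<^sub>R tau 2 z"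
    by (simp_all only: e3 e7 x_def z_def linear_cmul[OF S] tau)
  have Se4: "S (e 4) = Jm ((- 2) *\<^sub>R tau 2 x)" "S (e 8) = Jm ((- 2) *\<^sub>R tau 2 z)"
    by (simp_all only: e4 e8 J Se3)
  \<comment> \<open>The upper components are where twice \<open>tau 3\<close> coincides with
    \<open>Jm\<close>; commuting with both, \<open>S\<close> preserves them.\<close>
  have "2 *\<^sub>R tau 3 (e 1) = Jm (e 1)" "2 *\<^sub>R tau 3 (e 5) = Jm (e 5)"
    by (simp_all add: e_def vec_eq_iff forall_8 Jm_def tau_def ax)
  then have "2 *\<^sub>R tau 3 x = Jm x" "2 *\<^sub>R tau 3 z = Jm z"
    unfolding x_def z_def by (metis J tau linear_cmul[OF S])+
  then have x0: "x$3 = 0" "x$4 = 0" "x$7 = 0" "x$8 = 0" and z0: "z$3 = 0" "z$4 = 0" "z$7 = 0" "z$8 = 0"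
    by (simp_all add: vec_eq_iff forall_8 Jm_def tau_def)
  have in_e: "v \<bullet> e i = v $ i" "e i \<bullet> v = v $ i" for v i by (simp_all add: e_def inner_axis inner_axis')
  have d: "x$1 = 0" "z$5 = 0" "z$1 = - x$5"
    using skew[of "e 1" "e 1"] skew[of "e 5" "e 5"] skew[of "e 5" "e 1"] by (simp_all add: in_e Se)
  have z2: "z$2 = x$6"
    using skew[of "e 5" "e 2"] by (simp add: in_e Se Jm_def)
  define M :: "complex^2^2" where
    "M = vector [vector [Complex 0 (x$2), Complex (- x$5) (x$6)], vector [Complex (x$5) (x$6), Complex 0 (z$6)]]"
  have M: "M$1$1 = Complex 0 (x$2)" "M$1$2 = Complex (- x$5) (x$6)" "M$2$1 = Complex (x$5) (x$6)" "M$2$2 = Complex 0 (z$6)"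
    by (simp_all add: M_def)
  have "dagger M = - M"
    by (simp add: dagger_def vec_eq_iff forall_2 M complex_eq_iff)
  moreover have "S = higgs_rotate M"
  proof (rule linear_eqI_axes[OF S linear_higgs])
    fix j :: 8
    have "S (e j) = higgs_rotate M (e j)"
      using exhaust_8[of j]
      by (elim disjE) (simp_all add: Se Se3 Se4, simp_all add: vec_eq_iff forall_8 higgs_eq M e_def ax x0 z0 d z2 Jm_def tau_def)
    then show "S (axis j 1) = higgs_rotate M (axis j 1)" by (simp add: e_def)
  qed
  ultimately show ?thesis by blast
qed

text \<open>With \<open>\<sigma>\<^sub>a = -2J\<tau>\<^sub>a\<close>, the first hypothesis turns into \<open>S\<sigma>\<^sub>a = \<sigma>\<^sub>aS\<close>, and \<open>J = \<sigma>\<^sub>1\<sigma>\<^sub>2\<sigma>\<^sub>3\<close>.\<close>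

lemma gauge_adjoint_imp_commute:
  assumes S: "linear S"
    and J: "\<And>u v. S u \<bullet> Jm v + u \<bullet> Jm (S v) = 0"
    and tau: "\<And>a u v. S u \<bullet> tau a v + u \<bullet> tau a (S v) = 0"
  shows "S (Jm v) = Jm (S v)" "S (tau a v) = tau a (S v)" "S v \<bullet> w = - (v \<bullet> S w)"
proof -
  define \<sigma> where "\<sigma> = (\<lambda>a v. (- 2) *\<^sub>R Jm (tau a v))"
  have J\<sigma>: "Jm (\<sigma> a v) = 2 *\<^sub>R tau a v" for a v
    by (simp add: \<sigma>_def linear_cmul[OF linear_Jm] linear_neg[OF linear_Jm])
  have J': "S u \<bullet> Jm v = Jm u \<bullet> S v" for u v
    using J[of u v] by (simp add: Jm_skew)
  have sym: "\<sigma> a u \<bullet> v = u \<bullet> \<sigma> a v" and \<sigma>J: "\<sigma> a (Jm v) = Jm (\<sigma> a v)" for a u v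
    by (simp_all add: \<sigma>_def Jm_def tau_def inner_8 vec_eq_iff forall_8)
  have J\<sigma>': "Jm (\<sigma> a u) \<bullet> v = - (u \<bullet> Jm (\<sigma> a v))" for a u v
    by (metis Jm_skew \<sigma>J sym)
  have S\<sigma>: "S (\<sigma> a u) = \<sigma> a (S u)" for a u
  proof -
    have "S (\<sigma> a u) \<bullet> Jm v = \<sigma> a (S u) \<bullet> Jm v" for v
    proof -
      have "S (\<sigma> a u) \<bullet> Jm v = Jm (\<sigma> a u) \<bullet> S v" by (rule J')
      also have "\<dots> = - (u \<bullet> Jm (\<sigma> a (S v)))" by (rule J\<sigma>')
      also have "\<dots> = S u \<bullet> Jm (\<sigma> a v)"
        using tau[of u a v] by (simp add: J\<sigma>)
      also have "\<dots> = \<sigma> a (S u) \<bullet> Jm v"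
        by (metis \<sigma>J sym)
      finally show ?thesis .
    qed
    then have "(S (\<sigma> a u) - \<sigma> a (S u)) \<bullet> Jm v = 0" for v by (simp add: inner_diff_left)
    from this[of "- Jm (S (\<sigma> a u) - \<sigma> a (S u))"]
    have "(S (\<sigma> a u) - \<sigma> a (S u)) \<bullet> (S (\<sigma> a u) - \<sigma> a (S u)) = 0"
      by (simp add: linear_neg[OF linear_Jm])
    then show ?thesis by simp
  qed
  have "Jm v = \<sigma> 1 (\<sigma> 2 (\<sigma> 3 v))" for v
    by (simp add: \<sigma>_def Jm_def tau_def vec_eq_iff forall_8)
  then have SJ: "S (Jm v) = Jm (S v)" for v by (simp add: S\<sigma>)
  then show "S (Jm v) = Jm (S v)" .
  have "tau a v = (1/2) *\<^sub>R Jm (\<sigma> a v)" for v by (simp add: J\<sigma>)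
  then show "S (tau a v) = tau a (S v)" by (simp add: linear_cmul[OF S] SJ S\<sigma>)
  have "S v \<bullet> Jm w' = - (v \<bullet> S (Jm w'))" for w'
    by (simp add: J' Jm_skew SJ)
  from this[of "- Jm w"] show "S v \<bullet> w = - (v \<bullet> S w)"
    by (simp add: linear_neg[OF linear_Jm])
qed

section \<open>Symmetries of the Euler-Lagrange equations\<close>

definition invariant_flow :: "potential_params \<Rightarrow> complex^2^2 \<Rightarrow> bool"
  where "invariant_flow P M \<longleftrightarrow> dagger M = - M \<and> (\<forall>v. dvpot P v (higgs_rotate M v) = 0)"

definition flavour_symmetries :: "potential_params \<Rightarrow> generator set"
  where "flavour_symmetries P = {\<lambda>y. higgs_rotate M (ph y) | M. invariant_flow P M}"

lemma ddvpot_sym: "ddvpot P v u w = ddvpot P v w u"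
proof -
  have "bil v w \<bullet> (quartic_mat P *v bil v u) = bil v u \<bullet> (quartic_mat P *v bil v w)"
    by (metis quartic_mat_sym inner_commute)
  then show ?thesis by (simp add: ddvpot_def bil_sym[of u w])
qed

lemma linear_dvpot: "linear (dvpot P v)"
  by (rule linearI) (simp_all add: dvpot_def bil_linear inner_simps algebra_simps)

lemma linear_ddvpot: "linear (ddvpot P v u)"
  by (rule linearI) (simp_all add: ddvpot_def bil_linear inner_simps algebra_simps)

text \<open>Differentiates the invariance identity once more, in the direction \<open>w\<close>;
  symmetry of the second derivative then moves \<open>S v\<close> to the other slot.\<close>

lemma invariance_derivative:
  assumes S: "linear S" and inv: "\<And>v. dvpot P v (S v) = 0"
  shows "ddvpot P v (S v) w = - dvpot P v (S w)"
proof -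
  have eq: "dvpot P (v + t *\<^sub>R w) (S (v + t *\<^sub>R w)) = dvpot P (v + t *\<^sub>R w) (S v) + t * dvpot P (v + t *\<^sub>R w) (S w)" for t
    by (simp add: linear_add[OF S] linear_cmul[OF S] linear_add[OF linear_dvpot] linear_cmul[OF linear_dvpot])
  have "((\<lambda>t. dvpot P (v + t *\<^sub>R w) (S (v + t *\<^sub>R w))) has_real_derivative
      ddvpot P v w (S v) + dvpot P v (S w)) (at 0)"
    unfolding eq
    using DERIV_add[OF dvpot_line DERIV_mult[OF DERIV_ident dvpot_line], of P v w "S v" P v w "S w"]
    by simp
  then have "((\<lambda>t. 0) has_real_derivative ddvpot P v w (S v) + dvpot P v (S w)) (at 0)"
    by (simp add: inv)
  then have "ddvpot P v w (S v) + dvpot P v (S w) = 0"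
    using DERIV_unique DERIV_const by blast
  then show ?thesis by (simp add: ddvpot_sym)
qed

lemma unit_index_sum_neq:
  "unit_index \<mu> + unit_index \<nu> \<noteq> 0" "unit_index \<mu> + unit_index \<nu> \<noteq> unit_index \<kappa>"
proof -
  show "unit_index \<mu> + unit_index \<nu> \<noteq> 0"
    by (metis add_is_0 plus_fun_apply unit_index_def zero_fun_apply zero_neq_one)
  show "unit_index \<mu> + unit_index \<nu> \<noteq> unit_index \<kappa>"
  proof
    assume eq: "unit_index \<mu> + unit_index \<nu> = unit_index \<kappa>"
    have "unit_index \<mu> \<mu> + unit_index \<nu> \<mu> = unit_index \<kappa> \<mu>" "unit_index \<mu> \<nu> + unit_index \<nu> \<nu> = unit_index \<kappa> \<nu>"
      using fun_cong[OF eq, of \<mu>] fun_cong[OF eq, of \<nu>] by simp_all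
    then show False by (auto simp: unit_index_def split: if_splits)
  qed
qed

lemma unit_index_double: "unit_index \<mu> + unit_index \<nu> = unit_index \<kappa> + unit_index \<kappa> \<longleftrightarrow> \<mu> = \<kappa> \<and> \<nu> = \<kappa>"
proof
  assume eq: "unit_index \<mu> + unit_index \<nu> = unit_index \<kappa> + unit_index \<kappa>"
  have "unit_index \<mu> \<kappa> + unit_index \<nu> \<kappa> = unit_index \<kappa> \<kappa> + unit_index \<kappa> \<kappa>"
    using fun_cong[OF eq, of \<kappa>] by simp
  then show "\<mu> = \<kappa> \<and> \<nu> = \<kappa>" by (auto simp: unit_index_def split: if_splits)
qed simp

section \<open>Solving the field equations over a 1-jet\<close>

definition same_1jet :: "jet \<Rightarrow> jet \<Rightarrow> bool"
  where "same_1jet z z' \<longleftrightarrow> (\<forall>f. z (Dep f 0) = z' (Dep f 0) \<and>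
    (\<forall>\<mu>. z (Dep f (unit_index \<mu>)) = z' (Dep f (unit_index \<mu>))))"

context couplings begin

lemma higgs_rotate_Tg: "higgs_rotate M (Tg m v) = Tg m (higgs_rotate M v)"
  by (cases m) (simp_all add: Tg_def linear_cmul[OF linear_higgs] higgs_rotate_Jm higgs_rotate_tau)

lemma same_1jetD:
  assumes "same_1jet z z'"
  shows "scalars z 0 = scalars z' 0" "scalars z (unit_index \<mu>) = scalars z' (unit_index \<mu>)"
    "Acov \<mu> z = Acov \<mu> z'" "Kcov \<mu> z = Kcov \<mu> z'" "gauge_agree z z'"
    "Acov \<mu> (shift \<nu> z) = Acov \<mu> (shift \<nu> z')" "fields z = fields z'"
proof -
  note J = assms[unfolded same_1jet_def, rule_format]
  show s: "scalars z 0 = scalars z' 0" "scalars z (unit_index \<mu>) = scalars z' (unit_index \<mu>)"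
    using J by (simp_all add: vec_eq_iff)
  show A: "Acov \<mu> z = Acov \<mu> z'" "Acov \<mu> (shift \<nu> z) = Acov \<mu> (shift \<nu> z')"
    using J by (simp_all add: fun_eq_iff Acov_def)
  show "Kcov \<mu> z = Kcov \<mu> z'"
    by (simp add: Kcov_Acov s A)
  show "gauge_agree z z'" "fields z = fields z'"
    using J by (simp_all add: gauge_agree_def fields_def)
qed

text \<open>Each Euler expression contains a second derivative of its own field that occurs in no other one,
  so the equations can be solved over an arbitrary 1-jet.\<close>

definition pivot :: "dep_var \<Rightarrow> 4"
  where "pivot f = (case f of Phi k \<Rightarrow> 0 | BF \<nu> \<Rightarrow> (if \<nu> = 0 then 1 else 0) | WF a \<nu> \<Rightarrow> (if \<nu> = 0 then 1 else 0))"

lemma pivot_simps: "pivot (Phi k) = 0" "pivot (gfield \<nu> m) = (if \<nu> = 0 then 1 else 0)"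
  by (auto simp: pivot_def gfield_def split: option.splits)

definition with_pivots :: "jet \<Rightarrow> (dep_var \<Rightarrow> real) \<Rightarrow> jet"
  where "with_pivots z r c = (case c of Indep \<mu> \<Rightarrow> z c | Dep f J \<Rightarrow>
    if J = unit_index (pivot f) + unit_index (pivot f) then r f
    else if J = 0 \<or> (\<exists>\<mu>. J = unit_index \<mu>) then z c else 0)"

lemma same_1jet_with_pivots: "same_1jet (with_pivots z r) z"
  by (simp add: same_1jet_def with_pivots_def unit_index_sum_neq[symmetric])

lemma with_pivots_second:
  "with_pivots z r (Dep f (unit_index \<mu> + unit_index \<nu>)) = (if \<mu> = pivot f \<and> \<nu> = pivot f then r f else 0)"
  by (auto simp: with_pivots_def unit_index_double unit_index_sum_neq)

text \<open>In a gauge equation the terms with \<open>\<mu>\<close> equal to \<open>\<nu>\<close>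
  cancel, so the pivot direction has to differ from \<open>\<nu>\<close>. Exactly one of the two is
  timelike, which gives the same coefficient -1 as in the scalar equations.\<close>

lemma euler_with_pivots: "euler (Lag P) f (with_pivots z r) = euler (Lag P) f (with_pivots z 0) - r f"
proof -
  let ?z = "with_pivots z r" and ?zz = "with_pivots z 0"
  have J: "same_1jet ?z ?zz"
    using same_1jet_with_pivots[of z r] same_1jet_with_pivots[of z 0] by (simp add: same_1jet_def)
  show ?thesis
  proof (cases f rule: dep_var_cases)
    case (scalar i)
    have "dKcov \<mu> ?z (shift \<mu> ?z) $ i = dKcov \<mu> ?zz (shift \<mu> ?zz) $ i + (if \<mu> = 0 then r f else 0)" for \<mu>
      by (simp add: dKcov_def same_1jetD[OF J] with_pivots_second pivot_simps scalar)
    then have "box_scalar ?z $ i = (\<Sum>\<mu>\<in>UNIV. minkowski \<mu> * (Acov \<mu> ?zz (Kcov \<mu> ?zz) $ i + dKcov \<mu> ?zz (shift \<mu> ?zz) $ i)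
        + (if \<mu> = 0 then minkowski \<mu> * r f else 0))"
      unfolding box_scalar_def by (auto simp: same_1jetD[OF J] algebra_simps intro!: sum.cong)
    also have "\<dots> = box_scalar ?zz $ i + r f"
      by (simp add: sum.distrib box_scalar_def minkowski_def sum.delta)
    finally show ?thesis
      unfolding scalar euler_scalar same_1jetD(1)[OF J] by simp
  next
    case (gauge \<nu> m)
    have "(\<Sum>\<mu>\<in>UNIV. minkowski \<mu> * minkowski \<nu> * (with_pivots z s (Dep (gfield \<nu> m) (unit_index \<mu> + unit_index \<mu>))
        - with_pivots z s (Dep (gfield \<mu> m) (unit_index \<nu> + unit_index \<mu>))))
      = (\<Sum>\<mu>\<in>UNIV. if \<mu> = pivot f then minkowski \<mu> * minkowski \<nu> * s f else 0)" for s
      by (rule sum.cong) (auto simp: with_pivots_second gauge pivot_simps)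
    moreover have "minkowski (pivot f) * minkowski \<nu> = - 1"
      by (simp add: gauge pivot_simps minkowski_def)
    ultimately show ?thesis
      unfolding gauge euler_gauge gauge_lower_cong[OF same_1jetD(5)[OF J]] same_1jetD(1)[OF J] same_1jetD(4)[OF J]
      by (simp add: sum.delta gauge)
  qed
qed

lemma solve_euler: "\<exists>z'. same_1jet z' z \<and> (\<forall>f. euler (Lag P) f z' = 0)"
proof -
  define r where "r = (\<lambda>f. euler (Lag P) f (with_pivots z 0))"
  have "euler (Lag P) f (with_pivots z r) = 0" for f
    using euler_with_pivots[of P f z r] by (simp add: r_def)
  then show ?thesis using same_1jet_with_pivots by blast
qed

lemma dgen_0 [simp]: "dgen X y (\<lambda>f. 0) = 0"
  by (simp add: dgen_def vec_eq_iff)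

text \<open>Above every 1-jet lies a point where the field equations hold, and the prolonged gauge
  equation sees the 1-jet only. Hence it holds for all fields \<open>y\<close> and all slopes
  \<open>w\<close>.\<close>

lemma el_symmetry_gauge_condition:
  assumes "el_symmetry (Lag P) X"
  shows "dgen X y w \<bullet> Tg m (ph y) + ph w \<bullet> Tg m (X y) = 0"
proof -
  define A where "A = (\<lambda>v. \<Sum>m\<in>UNIV. y (gfield 0 m) *\<^sub>R Tg m v)"
  have *: "(dgen X y w + A (X y)) \<bullet> Tg m (ph y) + (ph w + A (ph y)) \<bullet> Tg m (X y) = 0" for w
  proof -
    define z :: jet where "z = (\<lambda>c. case c of Indep \<mu> \<Rightarrow> 0 | Dep f J \<Rightarrow> if J = 0 then y f else w f)"
    obtain z' where z': "same_1jet z' z" "\<And>f. euler (Lag P) f z' = 0"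
      using solve_euler by blast
    then have "prolong X (euler (Lag P) (gfield 0 m)) z' = 0"
      using assms by (simp add: el_symmetry_def)
    moreover have "fields z' = y"
      using same_1jetD(7)[OF z'(1)] by (simp add: z_def fields_def)
    moreover have "z' (Dep f (unit_index 0)) = w f" for f
      using z'(1) by (simp add: same_1jet_def z_def)
    moreover have "scalars z' 0 = ph y" "scalars z' (unit_index 0) = ph w"
      using same_1jetD(1,2)[OF z'(1)] by (simp_all add: z_def vec_eq_iff)
    moreover have "Acov 0 z' = A"
      using same_1jetD(3)[OF z'(1)] by (simp add: Acov_def A_def z_def fun_eq_iff)
    ultimately show ?thesis
      by (simp add: prolong_euler_gauge scalars_prol_dir Kcov_Acov minkowski_def)
  qed
  have "ph (\<lambda>f. 0) = 0" by (simp add: vec_eq_iff)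
  \<comment> \<open>The instance with zero slopes consists of the terms containing gauge fields;
    subtracting it leaves the part linear in \<open>w\<close>.\<close>
  then show ?thesis using *[of w] *[of "\<lambda>f. 0"] by (simp add: inner_add_left)
qed

text \<open>The function \<open>X y \<bullet> Jm (ph y)\<close> is homogeneous of degree 2 and its gradient determines \<open>X\<close>,
  so \<open>X\<close> is homogeneous of degree 1, hence equal to its own derivative at the origin.\<close>

lemma gauge_condition_imp_linear:
  assumes X: "scalar_generator X"
    and cond: "\<And>y w. dgen X y w \<bullet> Jm (ph y) + ph w \<bullet> Jm (X y) = 0"
  shows "\<exists>S. linear S \<and> X = (\<lambda>y. S (ph y))"
proof -
  define F where "F = (\<lambda>y. X y \<bullet> Jm (ph y))"
  \<comment> \<open>By the hypothesis and skewness of \<open>Jm\<close>, the two terms of the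
    product rule agree; hence the factor 2.\<close>
  have dF: "((\<lambda>t. F (\<lambda>f. y f + t * w f)) has_real_derivative 2 * (X (\<lambda>f. y f + t * w f) \<bullet> Jm (ph w))) (at t)" for y w t
  proof -
    define yt where "yt = (\<lambda>f. y f + t * w f)"
    have "((\<lambda>t. F (\<lambda>f. y f + t * w f)) has_real_derivative dgen X yt w \<bullet> Jm (ph yt) + X yt \<bullet> Jm (ph w)) (at t)"
      unfolding F_def inner_8 ph_line linear_add[OF linear_Jm] linear_cmul[OF linear_Jm] yt_def
      by (auto intro!: derivative_eq_intros dgen_line[OF X] simp: algebra_simps)
    moreover have "dgen X yt w \<bullet> Jm (ph yt) = X yt \<bullet> Jm (ph w)"
      using cond[of yt w] Jm_skew[of "X yt" "ph w"] by (simp add: inner_commute)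
    ultimately show ?thesis by (simp add: yt_def)
  qed
  have Jm_cancel: "u = v" if "\<And>w. u \<bullet> Jm w = v \<bullet> Jm w" for u v
    using that[of "- Jm (u - v)"] by (simp add: linear_neg[OF linear_Jm] flip: inner_diff_left)
      (metis Jm_Jm eq_iff_diff_eq_0 inner_diff_left inner_eq_zero_iff minus_minus linear_neg[OF linear_Jm])
  \<comment> \<open>Along directions that move only gauge fields \<open>ph w\<close> vanishes, so
    \<open>F\<close> is constant there.\<close>
  have F_ph: "F y = F y'" if "ph y = ph y'" for y y'
  proof -
    define w where "w = (\<lambda>f. y' f - y f)"
    have "ph w = 0" using that by (simp add: w_def vec_eq_iff)
    then have "((\<lambda>t. F (\<lambda>f. y f + t * w f)) has_real_derivative 0) (at t)" for t
      using dF[of y w t] by (simp add: linear_0[OF linear_Jm])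
    then have "F (\<lambda>f. y f + 0 * w f) = F (\<lambda>f. y f + 1 * w f)"
      by (intro DERIV_isconst_all) blast
    then show ?thesis by (simp add: w_def)
  qed
  define e where "e = (\<lambda>v. X (emb v))"
  \<comment> \<open>\<open>X y\<close> is recovered from the derivative of \<open>F\<close>, and
    \<open>F\<close> depends on \<open>y\<close> through \<open>ph y\<close> alone.\<close>
  have X_e: "X y = e (ph y)" for y
  proof (rule Jm_cancel)
    fix u
    have eq: "F (\<lambda>f. y f + t * emb u f) = F (\<lambda>f. emb (ph y) f + t * emb u f)" for t
      by (rule F_ph) (simp add: ph_line)
    have "2 * (X y \<bullet> Jm u) = 2 * (X (emb (ph y)) \<bullet> Jm u)"
      using DERIV_unique[OF dF[of y "emb u" 0, unfolded eq] dF[of "emb (ph y)" "emb u" 0]] by simp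
    then show "X y \<bullet> Jm u = e (ph y) \<bullet> Jm u" by (simp add: e_def)
  qed
  define G where "G = (\<lambda>v. F (emb v))"
  have dG: "((\<lambda>t. G (v + t *\<^sub>R u)) has_real_derivative 2 * (e (v + t *\<^sub>R u) \<bullet> Jm u)) (at t)" for v u t
    using dF[of "emb v" "emb u" t] by (simp add: G_def e_def emb_line)
  \<comment> \<open>Euler's relation: \<open>G v\<close> equals \<open>e v \<bullet> Jm v\<close>,
    half of its own radial derivative. So \<open>G (t *\<^sub>R v)\<close> divided by the square of
    \<open>t\<close> is constant for positive \<open>t\<close>.\<close>
  have homG: "G (t *\<^sub>R v) = t\<^sup>2 * G v" if "t > 0" for t v
  proof -
    have emb0: "(\<lambda>f. emb 0 f + t * emb v f) = emb (t *\<^sub>R v)" for t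
      by (auto simp: emb_def split: dep_var.splits)
    have "((\<lambda>t. G (t *\<^sub>R v) / t\<^sup>2) has_real_derivative 0) (at s)" if "s > 0" for s
    proof -
      have "((\<lambda>t. G (t *\<^sub>R v)) has_real_derivative 2 * (e (s *\<^sub>R v) \<bullet> Jm v)) (at s)"
        using dG[of 0 v s] by simp
      moreover have "G (s *\<^sub>R v) = s * (e (s *\<^sub>R v) \<bullet> Jm v)"
        by (simp add: G_def F_def e_def linear_cmul[OF linear_Jm])
      ultimately show ?thesis
        using that by (auto intro!: derivative_eq_intros simp: field_simps power2_eq_square)
    qed
    then have "G (t *\<^sub>R v) / t\<^sup>2 = G (1 *\<^sub>R v) / 1\<^sup>2"
      by (intro DERIV_isconst3[of "min t 1 / 2" "max t 1 + 1"]) (use that in auto)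
    then show ?thesis using that by (simp add: field_simps)
  qed
  have hom: "e (t *\<^sub>R v) = t *\<^sub>R e v" if "t > 0" for t v
  proof (rule Jm_cancel)
    fix u
    have eq: "G (t *\<^sub>R v + s *\<^sub>R u) = t\<^sup>2 * G (v + (s / t) *\<^sub>R u)" for s
      using homG[OF that, of "v + (s / t) *\<^sub>R u"] that by (simp add: scaleR_add_right)
    have "((\<lambda>s. G (v + (s / t) *\<^sub>R u)) has_real_derivative 2 * (e (v + (0 / t) *\<^sub>R u) \<bullet> Jm u) * (1 / t)) (at 0)"
      by (rule DERIV_chain'[where f = "\<lambda>s. s / t", OF _ dG]) (use that in \<open>auto intro!: derivative_eq_intros\<close>)
    then have "((\<lambda>s. t\<^sup>2 * G (v + (s / t) *\<^sub>R u)) has_real_derivative t\<^sup>2 * (2 * (e v \<bullet> Jm u) * (1 / t))) (at 0)"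
      by (intro DERIV_cmult) simp
    moreover have "((\<lambda>s. G (t *\<^sub>R v + s *\<^sub>R u)) has_real_derivative 2 * (e (t *\<^sub>R v) \<bullet> Jm u)) (at 0)"
      using dG[of "t *\<^sub>R v" u 0] by simp
    ultimately have "2 * (e (t *\<^sub>R v) \<bullet> Jm u) = t\<^sup>2 * (2 * (e v \<bullet> Jm u) * (1 / t))"
      unfolding eq by (metis DERIV_unique)
    then show "e (t *\<^sub>R v) \<bullet> Jm u = (t *\<^sub>R e v) \<bullet> Jm u"
      using that by (simp add: power2_eq_square)
  qed
  \<comment> \<open>Homogeneity is available for \<open>t > 0\<close> only; the value at the origin
    comes from the hypothesis at that point.\<close>
  have e0: "e 0 = 0"
  proof (rule Jm_cancel)
    fix u show "e 0 \<bullet> Jm u = 0 \<bullet> Jm u"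
      using cond[of "emb 0" "emb u"] Jm_skew[of "e 0" u] by (simp add: e_def linear_0[OF linear_Jm] inner_commute)
  qed
  \<comment> \<open>The differential at the origin. By homogeneity the right-hand difference
    quotients there are constant, with value \<open>e v\<close>.\<close>
  define S where "S = (\<lambda>v. dgen X (emb 0) (emb v))"
  have "e v = S v" for v
  proof -
    have "e v $ i = S v $ i" for i
    proof -
      have emb0: "(\<lambda>f. emb 0 f + t * emb v f) = emb (t *\<^sub>R v)" for t
      by (auto simp: emb_def split: dep_var.splits)
      have "((\<lambda>t. e (t *\<^sub>R v) $ i) has_real_derivative S v $ i) (at 0)"
        using dgen_line[OF X, of "emb 0" "emb v" i 0] by (simp add: emb0 e_def S_def)
      then have "((\<lambda>t. e (t *\<^sub>R v) $ i / t) \<longlongrightarrow> S v $ i) (at 0)"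
        by (simp add: has_field_derivative_iff e0)
      then have 1: "((\<lambda>t. e (t *\<^sub>R v) $ i / t) \<longlongrightarrow> S v $ i) (at_right 0)"
        by (rule tendsto_mono[rotated]) (simp add: at_within_le_at)
      have "\<forall>\<^sub>F t in at_right 0. e (t *\<^sub>R v) $ i / t = e v $ i"
        by (auto simp: eventually_at_right_field hom intro!: exI[of _ 1])
      then have 2: "((\<lambda>t. e (t *\<^sub>R v) $ i / t) \<longlongrightarrow> e v $ i) (at_right 0)"
        by (simp add: tendsto_eventually)
      show ?thesis
        by (rule tendsto_unique[OF _ 2 1]) simp
    qed
    then show ?thesis by (simp add: vec_eq_iff)
  qed
  moreover have "emb (u + v) f = emb u f + emb v f" "emb (c *\<^sub>R u) f = c * emb u f" for u v c f
    by (auto simp: emb_def split: dep_var.splits)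
  then have "linear S"
    by (intro linearI) (simp_all add: S_def dgen_def vec_eq_iff sum.distrib distrib_right sum_distrib_left mult.assoc)
  ultimately have "linear S \<and> X = (\<lambda>y. S (ph y))" using X_e by auto
  then show ?thesis by blast
qed

section \<open>The scalar equations and invariance of the potential\<close>

lemma commutes_Acov:
  assumes "linear S" "\<And>m v. S (Tg m v) = Tg m (S v)"
  shows "S (Acov \<mu> z v) = Acov \<mu> z (S v)"
  by (simp add: Acov_def linear_sum[OF assms(1)] linear_cmul[OF assms(1)] assms(2))

text \<open>Commuting with \<open>Tg\<close>, the map \<open>S\<close> passes through covariant
  derivatives, so \<open>box_scalar\<close> transforms like the scalars themselves; the potential
  term contributes \<open>ddvpot\<close>.\<close>

lemma prolong_euler_scalar:
  assumes S: "linear S" and comm: "\<And>m v. S (Tg m v) = Tg m (S v)"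
  shows "prolong (\<lambda>y. S (ph y)) (euler (Lag P) (Phi i)) z =
    - S (box_scalar z) $ i - ddvpot P (scalars z 0) (S (scalars z 0)) (axis i 1)"
proof (rule prolong_eqI)
  let ?X = "\<lambda>y. S (ph y)"
  define h where "h = prol_dir ?X z"
  note Slin = linear_add[OF S] linear_cmul[OF S] linear_sum[OF S]
  note comA = commutes_Acov[OF S comm]
  have h: "scalar_dir h" by (simp add: h_def scalar_dir_prol_dir)
  have eq: "euler (Lag P) (Phi i) (\<lambda>c. z c + t * h c) = - (box_scalar z + t *\<^sub>R S (box_scalar z)) $ i
     - dvpot P (scalars z 0 + t *\<^sub>R S (scalars z 0)) (axis i 1)" for t
  proof -
    define z' where "z' = (\<lambda>c. z c + t * h c)"
    have sc: "scalars z' J = scalars z J + t *\<^sub>R S (scalars z J)" for J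
      by (simp add: z'_def scalars_line h_def scalars_prol_dir_linear[OF S])
    have A: "Acov \<mu> z' = Acov \<mu> z" "Acov \<mu> (shift \<nu> z') = Acov \<mu> (shift \<nu> z)" for \<mu> \<nu>
      using h by (simp_all add: fun_eq_iff Acov_def z'_def scalar_dir_def)
    have K: "Kcov \<mu> z' = Kcov \<mu> z + t *\<^sub>R S (Kcov \<mu> z)" for \<mu>
      by (simp add: Kcov_Acov A sc Acov_linear Slin comA algebra_simps)
    have "dKcov \<mu> z' (shift \<mu> z') = dKcov \<mu> z (shift \<mu> z) + t *\<^sub>R S (dKcov \<mu> z (shift \<mu> z))" for \<mu>
      by (simp add: dKcov_def A sc Acov_linear Slin comA algebra_simps)
    then have "box_scalar z' = box_scalar z + t *\<^sub>R S (box_scalar z)"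
      unfolding box_scalar_def
      by (simp add: A K Acov_linear Slin comA algebra_simps sum.distrib scaleR_sum_right)
    then show ?thesis
      unfolding z'_def[symmetric] by (simp add: euler_scalar sc)
  qed
  have "((\<lambda>t. - (box_scalar z + t *\<^sub>R S (box_scalar z)) $ i) has_real_derivative - S (box_scalar z) $ i) (at 0)"
    by (auto intro!: derivative_eq_intros)
  from DERIV_diff[OF this dvpot_line]
  show "((\<lambda>t. euler (Lag P) (Phi i) (\<lambda>c. z c + t * prol_dir ?X z c)) has_real_derivative
    - S (box_scalar z) $ i - ddvpot P (scalars z 0) (S (scalars z 0)) (axis i 1)) (at 0)"
    unfolding h_def[symmetric] eq .
qed (intro polyfun_local polyfun_euler polyfun_lagrangian)

lemma euler_scalar_zero:
  assumes "\<And>f. euler (Lag P) f z = 0"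
  shows "box_scalar z \<bullet> w = - dvpot P (scalars z 0) w"
proof -
  have "box_scalar z $ i = - dvpot P (scalars z 0) (axis i 1)" for i
    using assms[of "Phi i"] by (simp add: euler_scalar)
  then show ?thesis
    by (simp add: inner_vec_def linear_eq_sum_axes[OF linear_dvpot, of P _ w] sum_negf[symmetric] mult.commute)
qed

lemma dvpot_scaleR: "dvpot P (c *\<^sub>R v) (c *\<^sub>R w) =
    c^2 * (2 * (mass_vec P \<bullet> bil v w)) + c^4 * (2 * (bil v w \<bullet> (quartic_mat P *v bil v v)))"
  by (simp add: dvpot_def bil_linear matrix_vector_mult_scaleR power2_eq_square power4_eq_xxxx algebra_simps)

text \<open>The two parts are homogeneous in \<open>v\<close> of degrees 2 and 4, so evaluation at
  \<open>2 *\<^sub>R v\<close> separates them. The weights are left open because the two routes to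
  invariance produce different ones.\<close>

lemma invariant_if_separately:
  assumes "linear S" "a > 0" "b > 0"
    and eq: "\<And>v. a * (mass_vec P \<bullet> bil v (S v)) + b * (bil v (S v) \<bullet> (quartic_mat P *v bil v v)) = 0"
  shows "dvpot P v (S v) = 0"
proof -
  have "a * 4 * (mass_vec P \<bullet> bil v (S v)) + b * 16 * (bil v (S v) \<bullet> (quartic_mat P *v bil v v)) = 0"
    using eq[of "2 *\<^sub>R v"] by (simp add: bil_linear linear_cmul[OF assms(1)] matrix_vector_mult_scaleR algebra_simps)
  with eq[of v] have "b * (bil v (S v) \<bullet> (quartic_mat P *v bil v v)) = 0" "a * (mass_vec P \<bullet> bil v (S v)) = 0"
    by linarith+
  then show ?thesis using assms by (simp add: dvpot_def)
qed

lemma g_EL_subset: "g_EL (Lag P) \<subseteq> flavour_symmetries P"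
proof
  fix X assume "X \<in> g_EL (Lag P)"
  then have X: "scalar_generator X" and el: "el_symmetry (Lag P) X" by (simp_all add: g_EL_def)
  have cond: "dgen X y w \<bullet> Tg m (ph y) + ph w \<bullet> Tg m (X y) = 0" for y w m
    by (rule el_symmetry_gauge_condition[OF el])
  have condJ: "dgen X y w \<bullet> Jm (ph y) + ph w \<bullet> Jm (X y) = 0" for y w
  proof -
    have "(g' * Y) * (dgen X y w \<bullet> Jm (ph y) + ph w \<bullet> Jm (X y)) = 0"
      using cond[of y w None] by (simp add: Tg_def distrib_left)
    then show ?thesis using g' Y by simp
  qed
  have condt: "dgen X y w \<bullet> tau a (ph y) + ph w \<bullet> tau a (X y) = 0" for y w a
  proof -
    have "g * (dgen X y w \<bullet> tau a (ph y) + ph w \<bullet> tau a (X y)) = 0"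
      using cond[of y w "Some a"] by (simp add: Tg_def distrib_left)
    then show ?thesis using g by simp
  qed
  obtain S where S: "linear S" "X = (\<lambda>y. S (ph y))"
    using gauge_condition_imp_linear[OF X condJ] by blast
  have "S u \<bullet> Jm v + u \<bullet> Jm (S v) = 0" "S u \<bullet> tau a v + u \<bullet> tau a (S v) = 0" for u v a
    using condJ[of "emb v" "emb u"] condt[of "emb v" "emb u" a]
    by (simp_all add: S(2) dgen_linear[OF S(1)])
  note comm = gauge_adjoint_imp_commute[OF S(1) this]
  obtain M where M: "dagger M = - M" "S = higgs_rotate M"
    using gauge_commutant[OF S(1) comm(3,1,2)] by blast
  \<comment> \<open>\<open>dvpot\<close> contributes 2 and 2 to the weights of the mass part and the
    quartic part; \<open>ddvpot\<close> along \<open>S v\<close> and \<open>v\<close> contributes 2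
    and 6.\<close>
  have "4 * (mass_vec P \<bullet> bil v (S v)) + 8 * (bil v (S v) \<bullet> (quartic_mat P *v bil v v)) = 0" for v
  proof -
    define z :: jet where "z = (\<lambda>c. case c of Dep (Phi i) J \<Rightarrow> if J = 0 then v $ i else 0 | _ \<Rightarrow> 0)"
    obtain z' where z': "same_1jet z' z" "\<And>f. euler (Lag P) f z' = 0"
      using solve_euler by blast
    have v: "scalars z' 0 = v"
      using same_1jetD(1)[OF z'(1)] by (simp add: z_def vec_eq_iff)
    have "- S (box_scalar z') $ i - ddvpot P v (S v) (axis i 1) = 0" for i
      using el z'(2) prolong_euler_scalar[OF S(1), of P i z'] unfolding M(2) higgs_rotate_Tg
      by (simp add: el_symmetry_def S(2) M(2) v)
    \<comment> \<open>The value of \<open>box_scalar z'\<close> is whatever the field equations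
      demand. Contracted with \<open>v\<close>, it is paired with \<open>S v\<close> by skewness and
      then eliminated by those equations.\<close>
    then have "(\<Sum>i\<in>UNIV. v $ i * (- S (box_scalar z') $ i - ddvpot P v (S v) (axis i 1))) = 0" by simp
    then have "v \<bullet> S (box_scalar z') + ddvpot P v (S v) v = 0"
      by (simp add: inner_vec_def linear_eq_sum_axes[OF linear_ddvpot, of P v "S v" v]
          algebra_simps sum.distrib sum_negf sum_subtractf)
    moreover have "v \<bullet> S (box_scalar z') = dvpot P v (S v)"
      using euler_scalar_zero[OF z'(2), of "S v"] comm(3)[of v "box_scalar z'"]
      by (simp add: v inner_commute)
    moreover have "bil v v \<bullet> (quartic_mat P *v bil v (S v)) = bil v (S v) \<bullet> (quartic_mat P *v bil v v)"
      by (metis quartic_mat_sym inner_commute)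
    ultimately show ?thesis
      by (simp add: dvpot_def ddvpot_def bil_sym[of "S v" v])
  qed
  then have "dvpot P v (S v) = 0" for v
    by (intro invariant_if_separately[OF S(1), of 4 8]) auto
  then show "X \<in> flavour_symmetries P"
    using M S(2) by (auto simp: flavour_symmetries_def invariant_flow_def)
qed

text \<open>The gauge currents are invariant because the rotation is skew and commutes with
  \<open>Tg\<close>. The scalar equation varies into its own rotation, by the differentiated
  invariance of the potential.\<close>

lemma flavour_subset_EL: "flavour_symmetries P \<subseteq> g_EL (Lag P)"
proof
  fix X assume "X \<in> flavour_symmetries P"
  then obtain M where X: "X = (\<lambda>y. higgs_rotate M (ph y))" and M: "dagger M = - M"
    and inv: "\<And>v. dvpot P v (higgs_rotate M v) = 0"
    by (auto simp: flavour_symmetries_def invariant_flow_def)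
  let ?S = "higgs_rotate M"
  note S = linear_higgs[of M]
  note comm = higgs_rotate_Tg
  have "prolong X (euler (Lag P) f) z = 0" if z: "\<And>f. euler (Lag P) f z = 0" for f z
  proof (cases f rule: dep_var_cases)
    case (scalar i)
    have "?S (box_scalar z) $ i = - (box_scalar z \<bullet> ?S (axis i 1))"
      using higgs_rotate_skew[OF M, of "box_scalar z" "axis i 1"] by (simp add: inner_axis)
    also have "\<dots> = dvpot P (scalars z 0) (?S (axis i 1))"
      by (simp add: euler_scalar_zero[OF z])
    finally show ?thesis
      unfolding scalar X prolong_euler_scalar[OF S comm] invariance_derivative[OF S inv] by simp
  next
    case (gauge \<nu> m)
    have "scalars (prol_dir X z) J = ?S (scalars z J)" for J
      unfolding X by (rule scalars_prol_dir_linear[OF S])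
    then have "prolong X (euler (Lag P) f) z = minkowski \<nu> *
        (?S (Kcov \<nu> z) \<bullet> Tg m (scalars z 0) + Kcov \<nu> z \<bullet> Tg m (?S (scalars z 0)))"
      unfolding gauge prolong_euler_gauge
      by (simp add: Kcov_Acov linear_add[OF S] commutes_Acov[OF S comm])
    then show ?thesis
      by (simp add: higgs_rotate_skew[OF M] comm)
  qed
  moreover have "scalar_generator X" unfolding X by (rule scalar_generator_linear[OF S])
  ultimately show "X \<in> g_EL (Lag P)" by (simp add: g_EL_def el_symmetry_def)
qed

text \<open>The covariant derivatives rotate along with the scalars, so the kinetic term varies by
  products of the form \<open>v \<bullet> ?S v\<close>, which vanish by skewness.\<close>

lemma flavour_subset_svar: "flavour_symmetries P \<subseteq> g_svar (Lag P)"
proof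
  fix X assume "X \<in> flavour_symmetries P"
  then obtain M where X: "X = (\<lambda>y. higgs_rotate M (ph y))" and M: "dagger M = - M"
    and inv: "\<And>v. dvpot P v (higgs_rotate M v) = 0"
    by (auto simp: flavour_symmetries_def invariant_flow_def)
  let ?S = "higgs_rotate M"
  note S = linear_higgs[of M]
  have "scalars (prol_dir X z) J = ?S (scalars z J)" for z J
    unfolding X by (rule scalars_prol_dir_linear[OF S])
  then have "prolong X (Lag P) z = (\<Sum>\<mu>\<in>UNIV. minkowski \<mu> * (Kcov \<mu> z \<bullet> ?S (Kcov \<mu> z)))" for z
    unfolding prolong_lagrangian
    by (simp add: Kcov_Acov linear_add[OF S] commutes_Acov[OF S higgs_rotate_Tg] inv)
  moreover have "v \<bullet> ?S v = 0" for v
    using higgs_rotate_skew[OF M, of v v] by (simp add: inner_commute)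
  ultimately have "prolong X (Lag P) z = 0" for z by simp
  moreover have "scalar_generator X" unfolding X by (rule scalar_generator_linear[OF S])
  ultimately show "X \<in> g_svar (Lag P)" by (simp add: g_svar_def strictly_variational_def)
qed

lemma g_svar_subset_var: "g_svar L \<subseteq> g_var L"
proof -
  have "local_function (\<lambda>z. 0)" by (intro polyfun_local polyfun_const)
  then show ?thesis
    unfolding g_svar_def g_var_def strictly_variational_def variational_def
    by (auto intro!: exI[of _ "\<lambda>\<mu> z. 0"])
qed

end

section \<open>Testing divergences on a box\<close>

text \<open>Integration in one coordinate, with the result again a function of all coordinates, so
  that these operators compose and commute without a change of type.\<close>

definition Iop :: "'c \<Rightarrow> (('c \<Rightarrow> real) \<Rightarrow> real) \<Rightarrow> ('c \<Rightarrow> real) \<Rightarrow> real"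
  where "Iop \<mu> f x = integral {0..1} (\<lambda>t. f (x(\<mu> := t)))"

lemma continuous_on_fun_upd [continuous_intros]:
  fixes f :: "'a::topological_space \<Rightarrow> 'c \<Rightarrow> real"
  assumes "continuous_on S f" "continuous_on S h"
  shows "continuous_on S (\<lambda>x. (f x)(c := h x))"
proof (rule continuous_on_coordinatewise_then_product)
  fix d
  show "continuous_on S (\<lambda>x. ((f x)(c := h x)) d)"
    using assms continuous_on_product_then_coordinatewise[OF assms(1), of d] by (cases "d = c") auto
qed

text \<open>Joint continuity in the parameter and the point survives each integration; iterated,
  this justifies limits under the integral sign.\<close>

lemma Iop_continuous_param:
  fixes f :: "'p::topological_space \<Rightarrow> ('c \<Rightarrow> real) \<Rightarrow> real"
  assumes f: "continuous_on UNIV (\<lambda>(p, x). f p x)"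
  shows "continuous_on UNIV (\<lambda>(p, x). Iop \<mu> (f p) x)"
proof -
  have "continuous_on (UNIV \<times> cbox 0 1) (\<lambda>((p, x), t). f p (x(\<mu> := t :: real)))"
  proof -
    have "continuous_on (UNIV \<times> cbox 0 1) (\<lambda>u :: ('p \<times> ('c \<Rightarrow> real)) \<times> real. (\<lambda>(p, x). f p x) (fst (fst u), (snd (fst u))(\<mu> := snd u)))"
      by (intro continuous_on_compose2[OF f] continuous_intros) auto
    then show ?thesis by (simp add: case_prod_unfold)
  qed
  from integral_continuous_on_param[of UNIV 0 1 "\<lambda>(p, x) t. f p (x(\<mu> := t))"] this
  show ?thesis by (simp add: Iop_def case_prod_unfold)
qed

lemma Iop_continuous:
  assumes "continuous_on UNIV f"
  shows "continuous_on UNIV (Iop \<mu> f)"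
proof -
  have "continuous_on UNIV (\<lambda>u :: real \<times> ('a \<Rightarrow> real). f (snd u))"
    by (intro continuous_on_compose2[OF assms] continuous_intros) auto
  then have "continuous_on UNIV (\<lambda>(p :: real, x). Iop \<mu> f x)"
    by (intro Iop_continuous_param) (simp add: case_prod_unfold)
  then have "continuous_on UNIV (\<lambda>x. (\<lambda>(p :: real, x). Iop \<mu> f x) (0, x))"
    by (rule continuous_on_compose2) (auto intro!: continuous_intros)
  then show ?thesis by simp
qed

lemma continuous_along:
  assumes "continuous_on UNIV (f :: ('c \<Rightarrow> real) \<Rightarrow> real)"
  shows "continuous_on A (\<lambda>t. f (x(\<mu> := t)))"
  by (intro continuous_on_compose2[OF assms] continuous_intros) auto

lemma Iop_linear:
  assumes "continuous_on UNIV f" "continuous_on UNIV h"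
  shows "Iop \<mu> (\<lambda>x. a * f x + h x) = (\<lambda>x. a * Iop \<mu> f x + Iop \<mu> h x)"
proof
  fix x
  have "(\<lambda>t. f (x(\<mu> := t))) integrable_on {0..1}" "(\<lambda>t. h (x(\<mu> := t))) integrable_on {0..1}"
    by (intro integrable_continuous_real continuous_along assms)+
  then show "Iop \<mu> (\<lambda>x. a * f x + h x) x = a * Iop \<mu> f x + Iop \<mu> h x"
    unfolding Iop_def by (subst integral_add) (auto intro: integrable_on_mult_right)
qed

lemma Iop_const [simp]: "Iop \<mu> (\<lambda>x. k) = (\<lambda>x. k)"
  by (simp add: Iop_def fun_eq_iff)

lemma Iop_swap:
  assumes "continuous_on UNIV f" "\<mu> \<noteq> \<nu>"
  shows "Iop \<mu> (Iop \<nu> f) = Iop \<nu> (Iop \<mu> f)"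
proof
  fix x
  have "continuous_on (cbox (0, 0) (1, 1)) (\<lambda>(s, t). f (x(\<mu> := s, \<nu> := t)))"
    unfolding case_prod_unfold
    by (intro continuous_on_compose2[OF assms(1)] continuous_intros) auto
  from integral_swap_continuous[OF this]
  show "Iop \<mu> (Iop \<nu> f) x = Iop \<nu> (Iop \<mu> f) x"
    using assms(2) by (simp add: Iop_def fun_upd_twist)
qed

definition I4 :: "((4 \<Rightarrow> real) \<Rightarrow> real) \<Rightarrow> real"
  where "I4 f = Iop 0 (Iop 1 (Iop 2 (Iop 3 f))) (\<lambda>_. 0)"

lemma I4_linear:
  assumes "continuous_on UNIV f" "continuous_on UNIV h"
  shows "I4 (\<lambda>x. a * f x + h x) = a * I4 f + I4 h"
  by (simp add: I4_def Iop_linear Iop_continuous assms)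

lemma I4_const [simp]: "I4 (\<lambda>x. k) = k"
  by (simp add: I4_def)

lemma I4_cmult: "continuous_on UNIV f \<Longrightarrow> I4 (\<lambda>x. a * f x) = a * I4 f"
  using I4_linear[of f "\<lambda>x. 0" a] by simp

lemma I4_add: "continuous_on UNIV f \<Longrightarrow> continuous_on UNIV h \<Longrightarrow> I4 (\<lambda>x. f x + h x) = I4 f + I4 h"
  using I4_linear[of f h 1] by simp

lemma I4_sum:
  "(\<And>i. i \<in> I \<Longrightarrow> continuous_on UNIV (f i)) \<Longrightarrow> I4 (\<lambda>x. \<Sum>i\<in>I. f i x) = (\<Sum>i\<in>I. I4 (f i))"
proof (induction I rule: infinite_finite_induct)
  case (insert i I)
  have "I4 (\<lambda>x. f i x + (\<Sum>i\<in>I. f i x)) = I4 (f i) + I4 (\<lambda>x. \<Sum>i\<in>I. f i x)"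
    using insert.prems by (intro I4_add continuous_intros) auto
  then show ?case using insert by simp
qed auto

text \<open>Fubini brings the integration in direction \<open>\<mu>\<close> innermost, where the
  fundamental theorem of calculus applies.\<close>

lemma I4_derivative:
  assumes f: "continuous_on UNIV f"
    and d: "\<And>x t. ((\<lambda>t. h (x(\<mu> := t))) has_real_derivative f (x(\<mu> := t))) (at t)"
    and bd: "\<And>x. h (x(\<mu> := 0)) = 0" "\<And>x. h (x(\<mu> := 1)) = 0"
  shows "I4 f = 0"
proof -
  have 0: "Iop \<mu> f = (\<lambda>x. 0)"
  proof
    fix x
    note d' = has_field_derivative_at_within[OF d, unfolded has_real_derivative_iff_has_vector_derivative]
    have "((\<lambda>t. f (x(\<mu> := t))) has_integral h (x(\<mu> := 1)) - h (x(\<mu> := 0))) {0..1}"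
      by (rule fundamental_theorem_of_calculus) (simp, rule d')
    then show "Iop \<mu> f x = 0" by (simp add: bd Iop_def integral_unique)
  qed
  note c = Iop_continuous f
  have "I4 f = Iop 0 (Iop 1 (Iop 2 (Iop 3 f))) (\<lambda>_. 0)" by (simp add: I4_def)
  also consider "\<mu> = 1" | "\<mu> = 2" | "\<mu> = 3" | "\<mu> = 0" using exhaust_4[of \<mu>] by auto
  then have "Iop 0 (Iop 1 (Iop 2 (Iop 3 f))) (\<lambda>_. 0) = 0"
  proof cases
    case 1
    have "Iop 1 (Iop 2 (Iop 3 f)) = Iop 2 (Iop 3 (Iop 1 f))"
      by (simp add: c Iop_swap[of _ 1])
    then show ?thesis using 0 1 by simp
  next
    case 2
    have "Iop 2 (Iop 3 f) = Iop 3 (Iop 2 f)"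
      by (simp add: c Iop_swap[of _ 2])
    then show ?thesis using 0 2 by simp
  next
    case 3
    then show ?thesis using 0 by simp
  next
    case 4
    have "Iop 0 (Iop 1 (Iop 2 (Iop 3 f))) = Iop 1 (Iop 2 (Iop 3 (Iop 0 f)))"
      by (simp add: c Iop_swap[of _ 0])
    then show ?thesis using 0 4 by simp
  qed
  finally show ?thesis .
qed

lemma prod_UNIV_4: "(\<Prod>\<nu>\<in>(UNIV :: 4 set). h \<nu>) = h 0 * h 1 * h 2 * h 3"
proof -
  have eq: "UNIV = {0, 1, 2, 3::4}" unfolding UNIV_4 by auto
  show ?thesis by (subst eq) (simp add: ac_simps)
qed

lemma I4_prod: "I4 (\<lambda>x. \<Prod>\<nu>\<in>UNIV. h \<nu> (x \<nu>)) = (\<Prod>\<nu>\<in>UNIV. integral {0..1} (h \<nu>))"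
  unfolding I4_def Iop_def prod_UNIV_4 by simp

text \<open>The box has side lengths \<open>len\<close>; the argument \<open>x\<close> ranges over the unit cube.\<close>

definition test_jet :: "(4 \<Rightarrow> real) \<Rightarrow> (dep_var \<Rightarrow> real) \<Rightarrow> (dep_var \<Rightarrow> real) \<Rightarrow> (dep_var \<Rightarrow> 4 \<Rightarrow> real poly) \<Rightarrow> (4 \<Rightarrow> real) \<Rightarrow> jet"
  where "test_jet len k w Q x c = (case c of Indep \<mu> \<Rightarrow> len \<mu> * x \<mu>
    | Dep f J \<Rightarrow> (if J = 0 then k f else 0) +
        w f * (\<Prod>\<nu>\<in>UNIV. poly ((pderiv ^^ J \<nu>) (Q f \<nu>)) (x \<nu>) / len \<nu> ^ J \<nu>))"

text \<open>\<open>test_jet\<close> is the jet of an actual configuration, so moving the point moves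
  the jet along \<open>shift\<close>; the factor \<open>len \<mu>\<close> comes from parametrising
  the box by the unit cube.\<close>

lemma test_jet_derivative:
  assumes len: "len \<mu> \<noteq> 0"
  shows "((\<lambda>t. test_jet len k w Q (x(\<mu> := t)) c) has_real_derivative
    len \<mu> * shift \<mu> (test_jet len k w Q (x(\<mu> := t))) c) (at t)"
proof (cases c)
  case (Indep \<nu>)
  then show ?thesis
    by (cases "\<nu> = \<mu>") (auto simp: test_jet_def shift_def intro!: derivative_eq_intros)
next
  case (Dep f J)
  define R where "R = (\<Prod>\<nu>\<in>UNIV - {\<mu>}. poly ((pderiv ^^ J \<nu>) (Q f \<nu>)) (x \<nu>) / len \<nu> ^ J \<nu>)"
  have split: "(\<Prod>\<nu>\<in>UNIV. h \<nu>) = h \<mu> * (\<Prod>\<nu>\<in>UNIV - {\<mu>}. h \<nu>)" for h :: "4 \<Rightarrow> real"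
    by (rule prod.remove) auto
  have R: "(\<Prod>\<nu>\<in>UNIV - {\<mu>}. poly ((pderiv ^^ J \<nu>) (Q f \<nu>)) ((x(\<mu> := t)) \<nu>) / len \<nu> ^ J \<nu>) = R" for t
    unfolding R_def by (rule prod.cong) auto
  have R': "(\<Prod>\<nu>\<in>UNIV - {\<mu>}. poly ((pderiv ^^ (J + unit_index \<mu>) \<nu>) (Q f \<nu>)) ((x(\<mu> := t)) \<nu>) / len \<nu> ^ (J + unit_index \<mu>) \<nu>) = R" for t
    unfolding R_def by (rule prod.cong) (auto simp: unit_index_def)
  have J: "J + unit_index \<mu> \<noteq> 0"
    by (metis add_is_0 plus_fun_apply unit_index_def zero_fun_apply zero_neq_one)
  have J\<mu>: "(J + unit_index \<mu>) \<mu> = Suc (J \<mu>)" by (simp add: unit_index_def)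
  have "test_jet len k w Q (x(\<mu> := t)) (Dep f (J + unit_index \<mu>)) =
     w f * (poly (pderiv ((pderiv ^^ J \<mu>) (Q f \<mu>))) t / len \<mu> ^ Suc (J \<mu>) * R)"
    unfolding test_jet_def coord.case split R' J\<mu> using J by simp
  then have "len \<mu> * shift \<mu> (test_jet len k w Q (x(\<mu> := t))) c =
     w f * (poly (pderiv ((pderiv ^^ J \<mu>) (Q f \<mu>))) t / len \<mu> ^ J \<mu> * R)"
    using len by (simp add: Dep)
  moreover have "test_jet len k w Q (x(\<mu> := t)) c = (if J = 0 then k f else 0) + w f * (poly ((pderiv ^^ J \<mu>) (Q f \<mu>)) t / len \<mu> ^ J \<mu> * R)" for t
    unfolding Dep test_jet_def coord.case split R by simp
  ultimately show ?thesis
    using len by (auto intro!: derivative_eq_intros)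
qed

lemma test_jet_continuous: "continuous_on UNIV (test_jet len k w Q)"
proof (rule continuous_on_coordinatewise_then_product)
  fix c
  show "continuous_on UNIV (\<lambda>x. test_jet len k w Q x c)"
    unfolding test_jet_def
    by (cases c) (auto intro!: continuous_intros simp: divide_inverse)
qed

lemma total_deriv_continuous:
  assumes "local_function F"
  shows "continuous_on UNIV (total_deriv \<mu> F)"
proof -
  obtain S where S: "finite S" "depends_on F S" "smooth F"
    using assms by (auto simp: local_function_iff)
  have sh: "continuous_on UNIV (\<lambda>z. shift \<mu> z c)" for c
    by (cases c) (auto simp: shift_def intro!: continuous_intros)
  have "continuous_on UNIV (\<lambda>z. \<Sum>c\<in>S. shift \<mu> z c * pd c F z)"
    by (intro continuous_intros sh smooth_pd_continuous[OF S(3)])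
  moreover have "total_deriv \<mu> F = (\<lambda>z. \<Sum>c\<in>S. shift \<mu> z c * pd c F z)"
    using total_deriv_eq_sum[OF S(1,2)] by blast
  ultimately show ?thesis by simp
qed

lemma local_along_test_jet:
  assumes "local_function F" "len \<mu> \<noteq> 0"
  shows "((\<lambda>t. F (test_jet len k w Q (x(\<mu> := t)))) has_real_derivative
    len \<mu> * total_deriv \<mu> F (test_jet len k w Q (x(\<mu> := t)))) (at t)"
proof -
  obtain S where S: "finite S" "depends_on F S" "smooth F"
    using assms by (auto simp: local_function_iff)
  show ?thesis
    using chain_rule[OF S(3,1,2) test_jet_derivative[of len \<mu> k w Q x _ t], OF assms(2)]
    by (simp add: total_deriv_eq_sum[OF S(1,2)] sum_distrib_left mult.assoc)
qed

definition flat :: "nat \<Rightarrow> real poly \<Rightarrow> bool"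
  where "flat N q \<longleftrightarrow> (\<forall>k<N. poly ((pderiv ^^ k) q) 0 = 0 \<and> poly ((pderiv ^^ k) q) 1 = 0)"

text \<open>On the faces of the box the jets of the two configurations agree to the order on which \<open>\<beta>\<close> depends.\<close>

lemma divergence_test:
  assumes \<beta>: "\<And>\<mu>. local_function (\<beta> \<mu>)"
  shows "\<exists>N. \<forall>len k w Q. (\<forall>\<mu>. len \<mu> \<noteq> 0) \<longrightarrow> (\<forall>f \<mu>. flat N (Q f \<mu>)) \<longrightarrow>
    I4 (\<lambda>x. \<Sum>\<mu>\<in>UNIV. total_deriv \<mu> (\<beta> \<mu>) (test_jet len k w Q x)) =
    I4 (\<lambda>x. \<Sum>\<mu>\<in>UNIV. total_deriv \<mu> (\<beta> \<mu>) (test_jet len k (\<lambda>_. 0) Q x))"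
proof -
  have "\<forall>\<mu>. \<exists>S. finite S \<and> depends_on (\<beta> \<mu>) S" using \<beta> by (simp add: local_function_iff)
  then obtain S where S: "\<And>\<mu>. finite (S \<mu>)" "\<And>\<mu>. depends_on (\<beta> \<mu>) (S \<mu>)" by metis
  define ord where "ord = (\<lambda>c. case c of Indep \<mu> \<Rightarrow> 0 | Dep f J \<Rightarrow> sum J UNIV)"
  \<comment> \<open>Exceeds the order of every derivative on which any \<open>\<beta> \<mu>\<close>
    depends; \<open>Suc\<close> makes the bound strict, as \<open>flat\<close> demands.\<close>
  define N where "N = Suc (\<Sum>\<mu>\<in>UNIV. \<Sum>c\<in>S \<mu>. ord c)"
  have N: "J \<mu> < N" if "Dep f J \<in> S \<mu>" for f J \<mu>
  proof -
    have "J \<mu> \<le> ord (Dep f J)" by (simp add: ord_def member_le_sum)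
    also have "\<dots> \<le> (\<Sum>c\<in>S \<mu>. ord c)" by (rule member_le_sum[OF that]) (use S in auto)
    also have "\<dots> \<le> (\<Sum>\<mu>\<in>UNIV. \<Sum>c\<in>S \<mu>. ord c)" by (rule member_le_sum) auto
    finally show ?thesis by (simp add: N_def)
  qed
  show ?thesis
  proof (intro exI[of _ N] allI impI)
    fix len :: "4 \<Rightarrow> real" and k w :: "dep_var \<Rightarrow> real" and Q :: "dep_var \<Rightarrow> 4 \<Rightarrow> real poly"
    assume len: "\<forall>\<mu>. len \<mu> \<noteq> 0" and Q: "\<forall>f \<mu>. flat N (Q f \<mu>)"
    let ?z = "test_jet len k w Q" and ?zk = "test_jet len k (\<lambda>_. 0) Q"
    define D where "D = (\<lambda>\<mu> x. len \<mu> * total_deriv \<mu> (\<beta> \<mu>) (?z x) - len \<mu> * total_deriv \<mu> (\<beta> \<mu>) (?zk x))"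
    have cont: "continuous_on UNIV (\<lambda>x. total_deriv \<mu> (\<beta> \<mu>) (test_jet len k w Q x))" for \<mu> w
      by (rule continuous_on_compose2[OF total_deriv_continuous[OF \<beta>] test_jet_continuous]) auto
    have contD: "continuous_on UNIV (D \<mu>)" for \<mu>
      unfolding D_def by (intro continuous_intros cont)
    have D0: "I4 (D \<mu>) = 0" for \<mu>
    proof (rule I4_derivative[OF contD])
      show "((\<lambda>t. \<beta> \<mu> (?z (x(\<mu> := t))) - \<beta> \<mu> (?zk (x(\<mu> := t)))) has_real_derivative D \<mu> (x(\<mu> := t))) (at t)" for x t
        unfolding D_def by (intro DERIV_diff local_along_test_jet \<beta>) (use len in auto)
      have "\<beta> \<mu> (?z (x(\<mu> := a))) = \<beta> \<mu> (?zk (x(\<mu> := a)))" if a: "a = 0 \<or> a = 1" for x a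
      proof -
        have "?z (x(\<mu> := a)) c = ?zk (x(\<mu> := a)) c" if c: "c \<in> S \<mu>" for c
        proof (cases c)
          case (Dep f J)
          have "poly ((pderiv ^^ J \<mu>) (Q f \<mu>)) a = 0"
            using Q N[OF c[unfolded Dep]] a by (auto simp: flat_def)
          then have "(\<Prod>\<nu>\<in>UNIV. poly ((pderiv ^^ J \<nu>) (Q f \<nu>)) ((x(\<mu> := a)) \<nu>) / len \<nu> ^ J \<nu>) = 0"
            by (intro prod_zero bexI[of _ \<mu>]) auto
          then show ?thesis by (simp add: Dep test_jet_def)
        qed (simp add: test_jet_def)
        then show ?thesis using S(2)[of \<mu>] unfolding depends_on_def by blast
      qed
      then show "\<beta> \<mu> (?z (x(\<mu> := 0))) - \<beta> \<mu> (?zk (x(\<mu> := 0))) = 0"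
        "\<beta> \<mu> (?z (x(\<mu> := 1))) - \<beta> \<mu> (?zk (x(\<mu> := 1))) = 0" for x by simp_all
    qed
    have "(\<Sum>\<mu>\<in>UNIV. total_deriv \<mu> (\<beta> \<mu>) (?z x)) =
        (\<Sum>\<mu>\<in>UNIV. (1 / len \<mu>) * D \<mu> x) + (\<Sum>\<mu>\<in>UNIV. total_deriv \<mu> (\<beta> \<mu>) (?zk x))" for x
      unfolding sum.distrib[symmetric] by (rule sum.cong) (use len in \<open>auto simp: D_def field_simps\<close>)
    then have "I4 (\<lambda>x. \<Sum>\<mu>\<in>UNIV. total_deriv \<mu> (\<beta> \<mu>) (?z x)) =
        I4 (\<lambda>x. \<Sum>\<mu>\<in>UNIV. (1 / len \<mu>) * D \<mu> x) + I4 (\<lambda>x. \<Sum>\<mu>\<in>UNIV. total_deriv \<mu> (\<beta> \<mu>) (?zk x))"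
      by (simp only:) (intro I4_add continuous_intros cont contD)
    also have "I4 (\<lambda>x. \<Sum>\<mu>\<in>UNIV. (1 / len \<mu>) * D \<mu> x) = 0"
    proof -
      have "I4 (\<lambda>x. \<Sum>\<mu>\<in>UNIV. (1 / len \<mu>) * D \<mu> x) = (\<Sum>\<mu>\<in>UNIV. I4 (\<lambda>x. (1 / len \<mu>) * D \<mu> x))"
        by (rule I4_sum) (rule continuous_on_mult_left[OF contD])
      then show ?thesis by (simp only: I4_cmult[OF contD] D0) simp
    qed
    finally show "I4 (\<lambda>x. \<Sum>\<mu>\<in>UNIV. total_deriv \<mu> (\<beta> \<mu>) (?z x)) = I4 (\<lambda>x. \<Sum>\<mu>\<in>UNIV. total_deriv \<mu> (\<beta> \<mu>) (?zk x))"
      by simp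
  qed
qed

subsection \<open>Bump polynomials\<close>

lemma root_power_dvd_pderiv:
  fixes p :: "real poly"
  assumes "[:- a, 1:] ^ Suc n dvd p"
  shows "[:- a, 1:] ^ n dvd pderiv p"
proof -
  define s where "s = [:- a, 1:]"
  obtain r where p: "p = s ^ Suc n * r" using assms by (auto simp: s_def elim: dvdE)
  have "s ^ n dvd s ^ Suc n * pderiv r"
    by (intro dvd_mult2 le_imp_power_dvd) simp
  moreover have "s ^ n dvd r * (smult (of_nat (Suc n)) (s ^ n) * pderiv s)"
    by (intro dvd_mult dvd_mult2 dvd_smult dvd_refl)
  ultimately show ?thesis
    unfolding p pderiv_mult pderiv_power_Suc s_def[symmetric] by (rule dvd_add)
qed

lemma poly_higher_pderiv_root:
  fixes p :: "real poly"
  assumes "[:- a, 1:] ^ n dvd p" "k < n"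
  shows "poly ((pderiv ^^ k) p) a = 0"
proof -
  have "[:- a, 1:] ^ (n - k) dvd (pderiv ^^ k) p" if "k \<le> n" for k
    using that
  proof (induction k)
    case (Suc k)
    then have "[:- a, 1:] ^ Suc (n - Suc k) dvd (pderiv ^^ k) p" by (simp add: Suc_diff_Suc del: power_Suc)
    from root_power_dvd_pderiv[OF this] show ?case by simp
  qed (use assms in simp)
  from this[of k] assms(2) have "[:- a, 1:] ^ Suc (n - Suc k) dvd (pderiv ^^ k) p"
    by (simp add: Suc_diff_Suc del: power_Suc)
  then have "[:- a, 1:] dvd (pderiv ^^ k) p"
    by (metis dvd_mult_left power_Suc)
  then show ?thesis by (simp add: poly_eq_0_iff_dvd)
qed

text \<open>Zeros of order \<open>Suc N\<close> at both ends still leave zeros of order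
  \<open>N\<close> for the derivative, which later serves as the profile of a gauge field.\<close>

lemma bump_exists: "\<exists>q. flat N q \<and> flat N (pderiv q) \<and> q \<noteq> 0 \<and> pderiv q \<noteq> 0"
proof -
  define q :: "real poly" where "q = [:- 0, 1:] ^ Suc N * [:- 1, 1:] ^ Suc N"
  have r: "poly ((pderiv ^^ k) q) 0 = 0 \<and> poly ((pderiv ^^ k) q) 1 = 0" if "k < Suc N" for k
    using that unfolding q_def
    by (intro conjI poly_higher_pderiv_root[of _ "Suc N"] dvd_triv_left dvd_triv_right)
  have "(pderiv ^^ k) (pderiv q) = (pderiv ^^ Suc k) q" for k by (simp add: funpow_swap1)
  then have "flat N q" "flat N (pderiv q)"
    using r unfolding flat_def by (simp, metis Suc_less_eq less_SucI)
  moreover have "q \<noteq> 0" by (simp add: q_def del: power_Suc)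
  moreover have "degree q = Suc N + Suc N"
    unfolding q_def by (subst degree_mult_eq) (simp_all add: degree_power_eq del: power_Suc)
  then have "pderiv q \<noteq> 0" by (simp add: pderiv_eq_0_iff)
  ultimately show ?thesis by blast
qed

lemma integral_square_pos:
  fixes q :: "real poly"
  assumes "q \<noteq> 0"
  shows "0 < integral {0..1} (\<lambda>t. (poly q t)\<^sup>2)"
proof -
  have c: "continuous_on {0..1} (\<lambda>t. (poly q t)\<^sup>2)" by (intro continuous_intros)
  have "integral {0..1} (\<lambda>t. (poly q t)\<^sup>2) \<noteq> 0"
  proof
    assume "integral {0..1} (\<lambda>t. (poly q t)\<^sup>2) = 0"
    then have "\<forall>t\<in>{0..1}. (poly q t)\<^sup>2 = 0"
      using integral_eq_0_iff[OF c] by simp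
    then have "{0..1} \<subseteq> {t. poly q t = 0}" by auto
    then show False
      using finite_subset[OF _ poly_roots_finite[OF assms]] infinite_Icc[of "0::real" 1] by auto
  qed
  moreover have "0 \<le> integral {0..1} (\<lambda>t. (poly q t)\<^sup>2)"
    by (intro integral_nonneg integrable_continuous_real c) auto
  ultimately show ?thesis by simp
qed

section \<open>Variational generators\<close>

lemma flat_mono: "flat N q \<Longrightarrow> M \<le> N \<Longrightarrow> flat M q"
  by (auto simp: flat_def)

definition pbump :: "real poly \<Rightarrow> (4 \<Rightarrow> real) \<Rightarrow> real"
  where "pbump q x = (\<Prod>\<nu>\<in>UNIV. poly q (x \<nu>))"

text \<open>The derivative of \<open>pbump q\<close> in direction \<open>\<mu>\<close>, in the
  coordinates of the unit cube.\<close>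

definition dbump :: "real poly \<Rightarrow> 4 \<Rightarrow> (4 \<Rightarrow> real) \<Rightarrow> real"
  where "dbump q \<mu> x = (\<Prod>\<nu>\<in>UNIV. poly (if \<nu> = \<mu> then pderiv q else q) (x \<nu>))"

lemma continuous_pbump [continuous_intros]: "continuous_on A f \<Longrightarrow> continuous_on A (\<lambda>u. pbump q (f u))"
  and continuous_dbump [continuous_intros]: "continuous_on A f \<Longrightarrow> continuous_on A (\<lambda>u. dbump q \<mu> (f u))"
  unfolding pbump_def dbump_def
  by (auto intro!: continuous_intros continuous_on_product_then_coordinatewise[of A f])

lemma I4_pbump_power: "I4 (\<lambda>x. pbump q x ^ n) = integral {0..1} (\<lambda>t. poly q t ^ n) ^ 4"
  using I4_prod[of "\<lambda>\<nu> t. poly q t ^ n"] by (simp add: pbump_def prod_power_distrib)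

lemma I4_dbump_sq:
  "I4 (\<lambda>x. dbump q \<mu> x ^ 2) = integral {0..1} (\<lambda>t. poly (pderiv q) t ^ 2) * integral {0..1} (\<lambda>t. poly q t ^ 2) ^ 3"
proof -
  have "I4 (\<lambda>x. dbump q \<mu> x ^ 2) = (\<Prod>\<nu>\<in>UNIV. integral {0..1} (\<lambda>t. poly (if \<nu> = \<mu> then pderiv q else q) t ^ 2))"
    using I4_prod[of "\<lambda>\<nu> t. poly (if \<nu> = \<mu> then pderiv q else q) t ^ 2"]
    by (simp add: dbump_def prod_power_distrib)
  then show ?thesis
    using exhaust_4[of \<mu>] by (auto simp: prod_UNIV_4 power3_eq_cube)
qed

text \<open>Makes terms linear in the slopes integrate to zero. With \<open>Suc N\<close>, flatness
  includes the vanishing of \<open>q\<close> itself at the ends, whatever \<open>N\<close>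
  is.\<close>

lemma I4_dbump:
  assumes "flat (Suc N) q"
  shows "I4 (dbump q \<mu>) = 0"
proof -
  have q: "poly q 0 = 0" "poly q 1 = 0"
    using assms unfolding flat_def by (metis funpow_0 zero_less_Suc)+
  have "((\<lambda>t. poly (pderiv q) t) has_integral poly q 1 - poly q 0) {0..1}"
    by (rule fundamental_theorem_of_calculus)
       (auto intro!: has_field_derivative_at_within poly_DERIV simp flip: has_real_derivative_iff_has_vector_derivative)
  then have "integral {0..1} (poly (pderiv q)) = 0" using q by (simp add: integral_unique)
  then have "(\<Prod>\<nu>\<in>UNIV. integral {0..1} (poly (if \<nu> = \<mu> then pderiv q else q))) = 0"
    by (intro prod_zero bexI[of _ \<mu>]) auto
  then show ?thesis
    using I4_prod[of "\<lambda>\<nu>. poly (if \<nu> = \<mu> then pderiv q else q)"] unfolding dbump_def[abs_def] by (simp only:)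
qed

lemma I4_positivity:
  assumes "q \<noteq> 0" "pderiv q \<noteq> 0"
  shows "I4 (\<lambda>x. pbump q x ^ 2) > 0" "I4 (\<lambda>x. pbump q x ^ 4) > 0" "I4 (\<lambda>x. dbump q \<mu> x ^ 2) > 0"
proof -
  have "poly q t ^ 4 = (poly (q ^ 2) t) ^ 2" for t by (simp add: power_mult[symmetric] poly_power)
  then show "I4 (\<lambda>x. pbump q x ^ 2) > 0" "I4 (\<lambda>x. pbump q x ^ 4) > 0" "I4 (\<lambda>x. dbump q \<mu> x ^ 2) > 0"
    using integral_square_pos[OF assms(1)] integral_square_pos[OF assms(2)] integral_square_pos[of "q ^ 2"] assms
    by (simp_all add: I4_pbump_power I4_dbump_sq)
qed

lemma I4_continuous_param:
  fixes E :: "real \<Rightarrow> (4 \<Rightarrow> real) \<Rightarrow> real"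
  assumes "continuous_on UNIV (\<lambda>(p, x). E p x)"
  shows "continuous_on UNIV (\<lambda>p. I4 (E p))"
proof -
  have "continuous_on UNIV (\<lambda>(p, x). Iop 0 (Iop 1 (Iop 2 (Iop 3 (E p)))) x)"
    by (intro Iop_continuous_param assms)
  then have "continuous_on UNIV (\<lambda>p. (\<lambda>(p, x). Iop 0 (Iop 1 (Iop 2 (Iop 3 (E p)))) x) (p, \<lambda>_. 0))"
    by (rule continuous_on_compose2) (auto intro!: continuous_intros)
  then show ?thesis by (simp add: I4_def)
qed

section \<open>The prolonged Lagrangian on test configurations\<close>

definition test_fields :: "(dep_var \<Rightarrow> real) \<Rightarrow> (dep_var \<Rightarrow> real) \<Rightarrow> (dep_var \<Rightarrow> 4 \<Rightarrow> real poly) \<Rightarrow> (4 \<Rightarrow> real) \<Rightarrow> dep_var \<Rightarrow> real"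
  where "test_fields k w Q x = (\<lambda>f. k f + w f * (\<Prod>\<nu>\<in>UNIV. poly (Q f \<nu>) (x \<nu>)))"

definition test_slopes :: "(4 \<Rightarrow> real) \<Rightarrow> (dep_var \<Rightarrow> real) \<Rightarrow> (dep_var \<Rightarrow> 4 \<Rightarrow> real poly) \<Rightarrow> (4 \<Rightarrow> real) \<Rightarrow> 4 \<Rightarrow> dep_var \<Rightarrow> real"
  where "test_slopes len w Q x = (\<lambda>\<mu> f. w f * (\<Prod>\<nu>\<in>UNIV. poly (if \<nu> = \<mu> then pderiv (Q f \<nu>) else Q f \<nu>) (x \<nu>)) / len \<mu>)"

lemma test_jet_fields: "fields (test_jet len k w Q x) = test_fields k w Q x"
  by (simp add: fields_def test_jet_def test_fields_def)

lemma test_jet_slopes: "test_jet len k w Q x (Dep f (unit_index \<mu>)) = test_slopes len w Q x \<mu> f"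
proof -
  have "(\<Prod>\<nu>\<in>UNIV. len \<nu> ^ unit_index \<mu> \<nu>) = (\<Prod>\<nu>\<in>UNIV. if \<nu> = \<mu> then len \<nu> else 1)"
    by (rule prod.cong) (auto simp: unit_index_def)
  then have 1: "(\<Prod>\<nu>\<in>UNIV. len \<nu> ^ unit_index \<mu> \<nu>) = len \<mu>" by (simp add: prod.delta)
  have "(\<Prod>\<nu>\<in>UNIV. poly ((pderiv ^^ unit_index \<mu> \<nu>) (Q f \<nu>)) (x \<nu>)) =
    (\<Prod>\<nu>\<in>UNIV. poly (if \<nu> = \<mu> then pderiv (Q f \<nu>) else Q f \<nu>) (x \<nu>))"
    by (rule prod.cong) (auto simp: unit_index_def)
  then show ?thesis by (simp add: test_jet_def test_slopes_def prod_dividef 1)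
qed

lemma scalar_generator_continuous:
  assumes "scalar_generator X"
  shows "continuous_on UNIV X" "continuous_on UNIV (pd f (\<lambda>y. X y $ i))"
proof -
  have s: "smooth (\<lambda>y. X y $ i)" for i using assms by (simp add: scalar_generator_def)
  have "continuous_on UNIV (\<lambda>y. \<chi> i. X y $ i)"
    by (intro continuous_on_vec_lambda smooth_continuous s)
  then show "continuous_on UNIV X" by simp
  show "continuous_on UNIV (pd f (\<lambda>y. X y $ i))"
    by (rule smooth_pd_continuous[OF s])
qed

lemma continuous_on_linear_image:
  fixes S :: "'a::euclidean_space \<Rightarrow> 'b::real_normed_vector"
  assumes "linear S" "continuous_on A f"
  shows "continuous_on A (\<lambda>u. S (f u))"
  using assms by (simp add: linear_conv_bounded_linear bounded_linear.continuous_on)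

context couplings begin

definition Afld :: "(dep_var \<Rightarrow> real) \<Rightarrow> 4 \<Rightarrow> real^8 \<Rightarrow> real^8"
  where "Afld y \<mu> v = (\<Sum>m\<in>UNIV. y (gfield \<mu> m) *\<^sub>R Tg m v)"

text \<open>The prolonged Lagrangian as a function of fields and slopes, kept as two arguments so
  that they can be scaled independently.\<close>

definition PL :: "potential_params \<Rightarrow> generator \<Rightarrow> (dep_var \<Rightarrow> real) \<Rightarrow> (4 \<Rightarrow> dep_var \<Rightarrow> real) \<Rightarrow> real"
  where "PL P X y W = (\<Sum>\<mu>\<in>UNIV. minkowski \<mu> *
    ((ph (W \<mu>) + Afld y \<mu> (ph y)) \<bullet> (dgen X y (W \<mu>) + Afld y \<mu> (X y)))) - dvpot P (ph y) (X y)"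

lemma prolong_PL: "prolong X (Lag P) z = PL P X (fields z) (\<lambda>\<mu> f. z (Dep f (unit_index \<mu>)))"
proof -
  have "Acov \<mu> z = Afld (fields z) \<mu>" for \<mu>
    by (simp add: fun_eq_iff Acov_def Afld_def fields_def)
  moreover have "ph (\<lambda>f. z (Dep f (unit_index \<mu>))) = scalars z (unit_index \<mu>)" for \<mu>
    by (simp add: vec_eq_iff)
  ultimately show ?thesis
    by (simp add: prolong_lagrangian PL_def scalars_prol_dir Kcov_Acov)
qed

text \<open>The configuration used for comparison is the constant \<open>k\<close>; its integrand is
  constant, hence equal to its integral over the unit cube.\<close>

definition box_test :: "potential_params \<Rightarrow> generator \<Rightarrow> nat \<Rightarrow> bool"
  where "box_test P X N \<longleftrightarrow> (\<forall>len k w Q. (\<forall>\<mu>. len \<mu> \<noteq> 0) \<longrightarrow> (\<forall>f \<mu>. flat N (Q f \<mu>)) \<longrightarrow>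
    I4 (\<lambda>x. PL P X (test_fields k w Q x) (test_slopes len w Q x)) = PL P X k (\<lambda>_ _. 0))"

lemma box_testD:
  assumes "box_test P X N" "\<forall>\<mu>. len \<mu> \<noteq> 0" "\<forall>f \<mu>. flat N (Q f \<mu>)"
  shows "I4 (\<lambda>x. PL P X (test_fields k w Q x) (test_slopes len w Q x)) = PL P X k (\<lambda>_ _. 0)"
  by (rule assms(1)[unfolded box_test_def, THEN spec, THEN spec, THEN spec, THEN spec, THEN mp, THEN mp, OF assms(2,3)])

lemma variational_test:
  assumes "variational (Lag P) X"
  shows "\<exists>N. box_test P X N"
proof -
  obtain \<beta> where \<beta>: "\<And>\<mu>. local_function (\<beta> \<mu>)"
    and eq: "\<And>z. prolong X (Lag P) z = (\<Sum>\<mu>\<in>UNIV. total_deriv \<mu> (\<beta> \<mu>) z)"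
    using assms unfolding variational_def by blast
  show ?thesis
    using divergence_test[of \<beta>, OF \<beta>]
    unfolding box_test_def eq[symmetric] prolong_PL test_jet_fields test_jet_slopes
    by (simp add: test_fields_def[of _ "\<lambda>_. 0"] test_slopes_def[of _ "\<lambda>_. 0"])
qed

lemma linear_dgen: "dgen X y (\<lambda>f. c * w f) = c *\<^sub>R dgen X y w"
  by (simp add: dgen_def vec_eq_iff sum_distrib_left mult.assoc)

lemma continuous_Tg [continuous_intros]: "continuous_on A f \<Longrightarrow> continuous_on A (\<lambda>u. Tg m (f u))"
  by (rule continuous_on_linear_image[OF linear_Tg])

lemma continuous_ph [continuous_intros]: "continuous_on A f \<Longrightarrow> continuous_on A (\<lambda>u. ph (f u))"
  unfolding ph_def by (rule continuous_on_vec_lambda, rule continuous_on_product_then_coordinatewise)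

lemma continuous_dvpot:
  assumes "continuous_on A f" "continuous_on A h"
  shows "continuous_on A (\<lambda>u. dvpot P (f u) (h u))"
proof -
  have b: "continuous_on A (\<lambda>u. bil (f1 u) (f2 u) $ k)" if "continuous_on A f1" "continuous_on A f2" for f1 f2 k
  proof -
    consider "k = 1" | "k = 2" | "k = 3" | "k = 4" using exhaust_4[of k] by blast
    then show ?thesis
      by cases (simp_all add: bil_def, (intro continuous_intros that; simp)+)
  qed
  have "continuous_on A (\<lambda>u. \<chi> k. bil (f1 u) (f2 u) $ k)" if "continuous_on A f1" "continuous_on A f2" for f1 f2
    by (intro continuous_on_vec_lambda b that)
  then have bb: "continuous_on A (\<lambda>u. bil (f1 u) (f2 u))" if "continuous_on A f1" "continuous_on A f2" for f1 f2
    using that by simp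
  show ?thesis
    unfolding dvpot_def
    by (intro continuous_intros bb continuous_on_linear_image[OF matrix_vector_mul_linear] assms)
qed

lemma PL_continuous:
  fixes h :: "'p::topological_space \<Rightarrow> dep_var \<Rightarrow> real"
  assumes X: "scalar_generator X" and h: "continuous_on UNIV h" and W: "\<And>\<mu>. continuous_on UNIV (\<lambda>u. W u \<mu>)"
  shows "continuous_on UNIV (\<lambda>u. PL P X (h u) (W u))"
proof -
  have c: "continuous_on UNIV (\<lambda>u. X (h u))"
    by (rule continuous_on_compose2[OF scalar_generator_continuous(1)[OF X] h]) simp
  have pdc: "continuous_on UNIV (\<lambda>u. pd f (\<lambda>y. X y $ i) (h u))" for f i
    by (rule continuous_on_compose2[OF scalar_generator_continuous(2)[OF X] h]) simp
  have d: "continuous_on UNIV (\<lambda>u. dgen X (h u) (W u \<mu>))" for \<mu>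
    unfolding dgen_def
    by (intro continuous_intros continuous_on_vec_lambda pdc continuous_on_product_then_coordinatewise[OF W])
  have a: "continuous_on UNIV (\<lambda>u. Afld (h u) \<mu> (v u))" if "continuous_on UNIV v" for v \<mu>
    unfolding Afld_def by (intro continuous_intros that continuous_on_product_then_coordinatewise[OF h])
  show ?thesis
    unfolding PL_def by (intro continuous_intros a d c h W continuous_dvpot)
qed

text \<open>Shrinking the box at fixed first derivatives isolates the part quadratic in the derivatives.\<close>

lemma variational_imp_killing:
  assumes X: "scalar_generator X" and var: "variational (Lag P) X"
  shows "ph w \<bullet> dgen X k w = 0"
proof -
  obtain N where N: "box_test P X N" using variational_test[OF var] by blast
  obtain q where q: "flat (Suc N) q" "q \<noteq> 0" "pderiv q \<noteq> 0" using bump_exists by blast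
  \<comment> \<open>Amplitude and all four side lengths are \<open>\<delta>\<close>, so the slopes
    do not depend on \<open>\<delta>\<close>, while at \<open>\<delta> = 0\<close> the fields freeze
    at \<open>k\<close>.\<close>
  define E where "E = (\<lambda>\<delta> x. PL P X (\<lambda>f. k f + \<delta> * w f * pbump q x) (\<lambda>\<mu> f. dbump q \<mu> x * w f))"
  have E: "I4 (E \<delta>) = PL P X k (\<lambda>_ _. 0)" if "\<delta> \<noteq> 0" for \<delta>
    using box_testD[OF N, of "\<lambda>_. \<delta>" "\<lambda>_ _. q" k "\<lambda>f. \<delta> * w f"] that flat_mono[OF q(1)]
    by (simp add: E_def pbump_def dbump_def test_fields_def test_slopes_def mult_ac)
  have "continuous_on UNIV (\<lambda>u. PL P X (\<lambda>f. k f + fst u * w f * pbump q (snd u)) (\<lambda>\<mu> f. dbump q \<mu> (snd u) * w f))"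
    by (intro PL_continuous[OF X] continuous_on_coordinatewise_then_product continuous_intros)
  then have "continuous_on UNIV (\<lambda>\<delta>. I4 (E \<delta>))"
    by (intro I4_continuous_param) (simp add: E_def case_prod_unfold)
  then have "((\<lambda>\<delta>. I4 (E \<delta>)) \<longlongrightarrow> I4 (E 0)) (at 0)"
    by (simp add: continuous_on_def)
  moreover have "((\<lambda>\<delta>. I4 (E \<delta>)) \<longlongrightarrow> PL P X k (\<lambda>_ _. 0)) (at 0)"
    by (rule tendsto_eventually) (auto simp: eventually_at_filter E)
  ultimately have E0: "I4 (E 0) = PL P X k (\<lambda>_ _. 0)"
    by (rule tendsto_unique[OF at_neq_bot])
  define a where "a = ph w \<bullet> dgen X k w"
  define b where "b = (\<lambda>\<mu>. ph w \<bullet> Afld k \<mu> (X k) + Afld k \<mu> (ph k) \<bullet> dgen X k w)"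
  have ph_c: "ph (\<lambda>f. c * w f) = c *\<^sub>R ph w" for c by (simp add: vec_eq_iff)
  have ph_0: "ph (\<lambda>f. 0) = 0" by (simp add: vec_eq_iff)
  have E0x: "E 0 x = PL P X k (\<lambda>_ _. 0) + (\<Sum>\<mu>\<in>UNIV. minkowski \<mu> * a * dbump q \<mu> x ^ 2 + minkowski \<mu> * b \<mu> * dbump q \<mu> x)" for x
    unfolding E_def PL_def ph_c ph_0 linear_dgen dgen_0
    by (simp add: a_def b_def inner_simps algebra_simps power2_eq_square flip: sum.distrib)
  have "I4 (E 0) = PL P X k (\<lambda>_ _. 0) + (\<Sum>\<mu>\<in>UNIV. minkowski \<mu> * a * I4 (\<lambda>x. dbump q \<mu> x ^ 2) + minkowski \<mu> * b \<mu> * I4 (dbump q \<mu>))"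
  proof -
    have "I4 (E 0) = I4 (\<lambda>x. PL P X k (\<lambda>_ _. 0) + (\<Sum>\<mu>\<in>UNIV. minkowski \<mu> * a * dbump q \<mu> x ^ 2 + minkowski \<mu> * b \<mu> * dbump q \<mu> x))"
      by (simp add: E0x[abs_def])
    also have "\<dots> = PL P X k (\<lambda>_ _. 0) + (\<Sum>\<mu>\<in>UNIV. I4 (\<lambda>x. minkowski \<mu> * a * dbump q \<mu> x ^ 2 + minkowski \<mu> * b \<mu> * dbump q \<mu> x))"
      by (subst I4_add, intro continuous_intros, intro continuous_intros, subst I4_sum, intro continuous_intros) simp
    also have "(\<lambda>\<mu>. I4 (\<lambda>x. minkowski \<mu> * a * dbump q \<mu> x ^ 2 + minkowski \<mu> * b \<mu> * dbump q \<mu> x)) =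
      (\<lambda>\<mu>. minkowski \<mu> * a * I4 (\<lambda>x. dbump q \<mu> x ^ 2) + minkowski \<mu> * b \<mu> * I4 (dbump q \<mu>))"
      by (rule ext, subst I4_linear, intro continuous_intros, intro continuous_intros, subst I4_cmult, intro continuous_intros) simp
    finally show ?thesis .
  qed
  \<comment> \<open>The integral of the squared slope is the same in all four directions, so the
    Minkowski trace 1 - 3 = -2 factors out, and it is not zero.\<close>
  then have "(\<Sum>\<mu>\<in>UNIV. minkowski \<mu> * (a * I4 (\<lambda>x. dbump q 0 x ^ 2))) = 0"
    unfolding E0 I4_dbump[OF q(1)] I4_dbump_sq by (simp add: mult.assoc)
  then have "(\<Sum>\<mu>\<in>UNIV. minkowski \<mu>) * (a * I4 (\<lambda>x. dbump q 0 x ^ 2)) = 0"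
    unfolding sum_distrib_right .
  moreover have "(\<Sum>\<mu>\<in>UNIV. minkowski \<mu>) = - 2" by (simp add: sum_4 minkowski_def)
  ultimately show ?thesis
    using I4_positivity(3)[OF q(2,3), of 0] by (simp add: a_def)
qed

text \<open>Integrated along segments, the hypothesis becomes
  \<open>(X y - X y') \<bullet> (ph y - ph y') = 0\<close>, and polarization gives linearity without further derivatives.\<close>

lemma killing_imp_affine:
  assumes X: "scalar_generator X" and kill: "\<And>k w. ph w \<bullet> dgen X k w = 0"
  shows "\<exists>S b. linear S \<and> (\<forall>v w. S v \<bullet> w = - (v \<bullet> S w)) \<and> X = (\<lambda>y. S (ph y) + b)"
proof -
  have diff: "(X y - X y') \<bullet> (ph y - ph y') = 0" for y y'
  proof -
    define w where "w = (\<lambda>f. y f - y' f)"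
    have z: "dgen X (\<lambda>f. y' f + t * w f) w \<bullet> ph w = 0" for t
      by (subst inner_commute) (rule kill)
    have "((\<lambda>t. X (\<lambda>f. y' f + t * w f) \<bullet> ph w) has_real_derivative dgen X (\<lambda>f. y' f + t * w f) w \<bullet> ph w) (at t)" for t
      unfolding inner_8 by (intro dgen_line[OF X] DERIV_cmult_right DERIV_add)
    then have "((\<lambda>t. X (\<lambda>f. y' f + t * w f) \<bullet> ph w) has_real_derivative 0) (at t)" for t
      unfolding z .
    then have "X (\<lambda>f. y' f + 0 * w f) \<bullet> ph w = X (\<lambda>f. y' f + 1 * w f) \<bullet> ph w"
      by (intro DERIV_isconst_all) blast
    moreover have "ph w = ph y - ph y'" by (simp add: w_def vec_eq_iff)
    ultimately show ?thesis by (simp add: w_def inner_diff_left)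
  qed
  define b where "b = X (\<lambda>f. 0)"
  define Z where "Z = (\<lambda>y. X y - b)"
  have ph_0: "ph (\<lambda>f. 0) = 0" by (simp add: vec_eq_iff)
  have Z0: "Z y \<bullet> ph y = 0" for y
    using diff[of y "\<lambda>f. 0"] by (simp add: Z_def b_def ph_0)
  have ZZ: "Z y \<bullet> ph y' = - (Z y' \<bullet> ph y)" for y y'
    using diff[of y y'] Z0[of y] Z0[of y'] by (simp add: Z_def inner_simps)
  define S where "S = (\<lambda>v. Z (emb v))"
  \<comment> \<open>Tested against all \<open>u\<close>, this shows that \<open>Z y\<close> depends
    on \<open>y\<close> through \<open>ph y\<close> alone.\<close>
  have Z_S: "Z y \<bullet> u = - (S u \<bullet> ph y)" for y u
    using ZZ[of y "emb u"] by (simp add: S_def)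
  have skew: "S v \<bullet> w = - (v \<bullet> S w)" for v w
    using Z_S[of "emb v" w] by (simp add: S_def inner_commute)
  have Z_eq: "Z y = S (ph y)" for y
  proof -
    have "Z y \<bullet> u = S (ph y) \<bullet> u" for u
      using Z_S[of y u] skew[of "ph y" u] by (simp add: inner_commute)
    then show ?thesis using vector_eq_rdot by blast
  qed
  have "linear S"
  proof (rule linearI)
    show "S (u + v) = S u + S v" for u v
    proof -
      have "S (u + v) \<bullet> w = (S u + S v) \<bullet> w" for w
        by (simp add: skew inner_simps)
      then show ?thesis using vector_eq_rdot by blast
    qed
    show "S (c *\<^sub>R u) = c *\<^sub>R S u" for c u
    proof -
      have "S (c *\<^sub>R u) \<bullet> w = (c *\<^sub>R S u) \<bullet> w" for w
        by (simp add: skew inner_simps)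
      then show ?thesis using vector_eq_rdot by blast
    qed
  qed
  moreover have "X = (\<lambda>y. S (ph y) + b)"
    using Z_eq by (auto simp: Z_def fun_eq_iff algebra_simps)
  ultimately show ?thesis using skew by blast
qed

lemma dgen_affine:
  assumes S: "linear S"
  shows "dgen (\<lambda>y. S (ph y) + b) y w = S (ph w)"
proof -
  have "pd f (\<lambda>y. (S (ph y) + b) $ i) y = pd f (\<lambda>y. S (ph y) $ i) y" for f i
  proof (rule pd_eqI)
    show "((\<lambda>t. (S (ph (y(f := t))) + b) $ i) has_real_derivative pd f (\<lambda>y. S (ph y) $ i) y) (at (y f))"
      using DERIV_add[OF polyfun_DERIV[OF polyfun_linear_ph[OF S, of i], of y f] DERIV_const[of "b $ i"]] by simp
  qed
  then have "dgen (\<lambda>y. S (ph y) + b) y w = dgen (\<lambda>y. S (ph y)) y w"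
    by (simp add: dgen_def)
  then show ?thesis by (simp add: dgen_linear[OF S])
qed

text \<open>Besides the scalars, a single component of one gauge field is switched on, over a box
  with one side \<open>\<delta>\<close>. This multiplies \<open>\<kappa>\<close> by
  \<open>1 / \<delta>\<close> and leaves the other terms independent of \<open>\<delta>\<close>, so
  \<open>\<kappa>\<close> vanishes; that removes the translation \<open>b\<close> and makes
  \<open>S\<close> commute with the gauge group.\<close>

lemma g_var_subset: "g_var (Lag P) \<subseteq> flavour_symmetries P"
proof
  fix X assume "X \<in> g_var (Lag P)"
  then have X: "scalar_generator X" and var: "variational (Lag P) X" by (simp_all add: g_var_def)
  obtain N where N: "box_test P X N" using variational_test[OF var] by blast
  obtain q where q: "flat (Suc N) q" "flat (Suc N) (pderiv q)" "q \<noteq> 0" "pderiv q \<noteq> 0" using bump_exists by blast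
  note qN = flat_mono[OF q(1), of N] flat_mono[OF q(2), of N]
  obtain S b where S: "linear S" and skew: "\<And>v w. S v \<bullet> w = - (v \<bullet> S w)" and Xeq: "X = (\<lambda>y. S (ph y) + b)"
    using killing_imp_affine[OF X variational_imp_killing[OF X var]] by blast
  note Slin = linear_add[OF S] linear_cmul[OF S] linear_0[OF S]
  have vSv: "v \<bullet> S v = 0" for v using skew[of v v] by (simp add: inner_commute)
  have \<kappa>: "w0 \<bullet> Tg m (S c0 + b) + Tg m c0 \<bullet> S w0 = 0" for m w0 c0
  proof -
    define \<kappa> where "\<kappa> = w0 \<bullet> Tg m (S c0 + b) + Tg m c0 \<bullet> S w0"
    define R where "R = (\<lambda>x. dbump q 0 x ^ 2 * (Tg m (c0 + pbump q x *\<^sub>R w0) \<bullet> Tg m (S (c0 + pbump q x *\<^sub>R w0) + b))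
      - dvpot P (c0 + pbump q x *\<^sub>R w0) (S (c0 + pbump q x *\<^sub>R w0) + b))"
    define w where "w = (\<lambda>f. emb w0 f + (if f = gfield 0 m then 1 else 0))"
    \<comment> \<open>With profile \<open>pderiv q\<close> in direction 0, the gauge field has the
      same shape as the time derivative of the scalar bump; their product is a square with positive
      integral.\<close>
    define Q where "Q = (\<lambda>f (\<mu>::4). if f = gfield 0 m \<and> \<mu> = 0 then pderiv q else q)"
    have contR: "continuous_on UNIV R"
      unfolding R_def
      by (intro continuous_intros continuous_dvpot continuous_on_linear_image[OF S])
    have eq: "(1 / \<delta>) * \<kappa> * I4 (\<lambda>x. dbump q 0 x ^ 2) + I4 R = PL P X (emb c0) (\<lambda>_ _. 0)" if \<delta>: "\<delta> \<noteq> 0" for \<delta>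
    proof -
      define len where "len = (\<lambda>\<mu>::4. if \<mu> = 0 then \<delta> else 1)"
      have "PL P X (test_fields (emb c0) w Q x) (test_slopes len w Q x) = (1 / \<delta>) * \<kappa> * dbump q 0 x ^ 2 + R x" for x
      proof -
        define y where "y = test_fields (emb c0) w Q x"
        define W where "W = test_slopes len w Q x"
        define v where "v = c0 + pbump q x *\<^sub>R w0"
        define d where "d = dbump q 0 x"
        have phy: "ph y = v"
          by (simp add: y_def test_fields_def vec_eq_iff v_def w_def Q_def pbump_def emb_def mult.commute)
        have phW: "ph (W \<mu>) = (dbump q \<mu> x / len \<mu>) *\<^sub>R w0" for \<mu>
          by (simp add: W_def test_slopes_def vec_eq_iff w_def Q_def dbump_def emb_def mult.commute cong: if_cong)
        have yg: "y (gfield \<mu> n) = (if n = m then if \<mu> = 0 then d else 0 else 0)" for \<mu> n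
        proof -
          have "emb u (gfield \<mu> n) = 0" for u by (simp add: emb_def gfield_def split: option.splits)
          then show ?thesis by (auto simp: y_def test_fields_def w_def Q_def d_def dbump_def intro!: prod.cong)
        qed
        have A: "Afld y \<mu> u = (if \<mu> = 0 then d *\<^sub>R Tg m u else 0)" for \<mu> u
          unfolding Afld_def yg by (simp add: if_distrib[of "\<lambda>c. c *\<^sub>R _"] sum.delta cong: if_cong)
        have "PL P X y W = (\<Sum>\<mu>\<in>UNIV. if \<mu> = 0 then minkowski \<mu> * (((d / \<delta>) *\<^sub>R w0 + d *\<^sub>R Tg m v) \<bullet> ((d / \<delta>) *\<^sub>R S w0 + d *\<^sub>R Tg m (S v + b))) else 0)
           - dvpot P v (S v + b)"
          unfolding PL_def phy phW A Xeq dgen_affine[OF S]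
          by (intro arg_cong2[of _ _ _ _ "(-)"] sum.cong refl) (auto simp: Slin vSv len_def d_def)
        also have "\<dots> = ((d / \<delta>) *\<^sub>R w0 + d *\<^sub>R Tg m v) \<bullet> ((d / \<delta>) *\<^sub>R S w0 + d *\<^sub>R Tg m (S v + b)) - dvpot P v (S v + b)"
          by (simp add: sum.delta minkowski_def)
        also have "((d / \<delta>) *\<^sub>R w0 + d *\<^sub>R Tg m v) \<bullet> ((d / \<delta>) *\<^sub>R S w0 + d *\<^sub>R Tg m (S v + b)) =
            (1 / \<delta>) * d^2 * (w0 \<bullet> Tg m (S v + b) + Tg m v \<bullet> S w0) + d^2 * (Tg m v \<bullet> Tg m (S v + b))"
          by (simp add: inner_add_left inner_add_right vSv power2_eq_square algebra_simps)
        \<comment> \<open>The bump part of \<open>v\<close> drops out by skewness of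
          \<open>Tg m\<close>, so this coefficient is constant over the box.\<close>
        also have "w0 \<bullet> Tg m (S v + b) + Tg m v \<bullet> S w0 = \<kappa>"
          using Tg_skew[of m w0 "S w0"]
          by (simp add: v_def \<kappa>_def Slin Tg_linear inner_simps)
        finally show ?thesis
          by (simp add: y_def W_def R_def v_def d_def)
      qed
      moreover have "\<forall>f \<mu>. flat N (Q f \<mu>)" using qN by (simp add: Q_def)
      moreover have "\<forall>\<mu>. len \<mu> \<noteq> 0" using \<delta> by (simp add: len_def)
      ultimately have "I4 (\<lambda>x. (1 / \<delta>) * \<kappa> * dbump q 0 x ^ 2 + R x) = PL P X (emb c0) (\<lambda>_ _. 0)"
        using box_testD[OF N, of len Q "emb c0" w] by simp
      moreover have "I4 (\<lambda>x. (1 / \<delta>) * \<kappa> * dbump q 0 x ^ 2 + R x) = (1 / \<delta>) * \<kappa> * I4 (\<lambda>x. dbump q 0 x ^ 2) + I4 R"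
        by (intro I4_linear contR continuous_intros)
      ultimately show ?thesis by simp
    qed
    \<comment> \<open>Comparing the side lengths 1 and 1/2 isolates the term in
      \<open>1 / \<delta>\<close>.\<close>
    have "\<kappa> * I4 (\<lambda>x. dbump q 0 x ^ 2) = 0"
    proof -
      have "\<kappa> * I4 (\<lambda>x. dbump q 0 x ^ 2) + I4 R = PL P X (emb c0) (\<lambda>_ _. 0)"
        "2 * (\<kappa> * I4 (\<lambda>x. dbump q 0 x ^ 2)) + I4 R = PL P X (emb c0) (\<lambda>_ _. 0)"
        using eq[of 1] eq[of "1/2"] by (simp_all add: mult.assoc)
      then show ?thesis by linarith
    qed
    then show ?thesis using I4_positivity(3)[OF q(3,4), of 0] by (simp add: \<kappa>_def)
  qed
  have b0: "b = 0"
  proof -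
    have "w0 \<bullet> Tg None b = 0" for w0 using \<kappa>[of w0 None 0] by (simp add: Slin Tg_linear)
    then have "Tg None b = 0" by (metis inner_eq_zero_iff)
    then have "Jm b = 0" using g' Y by (simp add: Tg_def)
    then show ?thesis by (metis Jm_Jm linear_0[OF linear_Jm] neg_equal_0_iff_equal)
  qed
  have comm: "S (Tg m v) = Tg m (S v)" for m v
  proof -
    have "w0 \<bullet> S (Tg m v) = w0 \<bullet> Tg m (S v)" for w0
      using \<kappa>[of w0 m v] skew[of "Tg m v" w0] by (simp add: b0 inner_commute)
    then show ?thesis using vector_eq_ldot by blast
  qed
  have commJ: "S (Jm v) = Jm (S v)" for v
    using comm[of None v] g' Y by (simp add: Tg_def Slin)
  have commt: "S (tau a v) = tau a (S v)" for a v
    using comm[of "Some a" v] g by (simp add: Tg_def Slin)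
  obtain M where M: "dagger M = - M" "S = higgs_rotate M"
    using gauge_commutant[OF S skew commJ commt] by blast
  \<comment> \<open>For a bump of the scalars around the origin only the potential survives; its
    quadratic and quartic parts are weighted by the integrals of the second and fourth powers of the
    bump.\<close>
  have "2 * I4 (\<lambda>x. pbump q x ^ 2) * (mass_vec P \<bullet> bil v (S v)) +
      2 * I4 (\<lambda>x. pbump q x ^ 4) * (bil v (S v) \<bullet> (quartic_mat P *v bil v v)) = 0" for v
  proof -
    have PL0: "PL P X y W = - dvpot P (ph y) (S (ph y))" for y W
    proof -
      have A: "Afld y \<mu> (S u) = S (Afld y \<mu> u)" for \<mu> u
        by (simp add: Afld_def linear_sum[OF S] Slin comm)
      show ?thesis
        unfolding PL_def Xeq dgen_affine[OF S] by (simp add: b0 A vSv flip: Slin(1))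
    qed
    have "I4 (\<lambda>x. - dvpot P (pbump q x *\<^sub>R v) (pbump q x *\<^sub>R S v)) = - dvpot P 0 (S 0)"
    proof -
      have "ph (\<lambda>f. 0) = 0" by (simp add: vec_eq_iff)
      moreover have "ph (\<lambda>f. emb v f * c) = c *\<^sub>R v" for c by (simp add: vec_eq_iff emb_def)
      ultimately show ?thesis
        using box_testD[OF N, of "\<lambda>_. 1" "\<lambda>_ _. q" "\<lambda>_. 0" "emb v"] qN(1)
        by (simp add: PL0 Slin test_fields_def flip: pbump_def)
    qed
    moreover have "dvpot P 0 (S 0) = 0" using dvpot_scaleR[of P 0 0 0] by (simp add: Slin)
    moreover have "I4 (\<lambda>x. - dvpot P (pbump q x *\<^sub>R v) (pbump q x *\<^sub>R S v)) =
      - (2 * (mass_vec P \<bullet> bil v (S v))) * I4 (\<lambda>x. pbump q x ^ 2)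
      + - (2 * (bil v (S v) \<bullet> (quartic_mat P *v bil v v))) * I4 (\<lambda>x. pbump q x ^ 4)"
    proof -
      have "(\<lambda>x. - dvpot P (pbump q x *\<^sub>R v) (pbump q x *\<^sub>R S v)) =
        (\<lambda>x. - (2 * (mass_vec P \<bullet> bil v (S v))) * pbump q x ^ 2
           + - (2 * (bil v (S v) \<bullet> (quartic_mat P *v bil v v))) * pbump q x ^ 4)"
        by (simp add: dvpot_scaleR fun_eq_iff algebra_simps)
      then show ?thesis
        by (simp only:) (subst I4_linear I4_cmult, intro continuous_intros, intro continuous_intros,
          subst I4_cmult, intro continuous_intros, rule refl)
    qed
    ultimately show ?thesis by (simp add: algebra_simps)
  qed
  note * = this
  have "dvpot P v (S v) = 0" for v
    by (rule invariant_if_separately[OF S _ _ *]) (use I4_positivity(1,2)[OF q(3,4)] in simp_all)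
  then show "X \<in> flavour_symmetries P"
    using M by (auto simp: flavour_symmetries_def invariant_flow_def Xeq b0)
qed

lemma symmetry_algebras:
  "g_EL (Lag P) = flavour_symmetries P" "g_var (Lag P) = flavour_symmetries P" "g_svar (Lag P) = flavour_symmetries P"
  using g_EL_subset flavour_subset_EL g_var_subset flavour_subset_svar g_svar_subset_var
  by blast+

end

section \<open>The flavour algebra\<close>

text \<open>The entries are arranged so that the arguments become the coefficients of
  \<open>H1\<close>, \<open>H2\<close>, \<open>H3\<close>, \<open>X_Y\<close>; the trace is carried
  by \<open>d\<close> alone.\<close>

definition flow_mat :: "real \<Rightarrow> real \<Rightarrow> real \<Rightarrow> real \<Rightarrow> complex^2^2"
  where "flow_mat a b c d = vector [vector [Complex 0 (d - c), Complex b (- a)],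
                                       vector [Complex (- b) (- a), Complex 0 (d + c)]]"

definition flow :: "real \<Rightarrow> real \<Rightarrow> real \<Rightarrow> real \<Rightarrow> generator"
  where "flow a b c d = (\<lambda>y. higgs_rotate (flow_mat a b c d) (ph y))"

lemma flow_mat_nth [simp]:
  "flow_mat a b c d $ 1 $ 1 = Complex 0 (d - c)" "flow_mat a b c d $ 1 $ 2 = Complex b (- a)"
  "flow_mat a b c d $ 2 $ 1 = Complex (- b) (- a)" "flow_mat a b c d $ 2 $ 2 = Complex 0 (d + c)"
  by (simp_all add: flow_mat_def)

lemma flow_eq: "flow a b c d = a *\<^sub>R H1 + b *\<^sub>R H2 + c *\<^sub>R H3 + d *\<^sub>R X_Y"
  by (rule ext) (simp add: flow_def higgs_eq H1_def H2_def H3_def X_Y_def scaleR_fun_def vec_eq_iff forall_8 algebra_simps)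

lemma flow_mat_antihermitian: "dagger (flow_mat a b c d) = - flow_mat a b c d"
  by (simp add: dagger_def vec_eq_iff forall_2 complex_eq_iff)

lemma antihermitian_flow_mat:
  assumes "dagger M = - M"
  obtains a b c d where "M = flow_mat a b c d"
proof
  show "M = flow_mat (- Im (M$1$2)) (Re (M$1$2)) ((Im (M$2$2) - Im (M$1$1)) / 2) ((Im (M$2$2) + Im (M$1$1)) / 2)"
    using antihermitian_entries[OF assms] by (simp add: vec_eq_iff forall_2 complex_eq_iff field_simps)
qed

text \<open>\<open>dvpot\<close> along the flow, as a polynomial in the four bilinears. Hypercharge
  fixes the bilinears, hence the absence of \<open>d\<close>.\<close>

definition pot_variation :: "potential_params \<Rightarrow> real \<Rightarrow> real \<Rightarrow> real \<Rightarrow> real \<Rightarrow> real \<Rightarrow> real \<Rightarrow> real \<Rightarrow> real"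
  where "pot_variation P a b c p q s t =
    2 * (b * s + a * t) *
      ((m11sq P + lam1 P * p + lam3 P * q + 2 * Re (lam6 P) * s - 2 * Im (lam6 P) * t)
       - (m22sq P + lam3 P * p + lam2 P * q + 2 * Re (lam7 P) * s - 2 * Im (lam7 P) * t))
    + (b * (q - p) - 2 * c * t) * (- 2 * Re (m12sq P) + 2 * Re (lam6 P) * p + 2 * Re (lam7 P) * q
       + 2 * (lam4 P + Re (lam5 P)) * s - 2 * Im (lam5 P) * t)
    + (a * (q - p) + 2 * c * s) * (2 * Im (m12sq P) - 2 * Im (lam6 P) * p - 2 * Im (lam7 P) * q
       - 2 * Im (lam5 P) * s + 2 * (lam4 P - Re (lam5 P)) * t)"

lemma bil_flow:
  "bil v (higgs_rotate (flow_mat a b c d) v) = (1/2) *\<^sub>R vector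
    [2 * (b * bil v v $ 3 + a * bil v v $ 4), - 2 * (b * bil v v $ 3 + a * bil v v $ 4),
     b * (bil v v $ 2 - bil v v $ 1) - 2 * c * bil v v $ 4, a * (bil v v $ 2 - bil v v $ 1) + 2 * c * bil v v $ 3]"
  by (simp add: bil_def higgs_eq vec_eq_iff forall_4' field_simps)

lemma dvpot_flow:
  "dvpot P v (higgs_rotate (flow_mat a b c d) v) =
    pot_variation P a b c (bil v v $ 1) (bil v v $ 2) (bil v v $ 3) (bil v v $ 4)"
  unfolding dvpot_def bil_flow pot_variation_def mass_vec_def quartic_mat_def
  by (simp add: inner_4 matrix_vector_mult_def sum_4 algebra_simps)

definition pot_invariant :: "potential_params \<Rightarrow> real \<Rightarrow> real \<Rightarrow> real \<Rightarrow> bool"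
  where "pot_invariant P a b c \<longleftrightarrow> (\<forall>v. dvpot P v (higgs_rotate (flow_mat a b c 0) v) = 0)"

lemma pot_invariantI: "(\<And>p q s t. pot_variation P a b c p q s t = 0) \<Longrightarrow> pot_invariant P a b c"
  by (simp add: pot_invariant_def dvpot_flow)

text \<open>The bilinears of a pair of doublets obey the Cauchy-Schwarz inequality, so they are
  sampled in a fixed gauge: the first doublet has one real entry \<open>x\<close>, and
  \<open>w\<close> measures how strict the inequality is.\<close>

lemma pot_invariantD:
  assumes "pot_invariant P a b c"
  shows "pot_variation P a b c (x\<^sup>2) (u\<^sup>2 + v\<^sup>2 + w\<^sup>2) (x * u) (x * v) = 0"
proof -
  define f :: "real^8" where "f = sqrt 2 *\<^sub>R vector [x, 0, 0, 0, u, v, w, 0]"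
  have "bil f f $ 1 = x\<^sup>2" "bil f f $ 2 = u\<^sup>2 + v\<^sup>2 + w\<^sup>2" "bil f f $ 3 = x * u" "bil f f $ 4 = x * v"
    by (simp_all add: bil_def f_def power2_eq_square algebra_simps)
  then show ?thesis using assms unfolding pot_invariant_def dvpot_flow by metis
qed

lemma flavour_symmetries_eq: "flavour_symmetries P = {flow a b c d | a b c d. pot_invariant P a b c}"
proof -
  have "invariant_flow P (flow_mat a b c d) \<longleftrightarrow> pot_invariant P a b c" for a b c d
    by (simp add: invariant_flow_def pot_invariant_def flow_mat_antihermitian dvpot_flow)
  moreover have "\<exists>a b c d. M = flow_mat a b c d" if "invariant_flow P M" for M
    using that antihermitian_flow_mat unfolding invariant_flow_def by metis
  ultimately show ?thesis
    unfolding flavour_symmetries_def flow_def by blast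
qed

lemma span_generators:
  "span {X_Y} = {flow 0 0 0 d | d. True}"
  "span {H3, X_Y} = {flow 0 0 c d | c d. True}"
  "span {H1, H2, H3, X_Y} = {flow a b c d | a b c d. True}"
proof -
  show 1: "span {X_Y} = {flow 0 0 0 d | d. True}"
    by (auto simp: span_singleton flow_eq)
  have "X \<in> span {H3, X_Y} \<longleftrightarrow> (\<exists>c d. X = flow 0 0 c d)" for X
  proof -
    have "X \<in> span {H3, X_Y} \<longleftrightarrow> (\<exists>c d. X - c *\<^sub>R H3 = d *\<^sub>R X_Y)"
      by (subst span_insert) (auto simp: span_singleton)
    then show ?thesis by (simp add: flow_eq diff_eq_eq add.commute)
  qed
  then show 2: "span {H3, X_Y} = {flow 0 0 c d | c d. True}" by auto
  have "X \<in> span {H1, H2, H3, X_Y} \<longleftrightarrow> (\<exists>a b c d. X = flow a b c d)" for X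
  proof -
    have "X \<in> span {H1, H2, H3, X_Y} \<longleftrightarrow> (\<exists>a b. X - a *\<^sub>R H1 - b *\<^sub>R H2 \<in> span {H3, X_Y})"
      by (subst span_insert, subst span_insert) auto
    also have "\<dots> \<longleftrightarrow> (\<exists>a b c d. X - a *\<^sub>R H1 - b *\<^sub>R H2 = c *\<^sub>R H3 + d *\<^sub>R X_Y)"
      unfolding 2 by (auto simp: flow_eq)
    finally show ?thesis by (simp add: flow_eq diff_eq_eq add_ac)
  qed
  then show "span {H1, H2, H3, X_Y} = {flow a b c d | a b c d. True}" by (simp add: set_eq_iff)
qed

lemma H3_invariant_params:
  assumes "pot_invariant P 0 0 1"
  shows "m12sq P = 0" "lam5 P = 0" "lam6 P = 0" "lam7 P = 0"
proof -
  have e: "Re (m12sq P) * (x * v) + Im (m12sq P) * (x * u)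
      - (Re (lam6 P) * x\<^sup>2 + Re (lam7 P) * (u\<^sup>2 + v\<^sup>2 + w\<^sup>2)) * (x * v)
      - (Im (lam6 P) * x\<^sup>2 + Im (lam7 P) * (u\<^sup>2 + v\<^sup>2 + w\<^sup>2)) * (x * u)
      - 2 * Re (lam5 P) * (x * u) * (x * v) + Im (lam5 P) * ((x * v)\<^sup>2 - (x * u)\<^sup>2) = 0" (is "?e = 0") for x u v w
  proof -
    have "4 * ?e = pot_variation P 0 0 1 (x\<^sup>2) (u\<^sup>2 + v\<^sup>2 + w\<^sup>2) (x * u) (x * v)"
      by (simp add: pot_variation_def power2_eq_square algebra_simps)
    then show ?thesis using pot_invariantD[OF assms] by simp
  qed
  \<comment> \<open>Changing \<open>w\<close> isolates \<open>lam7\<close>, the signs of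
    \<open>u\<close> and \<open>v\<close> isolate the imaginary part of \<open>lam5\<close>,
    \<open>x = 2\<close> tells \<open>lam6\<close> from the mass term, and the points with both
    \<open>u\<close> and \<open>v\<close> give the real part of \<open>lam5\<close>.\<close>
  note eqs = e[of 1 1 0 0, simplified] e[of 1 1 0 1, simplified] e[of 1 0 1 0, simplified] e[of 1 0 1 1, simplified]
    e[of 1 "-1" 0 0, simplified] e[of 1 0 "-1" 0, simplified] e[of 2 1 0 0, simplified] e[of 2 0 1 0, simplified]
    e[of 1 1 1 0, simplified] e[of 1 1 "-1" 0, simplified]
  have "Re (lam7 P) = 0" "Im (lam7 P) = 0" "Re (lam6 P) = 0" "Im (lam6 P) = 0" "Re (m12sq P) = 0" "Im (m12sq P) = 0"
    "Re (lam5 P) = 0" "Im (lam5 P) = 0"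
    using eqs by linarith+
  then show "m12sq P = 0" "lam5 P = 0" "lam6 P = 0" "lam7 P = 0"
    by (simp_all add: complex_eq_iff)
qed

lemma pot_variation_H3_invariant:
  assumes "pot_invariant P 0 0 1"
  shows "pot_variation P a b c p q s t = 2 * (b * s + a * t) *
    (m11sq P - m22sq P + (lam1 P - lam3 P - lam4 P) * p - (lam2 P - lam3 P - lam4 P) * q)"
  by (simp add: pot_variation_def H3_invariant_params[OF assms] algebra_simps)

text \<open>Once \<open>H3\<close> is preserved, every variation is a linear form in
  \<open>s\<close>, \<open>t\<close> times one affine function of \<open>p\<close>, \<open>q\<close>
  common to all directions. At \<open>u = b\<close>, \<open>v = a\<close> the linear form is
  nonzero, so the affine function vanishes, and all variations with it.\<close>

lemma H3_and_other_invariant: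
  assumes inv: "pot_invariant P 0 0 1" "pot_invariant P a b c" and ab: "a \<noteq> 0 \<or> b \<noteq> 0"
  shows "pot_invariant P a' b' c'"
proof -
  define n where "n = a\<^sup>2 + b\<^sup>2"
  have n: "n > 0" using ab by (simp add: n_def sum_power2_gt_zero_iff)
  have *: "m11sq P - m22sq P + (lam1 P - lam3 P - lam4 P) * x\<^sup>2 - (lam2 P - lam3 P - lam4 P) * (n + w\<^sup>2) = 0"
    if "x \<noteq> 0" for x w
  proof -
    have "b * (x * b) + a * (x * a) = x * n" "b\<^sup>2 + a\<^sup>2 + w\<^sup>2 = n + w\<^sup>2"
      by (simp_all add: n_def power2_eq_square algebra_simps)
    then show ?thesis
      using pot_invariantD[OF inv(2), of x b a w] that n
      unfolding pot_variation_H3_invariant[OF inv(1)] by simp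
  qed
  have "lam1 P - lam3 P - lam4 P = 0" using *[of 1 0] *[of 2 0] by simp
  moreover have "lam2 P - lam3 P - lam4 P = 0" using *[of 1 0] *[of 1 1] by (simp add: algebra_simps)
  ultimately have "m11sq P - m22sq P = 0" using *[of 1 0] by simp
  with \<open>lam1 P - lam3 P - lam4 P = 0\<close> \<open>lam2 P - lam3 P - lam4 P = 0\<close>
  show ?thesis
    by (intro pot_invariantI) (simp only: pot_variation_H3_invariant[OF inv(1)], simp)
qed

lemma pot_variation_scale: "pot_variation P (r * a) (r * b) (r * c) p q s t = r * pot_variation P a b c p q s t"
  by (simp add: pot_variation_def algebra_simps)

lemma pot_invariant_scale: "pot_invariant P a b c \<Longrightarrow> pot_invariant P (r * a) (r * b) (r * c)"
  by (simp add: pot_invariant_def dvpot_flow pot_variation_scale)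

text \<open>By the preceding dichotomy no algebra lies strictly between the two, so one direction
  that fails to be invariant decides.\<close>

lemma flavour_symmetries_H3:
  assumes "pot_invariant P 0 0 1"
  shows "flavour_symmetries P \<in> {span {H1, H2, H3, X_Y}, span {H3, X_Y}}"
    "\<not> pot_invariant P a b c \<Longrightarrow> flavour_symmetries P = span {H3, X_Y}"
proof -
  have H3: "pot_invariant P 0 0 c" for c
    using pot_invariant_scale[OF assms, of c] by simp
  have **: "flavour_symmetries P = span {H3, X_Y}" if "\<not> pot_invariant P a b c" for a b c
  proof -
    have "pot_invariant P a' b' c' \<longleftrightarrow> a' = 0 \<and> b' = 0" for a' b' c'
      using H3_and_other_invariant[OF assms, of a' b' c' a b c] that H3 by auto
    then show ?thesis unfolding flavour_symmetries_eq span_generators by auto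
  qed
  then show "\<not> pot_invariant P a b c \<Longrightarrow> flavour_symmetries P = span {H3, X_Y}" .
  show "flavour_symmetries P \<in> {span {H1, H2, H3, X_Y}, span {H3, X_Y}}"
  proof (cases "\<forall>a b c. pot_invariant P a b c")
    case True
    then show ?thesis unfolding flavour_symmetries_eq span_generators by auto
  next
    case False
    then show ?thesis using ** by blast
  qed
qed

lemma flavour_symmetries_all:
  "(\<And>a b c. pot_invariant P a b c) \<Longrightarrow> flavour_symmetries P = span {H1, H2, H3, X_Y}"
  unfolding flavour_symmetries_eq span_generators by auto

lemma flavour_symmetries_none:
  assumes "\<And>a b c. pot_invariant P a b c \<Longrightarrow> a = 0 \<and> b = 0 \<and> c = 0"
  shows "flavour_symmetries P = span {X_Y}"
proof -
  have "pot_invariant P 0 0 0" by (rule pot_invariantI) (simp add: pot_variation_def)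
  then have "pot_invariant P a b c \<longleftrightarrow> a = 0 \<and> b = 0 \<and> c = 0" for a b c using assms by blast
  then show ?thesis unfolding flavour_symmetries_eq span_generators by auto
qed

section \<open>Parameters realising the three algebras\<close>

definition zero_potential :: potential_params
  where "zero_potential = \<lparr>m11sq = 0, m22sq = 0, m12sq = 0, lam1 = 0, lam2 = 0, lam3 = 0, lam4 = 0,
    lam5 = 0, lam6 = 0, lam7 = 0\<rparr>"

text \<open>The zero potential keeps all flavour rotations, unequal masses leave the relative phase
  rotation, and \<open>lam5\<close> breaks that one as well.\<close>

lemma flavour_symmetries_examples:
  "flavour_symmetries zero_potential = span {H1, H2, H3, X_Y}"
  "flavour_symmetries (zero_potential\<lparr>m11sq := 1\<rparr>) = span {H3, X_Y}"
  "flavour_symmetries (zero_potential\<lparr>m11sq := 1, lam5 := 1\<rparr>) = span {X_Y}"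
proof -
  show "flavour_symmetries zero_potential = span {H1, H2, H3, X_Y}"
    by (rule flavour_symmetries_all, rule pot_invariantI) (simp add: pot_variation_def zero_potential_def)
  show "flavour_symmetries (zero_potential\<lparr>m11sq := 1\<rparr>) = span {H3, X_Y}"
  proof (rule flavour_symmetries_H3(2))
    show "pot_invariant (zero_potential\<lparr>m11sq := 1\<rparr>) 0 0 1"
      by (rule pot_invariantI) (simp add: pot_variation_def zero_potential_def)
    show "\<not> pot_invariant (zero_potential\<lparr>m11sq := 1\<rparr>) 1 0 0"
      using pot_invariantD[of "zero_potential\<lparr>m11sq := 1\<rparr>" 1 0 0 1 0 1 0]
      by (auto simp: pot_variation_def zero_potential_def)
  qed
  show "flavour_symmetries (zero_potential\<lparr>m11sq := 1, lam5 := 1\<rparr>) = span {X_Y}"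
  proof (rule flavour_symmetries_none)
    fix a b c assume "pot_invariant (zero_potential\<lparr>m11sq := 1, lam5 := 1\<rparr>) a b c"
    note e = pot_invariantD[OF this, unfolded pot_variation_def]
    show "a = 0 \<and> b = 0 \<and> c = 0"
      using e[of 1 1 0 0] e[of 1 0 1 0] e[of 1 1 1 0] by (simp add: zero_potential_def)
  qed
qed

section \<open>Change of Higgs basis\<close>

lemma higgs_rotate_mult: "higgs_rotate (A ** B) v = higgs_rotate A (higgs_rotate B v)"
  by (simp add: higgs_eq vec_eq_iff forall_8 matrix_matrix_mult_def sum_2 algebra_simps)

lemma higgs_rotate_1 [simp]: "higgs_rotate (mat 1) v = v"
  by (simp add: higgs_eq vec_eq_iff forall_8 mat_def)

lemma unitary_inner:
  assumes "unitary2 U"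
  shows "higgs_rotate U v \<bullet> higgs_rotate U v = v \<bullet> v"
proof -
  have adj: "higgs_rotate U v \<bullet> w = v \<bullet> higgs_rotate (dagger U) w" for v w
    by (simp add: higgs_eq inner_8 dagger_def algebra_simps)
  show ?thesis
    using assms by (simp add: adj unitary2_def flip: higgs_rotate_mult)
qed

lemma scalars_rotate_jet: "scalars (rotate_jet U z) J = higgs_rotate U (scalars z J)"
  by (simp add: vec_eq_iff scalars_def rotate_jet_def)

lemma ph_rotate_fields: "ph (rotate_fields U y) = higgs_rotate U (ph y)"
  by (simp add: vec_eq_iff rotate_fields_def ph_def)

lemma rotate_fields_mult: "rotate_fields A (rotate_fields B y) = rotate_fields (A ** B) y"
proof
  fix f show "rotate_fields A (rotate_fields B y) f = rotate_fields (A ** B) y f"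
    by (cases f) (simp_all add: rotate_fields_def higgs_rotate_mult)
qed

lemma rotate_fields_1 [simp]: "rotate_fields (mat 1) y = y"
proof
  fix f show "rotate_fields (mat 1) y f = y f"
    by (cases f) (simp_all add: rotate_fields_def)
qed

lemma rotate_jet_1 [simp]: "rotate_jet (mat 1) z = z"
proof
  fix c show "rotate_jet (mat 1) z c = z c"
    by (auto simp: rotate_jet_def split: coord.splits dep_var.splits)
qed

lemma dagger_mult: "dagger (A ** B) = dagger B ** dagger A"
  by (simp add: dagger_def vec_eq_iff forall_2 matrix_matrix_mult_def sum_2 algebra_simps)

lemma dagger_dagger [simp]: "dagger (dagger A) = A"
  by (simp add: dagger_def vec_eq_iff)

text \<open>The action on the bilinears induced by \<open>A\<close>: each row expands one Hermitian
  product of the rotated doublets, and the factors 2 in the first two rows come from pairs of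
  conjugate cross terms.\<close>

definition bil_matrix :: "complex^2^2 \<Rightarrow> real^4^4"
  where "bil_matrix A = (let \<alpha> = A$1$1; \<beta> = A$1$2; \<gamma> = A$2$1; \<delta> = A$2$2 in vector
    [vector [Re (cnj \<alpha> * \<alpha>), Re (cnj \<beta> * \<beta>), 2 * Re (cnj \<alpha> * \<beta>), - 2 * Im (cnj \<alpha> * \<beta>)],
     vector [Re (cnj \<gamma> * \<gamma>), Re (cnj \<delta> * \<delta>), 2 * Re (cnj \<gamma> * \<delta>), - 2 * Im (cnj \<gamma> * \<delta>)],
     vector [Re (cnj \<alpha> * \<gamma>), Re (cnj \<beta> * \<delta>), Re (cnj \<alpha> * \<delta>) + Re (cnj \<beta> * \<gamma>), Im (cnj \<beta> * \<gamma>) - Im (cnj \<alpha> * \<delta>)],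
     vector [Im (cnj \<alpha> * \<gamma>), Im (cnj \<beta> * \<delta>), Im (cnj \<alpha> * \<delta>) + Im (cnj \<beta> * \<gamma>), Re (cnj \<alpha> * \<delta>) - Re (cnj \<beta> * \<gamma>)]])"

lemma bil_higgs_rotate: "bil (higgs_rotate A v) (higgs_rotate A v) = bil_matrix A *v bil v v"
proof -
  have "bil (higgs_rotate A v) (higgs_rotate A v) $ k = (bil_matrix A *v bil v v) $ k" for k
    using exhaust_4[of k]
    by (elim disjE) (simp_all add: bil_matrix_def Let_def matrix_vector_mult_def sum_4 bil_def higgs_eq field_simps)
  then show ?thesis by (simp add: vec_eq_iff)
qed

text \<open>The 14 real parameters of the potential amount to a vector and a symmetric matrix in
  dimension four, with 4 + 10 entries. Hence the general potential is closed under changes of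
  basis.\<close>

lemma potential_params_surj:
  fixes m :: "real^4" and E :: "real^4^4"
  assumes "transpose E = E"
  shows "\<exists>P. mass_vec P = m \<and> quartic_mat P = E"
proof -
  have s: "E$i$j = E$j$i" for i j
    using arg_cong[OF assms, of "\<lambda>A. A$i$j"] by (simp add: transpose_def)
  define P where "P = \<lparr>m11sq = m$1, m22sq = m$2, m12sq = Complex (- m$3 / 2) (m$4 / 2),
    lam1 = E$1$1, lam2 = E$2$2, lam3 = E$1$2, lam4 = (E$3$3 + E$4$4) / 4,
    lam5 = Complex ((E$3$3 - E$4$4) / 4) (- E$3$4 / 2), lam6 = Complex (E$1$3 / 2) (- E$1$4 / 2),
    lam7 = Complex (E$2$3 / 2) (- E$2$4 / 2)\<rparr>"
  have "mass_vec P = m" "quartic_mat P = E"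
    by (simp_all add: P_def mass_vec_def quartic_mat_def vec_eq_iff forall_4' field_simps
        s[of 2 1] s[of 3 1] s[of 3 2] s[of 4 1] s[of 4 2] s[of 4 3] s[of 0 1] s[of 0 2] s[of 0 3])
  then show ?thesis by blast
qed

lemma rotated_potential_exists: "\<exists>P'. \<forall>v. vpot P' v = vpot P (higgs_rotate A v)"
proof -
  let ?L = "bil_matrix A" and ?Q = "quartic_mat P"
  have Q: "transpose ?Q = ?Q"
    by (simp add: quartic_mat_def transpose_def vec_eq_iff forall_4')
  have "transpose (transpose ?L ** ?Q ** ?L) = transpose ?L ** ?Q ** ?L"
    by (simp add: matrix_transpose_mul Q matrix_mul_assoc)
  then obtain P' where P': "mass_vec P' = transpose ?L *v mass_vec P" "quartic_mat P' = transpose ?L ** ?Q ** ?L"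
    using potential_params_surj by blast
  have "vpot P' v = vpot P (higgs_rotate A v)" for v
  proof -
    have "u \<bullet> (transpose ?L *v w) = (?L *v u) \<bullet> w" for u w
      by (metis dot_lmul_matrix inner_commute transpose_matrix_vector)
    then show ?thesis
      unfolding vpot_def P' bil_higgs_rotate
      by (simp add: matrix_vector_mul_assoc[symmetric] inner_commute[of _ "bil v v"])
        (simp add: inner_commute)
  qed
  then show ?thesis by blast
qed

lemma dvpot_rotated:
  assumes "\<And>v. vpot P' (higgs_rotate U v) = vpot P v"
  shows "dvpot P' (higgs_rotate U v) (higgs_rotate U w) = dvpot P v w"
proof -
  have eq: "vpot P' (higgs_rotate U v + t *\<^sub>R higgs_rotate U w) = vpot P (v + t *\<^sub>R w)" for t
    using assms[of "v + t *\<^sub>R w"] by (simp add: linear_add[OF linear_higgs] linear_cmul[OF linear_higgs])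
  show ?thesis
    using vpot_line[of P' "higgs_rotate U v" "higgs_rotate U w"] vpot_line[of P v w]
    unfolding eq by (rule DERIV_unique)
qed

lemma invariant_flow_rotated:
  assumes U: "unitary2 U" and pot: "\<And>v. vpot P' (higgs_rotate U v) = vpot P v" and M: "invariant_flow P M"
  shows "invariant_flow P' (U ** M ** dagger U)"
  unfolding invariant_flow_def
proof
  have dM: "dagger M = - M" using M by (simp add: invariant_flow_def)
  have "A ** (- B) = - (A ** B)" "(- A) ** B = - (A ** B)" for A B :: "complex^2^2"
    by (simp_all add: matrix_matrix_mult_def vec_eq_iff sum_negf)
  then show "dagger (U ** M ** dagger U) = - (U ** M ** dagger U)"
    by (simp add: dagger_mult dM matrix_mul_assoc)
  show "\<forall>v. dvpot P' v (higgs_rotate (U ** M ** dagger U) v) = 0"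
  proof
    fix v
    have v: "higgs_rotate U (higgs_rotate (dagger U) v) = v"
      using U by (simp add: unitary2_def flip: higgs_rotate_mult)
    have "dvpot P' (higgs_rotate U (higgs_rotate (dagger U) v)) (higgs_rotate U (higgs_rotate M (higgs_rotate (dagger U) v))) = 0"
      using M by (simp add: dvpot_rotated[OF pot] invariant_flow_def)
    then show "dvpot P' v (higgs_rotate (U ** M ** dagger U) v) = 0"
      by (simp add: v higgs_rotate_mult)
  qed
qed

lemma in_new_basis_flavour_symmetries:
  assumes U: "unitary2 U" and pot: "\<And>v. vpot P' (higgs_rotate U v) = vpot P v"
  shows "in_new_basis U (flavour_symmetries P) = flavour_symmetries P'"
proof (intro set_eqI iffI)
  have UU: "dagger U ** U = mat 1" "U ** dagger U = mat 1" using U by (simp_all add: unitary2_def)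
  fix X'
  {
    assume "X' \<in> in_new_basis U (flavour_symmetries P)"
    then obtain M where M: "invariant_flow P M"
      and X': "\<And>y. X' (rotate_fields U y) = higgs_rotate U (higgs_rotate M (ph y))"
      unfolding in_new_basis_def flavour_symmetries_def by auto
    have "X' y = higgs_rotate (U ** M ** dagger U) (ph y)" for y
      using X'[of "rotate_fields (dagger U) y"]
      by (simp add: rotate_fields_mult UU ph_rotate_fields higgs_rotate_mult)
    then show "X' \<in> flavour_symmetries P'"
      using invariant_flow_rotated[OF U pot M] unfolding flavour_symmetries_def by blast
  }
  {
    assume "X' \<in> flavour_symmetries P'"
    then obtain M' where M': "invariant_flow P' M'" and X': "X' = (\<lambda>y. higgs_rotate M' (ph y))"
      unfolding flavour_symmetries_def by auto
    have U': "unitary2 (dagger U)" using UU by (simp add: unitary2_def)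
    have pot': "vpot P (higgs_rotate (dagger U) v) = vpot P' v" for v
      using pot[of "higgs_rotate (dagger U) v"] by (simp add: UU flip: higgs_rotate_mult)
    let ?M = "dagger U ** M' ** U"
    have M: "invariant_flow P ?M" using invariant_flow_rotated[OF U' pot' M'] by simp
    have "higgs_rotate U (higgs_rotate ?M v) = higgs_rotate M' (higgs_rotate U v)" for v
    proof -
      have "U ** ?M = M' ** U" by (metis UU(2) matrix_mul_assoc matrix_mul_lid)
      then show ?thesis by (metis higgs_rotate_mult)
    qed
    then have eq: "\<forall>y. X' (rotate_fields U y) = higgs_rotate U (higgs_rotate ?M (ph y))"
      by (simp add: X' ph_rotate_fields)
    have mem: "(\<lambda>y. higgs_rotate ?M (ph y)) \<in> flavour_symmetries P"
      using M by (auto simp: flavour_symmetries_def)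
    show "X' \<in> in_new_basis U (flavour_symmetries P)"
      unfolding in_new_basis_def by (rule CollectI, rule bexI[OF _ mem], rule eq)
  }
qed

lemma in_new_basis_1: "in_new_basis (mat 1) G = G"
proof -
  have "(\<forall>y. X' y = X y) \<longleftrightarrow> X' = X" for X X' :: generator by auto
  then show ?thesis by (simp add: in_new_basis_def)
qed

lemma unitary2_1: "unitary2 (mat 1)"
proof -
  have "dagger (mat 1) = mat 1" by (simp add: dagger_def mat_def vec_eq_iff forall_2)
  then show ?thesis by (simp add: unitary2_def)
qed

text \<open>The rows of the diagonalizing matrix are the eigenvectors of \<open>i\<close> times the flow matrix
  for the eigenvalues \<open>r\<close> and \<open>-r\<close>.\<close>

lemma diagonalize_flow_mat:
  assumes "a \<noteq> 0 \<or> b \<noteq> 0 \<or> c \<noteq> 0"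
  shows "\<exists>U r. unitary2 U \<and> r \<noteq> 0 \<and> U ** flow_mat a b c 0 ** dagger U = flow_mat 0 0 r 0"
proof (cases "a = 0 \<and> b = 0")
  case True
  have "dagger (mat 1) = mat 1" by (simp add: dagger_def mat_def vec_eq_iff forall_2)
  then show ?thesis using True assms unitary2_1 by (intro exI[of _ "mat 1"] exI[of _ c]) auto
next
  case False
  define r where "r = sqrt (a\<^sup>2 + b\<^sup>2 + c\<^sup>2)"
  have r2: "r\<^sup>2 = a\<^sup>2 + b\<^sup>2 + c\<^sup>2" by (simp add: r_def)
  \<comment> \<open>Squared norm of each row of \<open>U\<close> before normalisation. It is
    positive because \<open>a\<close> and \<open>b\<close> are not both 0; for a diagonal matrix it
    could vanish, which is why that case is treated apart.\<close>
  define D where "D = a\<^sup>2 + b\<^sup>2 + (r - c)\<^sup>2"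
  have ab: "a\<^sup>2 + b\<^sup>2 > 0" using False by (simp add: sum_power2_gt_zero_iff)
  then have D: "D > 0" by (simp add: D_def add_pos_nonneg)
  have r0: "r \<noteq> 0" using ab r2 by (metis add_pos_nonneg less_irrefl power_zero_numeral zero_le_power2)
  define h where "h = 1 / sqrt D"
  have hD: "h * h * (a * a + b * b + (r - c) * (r - c)) = 1"
  proof -
    have "h * h * D = 1" using D by (simp add: h_def)
    then show ?thesis by (simp add: D_def power2_eq_square)
  qed
  define U :: "complex^2^2" where "U = vector
    [vector [Complex (h * a) (- h * b), Complex (h * (r - c)) 0],
     vector [Complex (- h * (r - c)) 0, Complex (h * a) (h * b)]]"
  have Un: "U$1$1 = Complex (h * a) (- h * b)" "U$1$2 = Complex (h * (r - c)) 0"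
    "U$2$1 = Complex (- h * (r - c)) 0" "U$2$2 = Complex (h * a) (h * b)"
    by (simp_all add: U_def)
  have UU: "dagger U ** U = mat 1" "U ** dagger U = mat 1"
    using hD
    by (simp_all add: vec_eq_iff forall_2 matrix_matrix_mult_def sum_2 dagger_def Un mat_def complex_eq_iff algebra_simps)
  have "U ** flow_mat a b c 0 = flow_mat 0 0 r 0 ** U"
  proof -
    have "h * (r * r) = h * (a * a + b * b + c * c)" using r2 by (simp add: power2_eq_square)
    then show ?thesis
      by (simp add: vec_eq_iff forall_2 matrix_matrix_mult_def sum_2 Un complex_eq_iff algebra_simps)
  qed
  then have "U ** flow_mat a b c 0 ** dagger U = flow_mat 0 0 r 0"
    by (metis UU(2) matrix_mul_assoc matrix_mul_rid)
  then show ?thesis using UU r0 unfolding unitary2_def by blast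
qed

context couplings begin

lemma higgs_basis_changeI:
  assumes U: "unitary2 U" and pot: "\<And>v. vpot P' (higgs_rotate U v) = vpot P v"
  shows "higgs_basis_change g g' Y U P P'"
proof -
  have "Lag P' (rotate_jet U z) = Lag P z" for z
  proof -
    have gz: "rotate_jet U z (Dep (gfield \<mu> m) J) = z (Dep (gfield \<mu> m) J)" for \<mu> m J
      by (simp add: rotate_jet_def gfield_def split: option.splits)
    then have "Lgauge (rotate_jet U z) = Lgauge z"
      by (intro Lgauge_cong) (simp add: gauge_agree_def)
    moreover have "Kcov \<mu> (rotate_jet U z) = higgs_rotate U (Kcov \<mu> z)" for \<mu>
      by (simp add: Kcov_def gz scalars_rotate_jet linear_add[OF linear_higgs]
          linear_sum[OF linear_higgs] linear_cmul[OF linear_higgs] higgs_rotate_Tg)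
    ultimately show ?thesis
      by (simp add: lagrangian_eq scalars_rotate_jet pot unitary_inner[OF U])
  qed
  then show ?thesis using U by (simp add: higgs_basis_change_def)
qed

lemma flavour_classification:
  "\<exists>U P'. higgs_basis_change g g' Y U P P' \<and>
    in_new_basis U (flavour_symmetries P) \<in> {span {H1, H2, H3, X_Y}, span {H3, X_Y}, span {X_Y}}"
proof (cases "\<forall>a b c. pot_invariant P a b c \<longrightarrow> a = 0 \<and> b = 0 \<and> c = 0")
  case True
  then have "flavour_symmetries P = span {X_Y}" by (intro flavour_symmetries_none) blast
  moreover have "higgs_basis_change g g' Y (mat 1) P P"
    by (rule higgs_basis_changeI[OF unitary2_1]) simp
  ultimately show ?thesis
    by (intro exI[of _ "mat 1"] exI[of _ P]) (simp add: in_new_basis_1)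
next
  case False
  then obtain a b c where inv: "pot_invariant P a b c" and "a \<noteq> 0 \<or> b \<noteq> 0 \<or> c \<noteq> 0" by blast
  then obtain U r where U: "unitary2 U" "r \<noteq> 0" "U ** flow_mat a b c 0 ** dagger U = flow_mat 0 0 r 0"
    using diagonalize_flow_mat by blast
  obtain P' where P': "\<And>v. vpot P' v = vpot P (higgs_rotate (dagger U) v)"
    using rotated_potential_exists by blast
  have pot: "vpot P' (higgs_rotate U v) = vpot P v" for v
    using U(1) by (simp add: P' unitary2_def flip: higgs_rotate_mult)
  have "invariant_flow P (flow_mat a b c 0)"
    using inv by (simp add: invariant_flow_def pot_invariant_def flow_mat_antihermitian)
  from invariant_flow_rotated[OF U(1) pot this] have "pot_invariant P' 0 0 r"
    unfolding U(3) by (simp add: invariant_flow_def pot_invariant_def)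
  from pot_invariant_scale[OF this, of "1 / r"] have "pot_invariant P' 0 0 1" using U(2) by simp
  from flavour_symmetries_H3(1)[OF this] show ?thesis
    using higgs_basis_changeI[OF U(1) pot] in_new_basis_flavour_symmetries[OF U(1) pot]
    by (intro exI[of _ U] exI[of _ P']) auto
qed

end

section \<open>The Lie algebras\<close>

text \<open>Linear vector fields bracket to minus the commutator of their matrices, the source of
  the signs in the isomorphism with su(2).\<close>

lemma lie_bracket_linear:
  assumes "linear A" "linear B"
  shows "lie_bracket (\<lambda>y. A (ph y)) (\<lambda>y. B (ph y)) = (\<lambda>y. B (A (ph y)) - A (B (ph y)))"
proof -
  have *: "(\<Sum>j\<in>UNIV. v $ j * pd (Phi j) (\<lambda>y. C (ph y) $ i) y) = C v $ i" if "linear C" for C :: "real^8 \<Rightarrow> real^8" and v i y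
  proof -
    have "C v $ i = dgen (\<lambda>y. C (ph y)) y (emb v) $ i" by (simp add: dgen_linear[OF that])
    also have "\<dots> = (\<Sum>f\<in>range Phi. emb v f * pd f (\<lambda>y. C (ph y) $ i) y)"
      unfolding dgen_def vec_lambda_beta
      by (rule sum.mono_neutral_right) (auto simp: finite_dep_var emb_def image_iff split: dep_var.splits)
    also have "\<dots> = (\<Sum>j\<in>UNIV. v $ j * pd (Phi j) (\<lambda>y. C (ph y) $ i) y)"
      by (subst sum.reindex) (auto simp: inj_def emb_def)
    finally show ?thesis ..
  qed
  show ?thesis
    by (rule ext) (simp add: lie_bracket_def vec_eq_iff sum_subtractf * assms)
qed

lemma lie_bracket_flow:
  "lie_bracket (flow a b c d) (flow a' b' c' d') =
    flow (2 * (b * c' - c * b')) (2 * (c * a' - a * c')) (2 * (a * b' - b * a')) 0"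
  unfolding flow_def lie_bracket_linear[OF linear_higgs linear_higgs]
  by (rule ext) (simp add: higgs_eq vec_eq_iff forall_8 algebra_simps)

lemma mat_commutator_flow_mat:
  "mat_commutator (flow_mat a b c d) (flow_mat a' b' c' d') =
    - flow_mat (2 * (b * c' - c * b')) (2 * (c * a' - a * c')) (2 * (a * b' - b * a')) 0"
  by (simp add: mat_commutator_def vec_eq_iff forall_2 matrix_matrix_mult_def sum_2 complex_eq_iff algebra_simps)

lemma flow_mat_add: "flow_mat a b c d + flow_mat a' b' c' d' = flow_mat (a + a') (b + b') (c + c') (d + d')"
  and flow_mat_scaleR: "r *\<^sub>R flow_mat a b c d = flow_mat (r * a) (r * b) (r * c) (r * d)"
  and flow_mat_minus: "- flow_mat a b c d = flow_mat (- a) (- b) (- c) (- d)"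
  and flow_mat_0: "flow_mat 0 0 0 0 = 0"
  by (simp_all add: vec_eq_iff forall_2 complex_eq_iff algebra_simps)

text \<open>The coefficients of a flow are read off from the images of two basis vectors. This makes
  sense for all generators, as a globally linear map is required.\<close>

definition coord1 :: "generator \<Rightarrow> real" where "coord1 X = - X (emb (axis 1 1)) $ 6"
definition coord2 :: "generator \<Rightarrow> real" where "coord2 X = - X (emb (axis 1 1)) $ 5"
definition coord3 :: "generator \<Rightarrow> real" where "coord3 X = (X (emb (axis 5 1)) $ 6 - X (emb (axis 1 1)) $ 2) / 2"
definition coord4 :: "generator \<Rightarrow> real" where "coord4 X = (X (emb (axis 5 1)) $ 6 + X (emb (axis 1 1)) $ 2) / 2"

lemma coord_flow [simp]:
  "coord1 (flow a b c d) = a" "coord2 (flow a b c d) = b" "coord3 (flow a b c d) = c" "coord4 (flow a b c d) = d"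
  by (simp_all add: coord1_def coord2_def coord3_def coord4_def flow_def higgs_eq axis_def emb_def)

lemma coord_linear [simp]:
  "coord1 (X + Z) = coord1 X + coord1 Z" "coord1 (r *\<^sub>R X) = r * coord1 X"
  "coord2 (X + Z) = coord2 X + coord2 Z" "coord2 (r *\<^sub>R X) = r * coord2 X"
  "coord3 (X + Z) = coord3 X + coord3 Z" "coord3 (r *\<^sub>R X) = r * coord3 X"
  "coord4 (X + Z) = coord4 X + coord4 Z" "coord4 (r *\<^sub>R X) = r * coord4 X"
  by (simp_all add: coord1_def coord2_def coord3_def coord4_def scaleR_fun_def field_simps)

section \<open>Matrix models of the abstract Lie algebras\<close>

lemma su2_eq: "su2 = {flow_mat a b c 0 | a b c. True}"
proof (intro set_eqI iffI)
  fix M assume "M \<in> su2"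
  then have M: "dagger M = - M" "trace M = 0" by (simp_all add: su2_def)
  obtain a b c d where abcd: "M = flow_mat a b c d" using antihermitian_flow_mat[OF M(1)] .
  then have "d = 0" using M(2) by (simp add: trace_def sum_2 complex_eq_iff)
  then show "M \<in> {flow_mat a b c 0 | a b c. True}" using abcd by blast
next
  fix M assume "M \<in> {flow_mat a b c 0 | a b c. True}"
  then show "M \<in> su2"
    by (auto simp: su2_def flow_mat_antihermitian trace_def sum_2 complex_eq_iff)
qed

lemma u1_eq: "u1 = {Complex 0 d | d. True}"
proof (intro set_eqI iffI)
  fix z assume "z \<in> u1"
  then have "z = Complex 0 (Im z)" by (simp add: u1_def complex_eq_iff)
  then show "z \<in> {Complex 0 d | d. True}" by blast
qed (auto simp: u1_def complex_eq_iff)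

lemma flow_mat_in_su2 [simp]: "flow_mat a b c 0 \<in> su2"
  unfolding su2_eq by blast

lemma Complex_in_u1 [simp]: "Complex 0 d \<in> u1"
  unfolding u1_eq by blast

lemma flow_in_span [simp]:
  "flow a b c d \<in> span {H1, H2, H3, X_Y}" "flow 0 0 c d \<in> span {H3, X_Y}" "flow 0 0 0 d \<in> span {X_Y}"
  unfolding span_generators by blast+

lemma su2E: "M \<in> su2 \<Longrightarrow> (\<And>a b c. M = flow_mat a b c 0 \<Longrightarrow> thesis) \<Longrightarrow> thesis"
  unfolding su2_eq by blast

lemma spanE:
  "X \<in> span {H1, H2, H3, X_Y} \<Longrightarrow> (\<And>a b c d. X = flow a b c d \<Longrightarrow> thesis) \<Longrightarrow> thesis"
  "X \<in> span {H3, X_Y} \<Longrightarrow> (\<And>c d. X = flow 0 0 c d \<Longrightarrow> thesis) \<Longrightarrow> thesis"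
  "X \<in> span {X_Y} \<Longrightarrow> (\<And>d. X = flow 0 0 0 d \<Longrightarrow> thesis) \<Longrightarrow> thesis"
  unfolding span_generators by blast+

lemma subspace_u1: "subspace u1"
  unfolding subspace_def by (auto simp: u1_def complex_eq_iff)

lemma subspace_su2: "subspace su2"
proof (rule subspaceI)
  show "0 \<in> su2" using flow_mat_in_su2[of 0 0 0] by (simp add: flow_mat_0)
  show "x + y \<in> su2" if "x \<in> su2" "y \<in> su2" for x y
    using that by (elim su2E) (simp add: flow_mat_add)
  show "r *\<^sub>R x \<in> su2" if "x \<in> su2" for x r
    using that by (elim su2E) (simp add: flow_mat_scaleR)
qed

lemma mat_commutator_su2: "A \<in> su2 \<Longrightarrow> B \<in> su2 \<Longrightarrow> mat_commutator A B \<in> su2"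
  by (elim su2E) (simp add: mat_commutator_flow_mat flow_mat_minus)

lemma abelian_u1: "lie_subalgebra abelian_bracket u1"
  using subspace_0[OF subspace_u1] by (simp add: lie_subalgebra_def subspace_u1 abelian_bracket_def)

lemma lie_subalgebra_product:
  assumes "lie_subalgebra br G" "lie_subalgebra br' G'"
  shows "lie_subalgebra (sum_bracket br br') (G \<times> G')"
  using assms by (auto simp: lie_subalgebra_def sum_bracket_def subspace_Times)

lemma lie_subalgebra_spans:
  "lie_subalgebra lie_bracket (span {H1, H2, H3, X_Y})"
  "lie_subalgebra lie_bracket (span {H3, X_Y})" "lie_subalgebra lie_bracket (span {X_Y})"
  unfolding lie_subalgebra_def by (auto elim!: spanE simp: lie_bracket_flow)

lemma lie_isoI:
  assumes "lie_subalgebra br G" "lie_subalgebra br' G'" and h: "linear h" "h ` G = G'"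
    and inj: "\<And>X. X \<in> G \<Longrightarrow> h X = 0 \<Longrightarrow> X = 0"
    and "\<And>X Z. X \<in> G \<Longrightarrow> Z \<in> G \<Longrightarrow> h (br X Z) = br' (h X) (h Z)"
  shows "lie_iso h br G br' G'"
proof -
  have "subspace G" using assms(1) by (simp add: lie_subalgebra_def)
  then have "inj_on h G"
    using inj by (simp add: linear_inj_on_iff_eq_0[OF h(1)] subspace_def)
  then show ?thesis using assms by (simp add: lie_iso_def bij_betw_def)
qed

lemma flow_0: "flow 0 0 0 0 = 0"
  by (simp add: flow_eq)

text \<open>The clauses on \<open>span {X_Y}\<close> identify the last u(1) factor with
  hypercharge.\<close>

lemma lie_isomorphisms:
  "\<exists>h. lie_iso h lie_bracket (span {H1, H2, H3, X_Y})
      (sum_bracket mat_commutator abelian_bracket) (su2 \<times> u1) \<and> h ` span {X_Y} = {0} \<times> u1"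
  "\<exists>h. lie_iso h lie_bracket (span {H3, X_Y})
      (sum_bracket abelian_bracket abelian_bracket) (u1 \<times> u1) \<and> h ` span {X_Y} = {0} \<times> u1"
  "\<exists>h. lie_iso h lie_bracket (span {X_Y}) abelian_bracket u1"
proof -
  have su2: "lie_subalgebra mat_commutator su2"
    by (simp add: lie_subalgebra_def subspace_su2 mat_commutator_su2)
  \<comment> \<open>The minus signs turn the opposite bracket of linear vector fields into the
    matrix commutator.\<close>
  define h1 where "h1 = (\<lambda>X. (flow_mat (- coord1 X) (- coord2 X) (- coord3 X) 0, Complex 0 (coord4 X)))"
  have h1: "h1 (flow a b c d) = (flow_mat (- a) (- b) (- c) 0, Complex 0 d)" for a b c d
    by (simp add: h1_def)
  have "lie_iso h1 lie_bracket (span {H1, H2, H3, X_Y}) (sum_bracket mat_commutator abelian_bracket) (su2 \<times> u1)"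
  proof (rule lie_isoI[OF lie_subalgebra_spans(1) lie_subalgebra_product[OF su2 abelian_u1]])
    show "linear h1"
      by (rule linearI) (simp_all add: h1_def flow_mat_add flow_mat_scaleR complex_eq_iff)
    have "(flow_mat a b c 0, Complex 0 d) \<in> h1 ` span {H1, H2, H3, X_Y}" for a b c d
      using imageI[OF flow_in_span(1), of h1 "- a" "- b" "- c" d] by (simp add: h1)
    then show "h1 ` span {H1, H2, H3, X_Y} = su2 \<times> u1"
      by (auto simp: h1 u1_eq elim!: spanE su2E)
  qed (auto elim!: spanE simp: lie_bracket_flow h1 sum_bracket_def abelian_bracket_def mat_commutator_flow_mat
      flow_mat_minus flow_0 zero_prod_def vec_eq_iff forall_2 complex_eq_iff)
  moreover have "h1 ` span {X_Y} = {0} \<times> u1"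
    by (simp add: span_generators u1_eq full_SetCompr_eq image_image h1 flow_mat_0) auto
  ultimately show "\<exists>h. lie_iso h lie_bracket (span {H1, H2, H3, X_Y})
      (sum_bracket mat_commutator abelian_bracket) (su2 \<times> u1) \<and> h ` span {X_Y} = {0} \<times> u1" by blast
  define h2 where "h2 = (\<lambda>X. (Complex 0 (coord3 X), Complex 0 (coord4 X)))"
  have h2: "h2 (flow a b c d) = (Complex 0 c, Complex 0 d)" for a b c d
    by (simp add: h2_def)
  have "lie_iso h2 lie_bracket (span {H3, X_Y}) (sum_bracket abelian_bracket abelian_bracket) (u1 \<times> u1)"
  proof (rule lie_isoI[OF lie_subalgebra_spans(2) lie_subalgebra_product[OF abelian_u1 abelian_u1]])
    show "linear h2"
      by (rule linearI) (simp_all add: h2_def complex_eq_iff)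
    have "(Complex 0 c, Complex 0 d) \<in> h2 ` span {H3, X_Y}" for c d
      using imageI[OF flow_in_span(2), of h2 c d] by (simp add: h2)
    then show "h2 ` span {H3, X_Y} = u1 \<times> u1"
      by (auto simp: h2 u1_eq elim!: spanE)
  qed (auto elim!: spanE simp: lie_bracket_flow h2 h2[of 0 0 0 0, unfolded flow_0] sum_bracket_def abelian_bracket_def flow_0
      zero_prod_def complex_eq_iff)
  moreover have "h2 ` span {X_Y} = {0} \<times> u1"
    by (simp add: span_generators u1_eq full_SetCompr_eq image_image h2) (auto simp: complex_eq_iff)
  ultimately show "\<exists>h. lie_iso h lie_bracket (span {H3, X_Y})
      (sum_bracket abelian_bracket abelian_bracket) (u1 \<times> u1) \<and> h ` span {X_Y} = {0} \<times> u1" by blast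
  define h3 where "h3 = (\<lambda>X. Complex 0 (coord4 X))"
  have h3: "h3 (flow a b c d) = Complex 0 d" for a b c d
    by (simp add: h3_def)
  have "lie_iso h3 lie_bracket (span {X_Y}) abelian_bracket u1"
  proof (rule lie_isoI[OF lie_subalgebra_spans(3) abelian_u1])
    show "linear h3"
      by (rule linearI) (simp_all add: h3_def complex_eq_iff)
    show "h3 ` span {X_Y} = u1"
      by (simp add: span_generators u1_eq full_SetCompr_eq image_image h3)
  qed (auto elim!: spanE simp: lie_bracket_flow h3 h3[of 0 0 0 0, unfolded flow_0] abelian_bracket_def flow_0 complex_eq_iff)
  then show "\<exists>h. lie_iso h lie_bracket (span {X_Y}) abelian_bracket u1" by blast
qed

theorem mainTheorem1:
  fixes g g' Y :: real
  assumes "g \<noteq> 0" and "g' \<noteq> 0" and "Y \<noteq> 0"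
  shows
    "(\<forall>P. g_svar (lagrangian g g' Y P) = g_var (lagrangian g g' Y P) \<and>
          g_var (lagrangian g g' Y P) = g_EL (lagrangian g g' Y P)) \<and>
     (\<forall>P. \<exists>U P'. higgs_basis_change g g' Y U P P' \<and>
          in_new_basis U (g_EL (lagrangian g g' Y P))
            \<in> {span {H1, H2, H3, X_Y}, span {H3, X_Y}, span {X_Y}}) \<and>
     (\<exists>P. g_EL (lagrangian g g' Y P) = span {H1, H2, H3, X_Y}) \<and>
     (\<exists>P. g_EL (lagrangian g g' Y P) = span {H3, X_Y}) \<and>
     (\<exists>P. g_EL (lagrangian g g' Y P) = span {X_Y}) \<and>
     (\<exists>h. lie_iso h lie_bracket (span {H1, H2, H3, X_Y})
            (sum_bracket mat_commutator abelian_bracket) (su2 \<times> u1) \<and>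
          h ` span {X_Y} = {0} \<times> u1) \<and>
     (\<exists>h. lie_iso h lie_bracket (span {H3, X_Y})
            (sum_bracket abelian_bracket abelian_bracket) (u1 \<times> u1) \<and>
          h ` span {X_Y} = {0} \<times> u1) \<and>
     (\<exists>h. lie_iso h lie_bracket (span {X_Y}) abelian_bracket u1)"
proof -
  interpret couplings g g' Y using assms by unfold_locales
  show ?thesis
    unfolding symmetry_algebras
    by (intro conjI allI refl flavour_classification lie_isomorphisms
        exI[of "\<lambda>P. flavour_symmetries P = span {H1, H2, H3, X_Y}", OF flavour_symmetries_examples(1)]
        exI[of "\<lambda>P. flavour_symmetries P = span {H3, X_Y}", OF flavour_symmetries_examples(2)]
        exI[of "\<lambda>P. flavour_symmetries P = span {X_Y}", OF flavour_symmetries_examples(3)])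
qed

end
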